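(* Let $\ell, r, t$ be positive integers with $t\ge 2$ and $r\ge 2t+3$. Then $$\mathrm{ex}(n, H^{\ell}_{r,t}) = O\!\left(n^{1+\frac{rt-1}{2rt+2r}}\right).$$
   Context: For a graph $H$, $\mathrm{ex}(n,H)$ is the maximum number of edges of an $n$-vertex graph that does not contain $H$ as a (not necessarily induced) subgraph. The implicit constant in $O(\cdot)$ may depend on $\ell,r,t$. $T_{r,t}$ is the height-two tree with vertex set $\{w\}\cup\{y_i: i\in[r]\}\cup\{z_{i,j}: i\in[r], j\in[t]\}$ and edge set $\{wy_i: i\in[r]\}\cup\{y_iz_{i,j}: i\in[r], j\in[t]\}$. $T'_{r,t}$ is obtained from $T_{r,t}$ by subdividing each edge exactly once. Let $R=\{z_{i,j}: i\in[r],j\in[t]\}$ be the set of leaves of $T'_{r,t}$. The graph $H^{\ell}_{r,t}$ is the $\ell$-th power of $T'_{r,t}$ rooted at $R$: it is the union of $\ell$ labeled copies of $T'_{r,t}$ such that, for each $v\in R$, the images of $v$ in all $\ell$ copies coincide, and the copies are pairwise vertex-disjoint outside the common image of $R$. *)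

theory Defs
  imports Complex_Main "HOL-Library.Landau_Symbols"
begin

datatype 'a graph = Graph (verts: "'a set") (edges: "'a set set")

definition simple_graph :: "'a graph \<Rightarrow> bool" where
  "simple_graph G \<longleftrightarrow> finite (verts G) \<and> (\<forall>e\<in>edges G. e \<subseteq> verts G \<and> card e = 2)"

definition contains_subgraph :: "'a graph \<Rightarrow> 'b graph \<Rightarrow> bool" where
  "contains_subgraph G H \<longleftrightarrow>
     (\<exists>f. inj_on f (verts H) \<and> f ` verts H \<subseteq> verts G \<and> (\<forall>e\<in>edges H. f ` e \<in> edges G))"

(* Every finite graph has an isomorphic copy with vertices in nat, so the host graphs may be
   taken there; see ex_upper below. If H has an edge, the edgeless graph shows that the maximum
   is over a nonempty set; see ex_attained. *)
definition ex :: "nat \<Rightarrow> 'b graph \<Rightarrow> nat" where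
  "ex n H = Max {card (edges G) | G :: nat graph.
     simple_graph G \<and> card (verts G) = n \<and> \<not> contains_subgraph G H}"

datatype tree_vertex = VW | VY nat | VZ nat nat

(* Index sets are {..<r} and {..<t} instead of {1..r} and {1..t}. *)
definition tree :: "nat \<Rightarrow> nat \<Rightarrow> tree_vertex graph" where
  "tree r t = Graph
     ({VW} \<union> {VY i | i. i < r} \<union> {VZ i j | i j. i < r \<and> j < t})
     ({{VW, VY i} | i. i < r} \<union> {{VY i, VZ i j} | i j. i < r \<and> j < t})"

(* Inl v is an original vertex, Inr e is the new vertex placed on the edge e. *)
definition subdivision :: "'a graph \<Rightarrow> ('a + 'a set) graph" where
  "subdivision G = Graph
     (Inl ` verts G \<union> Inr ` edges G)
     {{Inl v, Inr e} | v e. e \<in> edges G \<and> v \<in> e}"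

definition sub_tree :: "nat \<Rightarrow> nat \<Rightarrow> (tree_vertex + tree_vertex set) graph" where
  "sub_tree r t = subdivision (tree r t)"

definition sub_tree_leaves :: "nat \<Rightarrow> nat \<Rightarrow> (tree_vertex + tree_vertex set) set" where
  "sub_tree_leaves r t = {Inl (VZ i j) | i j. i < r \<and> j < t}"

(* The embedding of copy number c: roots go to a common vertex Inl v, every other vertex v
   to its own vertex Inr (v, c). *)
definition copy_map :: "'a set \<Rightarrow> nat \<Rightarrow> 'a \<Rightarrow> 'a + 'a \<times> nat" where
  "copy_map R c v = (if v \<in> R then Inl v else Inr (v, c))"

definition rooted_power :: "nat \<Rightarrow> 'a graph \<Rightarrow> 'a set \<Rightarrow> ('a + 'a \<times> nat) graph" where
  "rooted_power l G R = Graph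
     (\<Union>c<l. copy_map R c ` verts G)
     (\<Union>c<l. (\<lambda>e. copy_map R c ` e) ` edges G)"

definition H_graph ::
  "nat \<Rightarrow> nat \<Rightarrow> nat \<Rightarrow>
     ((tree_vertex + tree_vertex set) + (tree_vertex + tree_vertex set) \<times> nat) graph" where
  "H_graph l r t = rooted_power l (sub_tree r t) (sub_tree_leaves r t)"

lemma finite_edges:
  assumes "simple_graph G"
  shows "finite (edges G)"
  using assms unfolding simple_graph_def
  by (meson PowI finite_Pow_iff finite_subset subsetI)

lemma finite_edge_numbers:
  "finite {card (edges G) | G :: 'a graph. simple_graph G \<and> card (verts G) = n \<and> P G}"
proof (rule finite_subset)
  show "{card (edges G) | G :: 'a graph. simple_graph G \<and> card (verts G) = n \<and> P G} \<subseteq> {..2 ^ n}"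
  proof clarsimp
    fix G :: "'a graph" assume G: "simple_graph G"
    then have "edges G \<subseteq> Pow (verts G)" "finite (verts G)"
      by (auto simp: simple_graph_def)
    then show "card (edges G) \<le> 2 ^ card (verts G)"
      by (metis card_Pow card_mono finite_Pow_iff)
  qed
qed simp

lemma ex_upper:
  fixes G :: "'a graph"
  assumes G: "simple_graph G" and n: "card (verts G) = n" and free: "\<not> contains_subgraph G H"
  shows "card (edges G) \<le> ex n H"
proof -
  have fin: "finite (verts G)" using G by (simp add: simple_graph_def)
  obtain f :: "'a \<Rightarrow> nat" where f: "inj_on f (verts G)"
    using fin finite_imp_inj_to_nat_seg by blast
  define K where "K = Graph (f ` verts G) ((`) f ` edges G)"
  have sub: "e \<subseteq> verts G" "card e = 2" if "e \<in> edges G" for e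
    using G that by (auto simp: simple_graph_def)
  have K: "simple_graph K"
    unfolding simple_graph_def K_def graph.sel
  proof (intro conjI ballI)
    fix e assume "e \<in> (`) f ` edges G"
    then obtain e' where e': "e' \<in> edges G" "e = f ` e'" by blast
    show "e \<subseteq> f ` verts G" using sub(1)[OF e'(1)] e'(2) by blast
    show "card e = 2"
      using sub(2)[OF e'(1)] card_image[OF inj_on_subset[OF f sub(1)[OF e'(1)]]] e'(2) by simp
  qed (simp add: fin)
  have nK: "card (verts K) = n" using n f by (simp add: K_def card_image)
  have "inj_on ((`) f) (edges G)"
    by (rule inj_on_subset[OF inj_on_image_Pow[OF f]]) (use sub in auto)
  then have cK: "card (edges K) = card (edges G)"
    by (simp add: K_def card_image)
  have "\<not> contains_subgraph K H"
  proof
    assume "contains_subgraph K H"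
    then obtain h where "inj_on h (verts H) \<and> h ` verts H \<subseteq> verts K \<and> (\<forall>e\<in>edges H. h ` e \<in> edges K)"
      unfolding contains_subgraph_def by (elim exE)
    then have h: "inj_on h (verts H)" "h ` verts H \<subseteq> f ` verts G"
      "\<forall>e\<in>edges H. h ` e \<in> (`) f ` edges G"
      by (simp_all add: K_def)
    let ?g = "inv_into (verts G) f"
    have "inj_on (?g \<circ> h) (verts H)"
      by (rule comp_inj_on[OF h(1)]) (rule inj_on_inv_into[OF h(2)])
    moreover have "(?g \<circ> h) ` verts H \<subseteq> verts G"
      using h(2) by (simp add: image_subset_iff inv_into_into)
    moreover have "(?g \<circ> h) ` e \<in> edges G" if he: "e \<in> edges H" for e
    proof -
      obtain e' where e': "e' \<in> edges G" "h ` e = f ` e'"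
        using bspec[OF h(3) he] by (elim imageE)
      have "(?g \<circ> h) ` e = ?g ` (f ` e')" unfolding e'(2)[symmetric] by (rule image_comp[symmetric])
      also have "\<dots> = e'" by (rule inv_into_image_cancel[OF f sub(1)[OF e'(1)]])
      finally have "(?g \<circ> h) ` e = e'" .
      then show ?thesis using e' by simp
    qed
    ultimately have "contains_subgraph G H"
      unfolding contains_subgraph_def by (intro exI[of _ "?g \<circ> h"] conjI ballI)
    with free show False by contradiction
  qed
  then have "card (edges G) \<in> {card (edges G) | G :: nat graph.
     simple_graph G \<and> card (verts G) = n \<and> \<not> contains_subgraph G H}"
    using K nK by (intro CollectI exI[of _ K]) (simp add: cK)
  then show ?thesis
    unfolding ex_def by (rule Max_ge[OF finite_edge_numbers])
qed

lemma ex_attained: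
  assumes "edges H \<noteq> {}"
  shows "\<exists>G :: nat graph. simple_graph G \<and> card (verts G) = n \<and> \<not> contains_subgraph G H
           \<and> card (edges G) = ex n H"
proof -
  let ?S = "{card (edges G) | G :: nat graph.
     simple_graph G \<and> card (verts G) = n \<and> \<not> contains_subgraph G H}"
  have "simple_graph (Graph {..<n} {})" "\<not> contains_subgraph (Graph {..<n} {}) H"
    using assms by (auto simp: simple_graph_def contains_subgraph_def)
  then have "?S \<noteq> {}"
    by (smt (verit) card_lessThan empty_Collect_eq graph.sel(1))
  then have "ex n H \<in> ?S"
    unfolding ex_def by (intro Max_in finite_edge_numbers)
  then show ?thesis by auto
qed

lemma simple_graph_tree: "simple_graph (tree r t)"
proof -
  have "{VY i | i. i < r} = VY ` {..<r}" by auto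
  moreover have "{VZ i j | i j. i < r \<and> j < t} = (\<lambda>(i, j). VZ i j) ` ({..<r} \<times> {..<t})" by auto
  ultimately have "finite (verts (tree r t))" by (simp add: tree_def)
  then show ?thesis by (auto simp: simple_graph_def tree_def)
qed

lemma simple_graph_subdivision:
  assumes "simple_graph G"
  shows "simple_graph (subdivision G)"
  using assms finite_edges[OF assms] by (auto simp: simple_graph_def subdivision_def)

lemma simple_graph_rooted_power:
  assumes "simple_graph G"
  shows "simple_graph (rooted_power l G R)"
proof -
  have inj: "inj (copy_map R c)" for c
    by (rule injI) (auto simp: copy_map_def split: if_splits)
  have card: "card (copy_map R c ` e) = card e" for c e
    by (rule card_image) (rule inj_on_subset[OF inj subset_UNIV])
  have sub: "copy_map R c ` e \<subseteq> copy_map R c ` verts G" if "e \<in> edges G" for c e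
    using assms that by (auto simp: simple_graph_def)
  show ?thesis
    unfolding simple_graph_def
  proof (intro conjI ballI)
    show "finite (verts (rooted_power l G R))"
      using assms by (simp add: simple_graph_def rooted_power_def)
  next
    fix e assume "e \<in> edges (rooted_power l G R)"
    then obtain c e' where e: "c < l" "e' \<in> edges G" "e = copy_map R c ` e'"
      by (auto simp: rooted_power_def)
    show "e \<subseteq> verts (rooted_power l G R)"
      using sub[OF e(2), of c] e(1,3) unfolding rooted_power_def graph.sel by blast
    show "card e = 2"
      using assms e card by (simp add: simple_graph_def)
  qed
qed

lemma simple_graph_H_graph: "simple_graph (H_graph l r t)"
  unfolding H_graph_def sub_tree_def
  by (intro simple_graph_rooted_power simple_graph_subdivision simple_graph_tree)

lemma edges_H_graph:
  assumes "l \<ge> 1" "r \<ge> 1"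
  shows "edges (H_graph l r t) \<noteq> {}"
proof -
  have "{VW, VY 0} \<in> edges (tree r t)" using assms by (auto simp: tree_def)
  then have "{Inl VW, Inr {VW, VY 0}} \<in> edges (sub_tree r t)"
    by (auto simp: sub_tree_def subdivision_def)
  then have "copy_map (sub_tree_leaves r t) 0 ` {Inl VW, Inr {VW, VY 0}} \<in> edges (H_graph l r t)"
    unfolding H_graph_def rooted_power_def graph.sel
    by (intro UN_I[of 0] imageI) (use assms in auto)
  then show ?thesis by blast
qed


end

(*
The proof follows the second moment method. Let Delta be the maximum degree of an H-free graph on n
vertices that has been made almost regular. A Ramsey argument shows that H-freeness excludes large
families of pairs with many common neighbours, and that a positive fraction of the (t+1)-tuples of
common second neighbours of two vertices are not the ends of many disjoint spiders; this bounds the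
moments of the numbers of common second neighbours.
Hence, after removing a few exceptional vertices, there are about n Delta^((2t+2) r) copies of the
subdivided tree T'. Group them by their rt leaves. Since H does not occur, a positive
fraction of the pairs of copies in one group is degenerate or shares a vertex besides the leaves, and
the moment bounds show that then the sum of the squares of the group sizes is at most
C n Delta^((2t+2) r). Comparing with the lower bound from Cauchy-Schwarz over at most n^(rt) groups
gives Delta^((2t+2) r) <= C n^(rt-1).
*)
theory Submission
  imports Defs "HOL-Analysis.Convex" "HOL-Library.Ramsey" "HOL-Library.FuncSet"
begin

section \<open>Sampling and selection\<close>

text \<open>Write D for \<Delta>^(2 t + 2), the order of the number of branches at one root. The
  second moment bound aims at n D^r, the order of what the pairs of equal trees contribute alone.
  The obstacle is pairs of vertices with very many common neighbours: they spoil every count and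
  cannot simply be deleted. But heavy cliques of bounded size do not occur, so any long enough list
  of vertices has two entries that are equal or light. By sampling, a constant fraction of all pairs
  is equal or light, also inside a fibre and under finitely many such conditions at once; only these
  are counted. The exponent t + 1 of the moments is the degree of y_i in T'. Pairs of trees that
  meet are counted with a free factor A: A times their number is at most a fixed multiple of the
  second moment plus a constant depending on A times n D^r. This rests on A x y^(r-1) <= y^r + (A
  x)^r, with y the number of branch pairs with equal leaves. For large A the second moment terms are
  absorbed by the left side.\<close>

lemma sum_mult_power_le:
  fixes p :: "'a \<Rightarrow> real"
  assumes "finite A" and nn: "\<And>x. x \<in> A \<Longrightarrow> 0 \<le> p x"
  shows "(\<Sum>x\<in>A. p x ^ n) * (\<Sum>x\<in>A. p x) \<le> real (card A) * (\<Sum>x\<in>A. p x ^ Suc n)"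
proof -
  \<comment> \<open>Chebyshev's sum inequality: both factors have the same sign, and summing over
    all pairs x, y gives twice the difference of the two sides.\<close>
  have "0 \<le> (p x ^ n - p y ^ n) * (p x - p y)" if "x \<in> A" "y \<in> A" for x y
  proof (cases "p x \<le> p y")
    case True
    then have "p x ^ n \<le> p y ^ n" using nn that by (intro power_mono) auto
    with True show ?thesis by (intro mult_nonpos_nonpos) auto
  next
    case False
    then have "p y ^ n \<le> p x ^ n" using nn that by (intro power_mono) auto
    with False show ?thesis by (intro mult_nonneg_nonneg) auto
  qed
  then have "0 \<le> (\<Sum>x\<in>A. \<Sum>y\<in>A. (p x ^ n - p y ^ n) * (p x - p y))"
    by (intro sum_nonneg) auto
  also have "\<dots> = (\<Sum>x\<in>A. \<Sum>y\<in>A. p x ^ Suc n) + (\<Sum>x\<in>A. \<Sum>y\<in>A. p y ^ Suc n)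
      - (\<Sum>x\<in>A. \<Sum>y\<in>A. p x ^ n * p y) - (\<Sum>x\<in>A. \<Sum>y\<in>A. p y ^ n * p x)"
  proof -
    have "(p x ^ n - p y ^ n) * (p x - p y) = p x ^ Suc n + p y ^ Suc n - p x ^ n * p y - p y ^ n * p x" for x y
      by (simp add: algebra_simps)
    then show ?thesis by (simp only: sum.distrib sum_subtractf)
  qed
  also have "(\<Sum>x\<in>A. \<Sum>y\<in>A. p y ^ n * p x) = (\<Sum>x\<in>A. \<Sum>y\<in>A. p x ^ n * p y)"
    by (rule sum.swap)
  also have "(\<Sum>x\<in>A. \<Sum>y\<in>A. p x ^ n * p y) = (\<Sum>x\<in>A. p x ^ n) * (\<Sum>x\<in>A. p x)"
    by (simp add: sum_product)
  also have "(\<Sum>x\<in>A. \<Sum>y\<in>A. p x ^ Suc n) = real (card A) * (\<Sum>x\<in>A. p x ^ Suc n)"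
    by (simp only: sum_constant sum_distrib_left)
  also have "(\<Sum>x\<in>A. \<Sum>y\<in>A. p y ^ Suc n) = real (card A) * (\<Sum>x\<in>A. p x ^ Suc n)"
    by (simp only: sum_constant)
  finally show ?thesis by linarith
qed

text \<open>The power mean inequality, by induction: each further factor is absorbed with
  \<open>sum_mult_power_le\<close>.\<close>

lemma power_sum_le:
  fixes p :: "'a \<Rightarrow> real"
  assumes "finite A" and nn: "\<And>x. x \<in> A \<Longrightarrow> 0 \<le> p x"
  shows "(\<Sum>x\<in>A. p x) ^ Suc n \<le> real (card A) ^ n * (\<Sum>x\<in>A. p x ^ Suc n)"
proof (induction n)
  case (Suc n)
  have s: "0 \<le> (\<Sum>x\<in>A. p x)" using nn by (intro sum_nonneg) auto
  have "(\<Sum>x\<in>A. p x) ^ Suc (Suc n) = (\<Sum>x\<in>A. p x) ^ Suc n * (\<Sum>x\<in>A. p x)" by simp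
  also have "\<dots> \<le> real (card A) ^ n * (\<Sum>x\<in>A. p x ^ Suc n) * (\<Sum>x\<in>A. p x)"
    by (intro mult_right_mono Suc.IH s)
  also have "\<dots> \<le> real (card A) ^ n * (real (card A) * (\<Sum>x\<in>A. p x ^ Suc (Suc n)))"
    using mult_left_mono[OF sum_mult_power_le[OF assms, where n = "Suc n"], where c = "real (card A) ^ n"]
    by (simp only: mult.assoc) simp
  finally show ?case by (simp only: power_Suc2 mult.assoc)
qed simp

lemma power_sum_le':
  fixes p :: "'a \<Rightarrow> real"
  assumes "finite A" and "\<And>x. x \<in> A \<Longrightarrow> 0 \<le> p x" and "n \<ge> 1"
  shows "(\<Sum>x\<in>A. p x) ^ n \<le> real (card A) ^ (n - 1) * (\<Sum>x\<in>A. p x ^ n)"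
proof -
  have "Suc (n - 1) = n" using assms(3) by simp
  then show ?thesis using power_sum_le[OF assms(1,2), where n = "n - 1"] by (simp only:)
qed

text \<open>A form of Young's inequality with crude constants: the product is at most the power of
  the larger of \<open>A * x\<close> and \<open>y\<close>. The factor \<open>A\<close> lands on the
  \<open>x\<close> term only, which later allows the \<open>y\<close> term to be absorbed.\<close>

lemma split_power_le:
  fixes x y A :: real
  assumes "0 \<le> x" "0 \<le> y" "0 \<le> A"
  shows "A * (x * y ^ n) \<le> y ^ Suc n + (A * x) ^ Suc n"
proof (cases "A * x \<le> y")
  case True
  then have "(A * x) * y ^ n \<le> y * y ^ n" using assms by (intro mult_right_mono) auto
  moreover have "0 \<le> (A * x) ^ Suc n" using assms by (intro zero_le_power mult_nonneg_nonneg)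
  ultimately show ?thesis by (simp add: algebra_simps)
next
  case False
  then have "(A * x) * y ^ n \<le> (A * x) * (A * x) ^ n"
    using assms by (intro mult_left_mono power_mono mult_nonneg_nonneg) auto
  moreover have "0 \<le> y ^ Suc n" using assms by simp
  ultimately show ?thesis by (simp add: algebra_simps)
qed

text \<open>Fix all coordinates except \<open>j\<close>; the condition \<open>S\<close> may depend
  on them and leaves at most \<open>c\<close> values for \<open>f j\<close>.\<close>

lemma card_PiE_coord_le:
  assumes I: "finite I" and j: "j \<in> I" and A: "finite A"
    and S: "\<And>g. card {b \<in> A. S g b} \<le> c"
  shows "card {f \<in> I \<rightarrow>\<^sub>E A. S (restrict f (I - {j})) (f j)} \<le> c * card A ^ (card I - 1)"
proof -
  let ?X = "{f \<in> I \<rightarrow>\<^sub>E A. S (restrict f (I - {j})) (f j)}"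
  let ?Y = "Sigma ((I - {j}) \<rightarrow>\<^sub>E A) (\<lambda>g. {b \<in> A. S g b})"
  let ?h = "\<lambda>f. (restrict f (I - {j}), f j)"
  have fin: "finite ((I - {j}) \<rightarrow>\<^sub>E A)" using I A by (intro finite_PiE) auto
  have "inj_on ?h ?X"
  proof (rule inj_onI)
    fix f g assume f: "f \<in> ?X" and g: "g \<in> ?X" and eq: "?h f = ?h g"
    show "f = g"
    proof (rule PiE_ext[of f I "\<lambda>_. A" g])
      fix x assume "x \<in> I"
      then show "f x = g x" using eq by (cases "x = j") (auto simp: restrict_def fun_eq_iff split: if_splits)
    qed (use f g in auto)
  qed
  moreover have "?h ` ?X \<subseteq> ?Y"
  proof (rule image_subsetI)
    fix f assume f: "f \<in> ?X"
    then have "restrict f (I - {j}) \<in> (I - {j}) \<rightarrow>\<^sub>E A" by (simp add: PiE_iff)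
    moreover have "f j \<in> {b \<in> A. S (restrict f (I - {j})) b}" using f j by (simp add: PiE_iff)
    ultimately show "?h f \<in> ?Y" by (simp only: mem_Sigma_iff)
  qed
  moreover have "finite ?Y" using fin A by auto
  ultimately have "card ?X \<le> card ?Y" by (intro card_inj_on_le)
  also have "\<dots> = (\<Sum>g\<in>(I - {j}) \<rightarrow>\<^sub>E A. card {b \<in> A. S g b})" using fin A by (intro card_SigmaI) auto
  also have "\<dots> \<le> (\<Sum>g\<in>(I - {j}) \<rightarrow>\<^sub>E A. c)" by (intro sum_mono S)
  also have "\<dots> = c * card A ^ (card I - 1)" using I j by (simp add: card_funcsetE)
  finally show ?thesis .
qed

lemma card_PiE_elem_le:
  assumes "finite I" and "j \<in> I" and "finite A"
  shows "card {f \<in> I \<rightarrow>\<^sub>E A. f j \<in> B} \<le> card (A \<inter> B) * card A ^ (card I - 1)"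
proof (rule card_PiE_coord_le[OF assms])
  have "{b \<in> A. b \<in> B} = A \<inter> B" by auto
  then show "card {b \<in> A. b \<in> B} \<le> card (A \<inter> B)" by simp
qed

lemma card_PiE_rel_le:
  assumes "finite I" and "i \<in> I" and "j \<in> I" and "i \<noteq> j" and A: "finite A"
    and Q: "\<And>a. a \<in> A \<Longrightarrow> card {b \<in> A. Q a b} \<le> c"
  shows "card {f \<in> I \<rightarrow>\<^sub>E A. Q (f i) (f j)} \<le> c * card A ^ (card I - 1)"
proof -
  have "card {b \<in> A. g i \<in> A \<and> Q (g i) b} \<le> c" for g
    using Q[of "g i"] by (cases "g i \<in> A") auto
  then have "card {f \<in> I \<rightarrow>\<^sub>E A. restrict f (I - {j}) i \<in> A \<and> Q (restrict f (I - {j}) i) (f j)}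
      \<le> c * card A ^ (card I - 1)"
    using card_PiE_coord_le[of I j A "\<lambda>g b. g i \<in> A \<and> Q (g i) b" c] assms by simp
  moreover have "{f \<in> I \<rightarrow>\<^sub>E A. restrict f (I - {j}) i \<in> A \<and> Q (restrict f (I - {j}) i) (f j)}
      = {f \<in> I \<rightarrow>\<^sub>E A. Q (f i) (f j)}"
    using assms by auto
  ultimately show ?thesis by simp
qed

text \<open>Splits a tuple into the coordinates read through \<open>g\<close>, which carry the
  pattern, and the remaining ones, which are free.\<close>

lemma card_PiE_comp_le:
  assumes I: "finite I" and A: "finite A" and g: "inj_on g J" "g ` J \<subseteq> I"
  shows "card {f \<in> I \<rightarrow>\<^sub>E A. P (restrict (f \<circ> g) J)}
    \<le> card {\<tau> \<in> J \<rightarrow>\<^sub>E A. P \<tau>} * card A ^ (card I - card J)"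
proof -
  let ?X = "{f \<in> I \<rightarrow>\<^sub>E A. P (restrict (f \<circ> g) J)}"
  let ?Y = "{\<tau> \<in> J \<rightarrow>\<^sub>E A. P \<tau>} \<times> ((I - g ` J) \<rightarrow>\<^sub>E A)"
  let ?h = "\<lambda>f. (restrict (f \<circ> g) J, restrict f (I - g ` J))"
  have J: "finite J" using g I by (metis finite_imageD finite_subset)
  have "inj_on ?h ?X"
  proof (rule inj_onI)
    fix f f' assume f: "f \<in> ?X" and f': "f' \<in> ?X" and eq: "?h f = ?h f'"
    show "f = f'"
    proof (rule PiE_ext[of f I "\<lambda>_. A" f'])
      fix x assume x: "x \<in> I"
      show "f x = f' x"
      proof (cases "x \<in> g ` J")
        case True
        then obtain y where "y \<in> J" "x = g y" by auto
        then show ?thesis using eq by (auto simp: restrict_def fun_eq_iff split: if_splits)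
      next
        case False
        then show ?thesis using eq x by (auto simp: restrict_def fun_eq_iff split: if_splits)
      qed
    qed (use f f' in auto)
  qed
  moreover have "?h ` ?X \<subseteq> ?Y"
  proof (rule image_subsetI)
    fix f assume f: "f \<in> ?X"
    have "restrict (f \<circ> g) J \<in> {\<tau> \<in> J \<rightarrow>\<^sub>E A. P \<tau>}" using f g(2) by (auto simp: PiE_iff)
    moreover have "restrict f (I - g ` J) \<in> (I - g ` J) \<rightarrow>\<^sub>E A" using f by (simp add: PiE_iff)
    ultimately show "?h f \<in> ?Y" by (simp only: mem_Sigma_iff)
  qed
  moreover have "finite ?Y" using I A J by (intro finite_cartesian_product) (auto intro!: finite_PiE)
  ultimately have "card ?X \<le> card ?Y" by (intro card_inj_on_le)
  also have "\<dots> = card {\<tau> \<in> J \<rightarrow>\<^sub>E A. P \<tau>} * card A ^ (card I - card J)"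
    using I J g by (simp add: card_cartesian_product card_funcsetE card_Diff_subset card_image)
  finally show ?thesis .
qed

text \<open>Sample \<open>card I\<close> elements independently: a pattern that is forced in every sample
  is matched by a constant fraction of all short tuples.\<close>

lemma sampling:
  assumes I: "finite I" and J: "finite J" and A: "finite A"
    and ex: "\<And>f. f \<in> I \<rightarrow>\<^sub>E A \<Longrightarrow> Q f \<or> (\<exists>g. inj_on g J \<and> g ` J \<subseteq> I \<and> P (restrict (f \<circ> g) J))"
  shows "card A ^ card I \<le> card {f \<in> I \<rightarrow>\<^sub>E A. Q f}
      + card I ^ card J * (card {\<tau> \<in> J \<rightarrow>\<^sub>E A. P \<tau>} * card A ^ (card I - card J))"
proof -
  let ?G = "{g \<in> J \<rightarrow>\<^sub>E I. inj_on g J}"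
  let ?F = "\<lambda>g. {f \<in> I \<rightarrow>\<^sub>E A. P (restrict (f \<circ> g) J)}"
  have finG: "finite ?G" and cG: "card ?G \<le> card I ^ card J"
  proof -
    have f: "finite (J \<rightarrow>\<^sub>E I)" using I J by (intro finite_PiE) auto
    then show "finite ?G" by simp
    have "card ?G \<le> card (J \<rightarrow>\<^sub>E I)" using f by (intro card_mono) auto
    then show "card ?G \<le> card I ^ card J" using J by (simp add: card_funcsetE)
  qed
  have finF: "finite (I \<rightarrow>\<^sub>E A)" using I A by (intro finite_PiE) auto
  have "I \<rightarrow>\<^sub>E A \<subseteq> {f \<in> I \<rightarrow>\<^sub>E A. Q f} \<union> (\<Union>g\<in>?G. ?F g)"
  proof
    fix f assume f: "f \<in> I \<rightarrow>\<^sub>E A"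
    show "f \<in> {f \<in> I \<rightarrow>\<^sub>E A. Q f} \<union> (\<Union>g\<in>?G. ?F g)"
    proof (cases "Q f")
      case False
      then obtain g where g: "inj_on g J" "g ` J \<subseteq> I" "P (restrict (f \<circ> g) J)"
        using ex[OF f] by auto
      have "restrict (f \<circ> restrict g J) J = restrict (f \<circ> g) J" by (auto simp: restrict_def)
      then have "f \<in> ?F (restrict g J)" using f g by simp
      moreover have "restrict g J \<in> ?G" using g by (auto simp: inj_on_def)
      ultimately show ?thesis by blast
    qed (use f in auto)
  qed
  then have "card (I \<rightarrow>\<^sub>E A) \<le> card ({f \<in> I \<rightarrow>\<^sub>E A. Q f} \<union> (\<Union>g\<in>?G. ?F g))"
    using finF finG by (intro card_mono) auto
  also have "\<dots> \<le> card {f \<in> I \<rightarrow>\<^sub>E A. Q f} + card (\<Union>g\<in>?G. ?F g)" by (rule card_Un_le)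
  also have "card (\<Union>g\<in>?G. ?F g) \<le> (\<Sum>g\<in>?G. card (?F g))" by (rule card_UN_le[OF finG])
  also have "\<dots> \<le> (\<Sum>g\<in>?G. card {\<tau> \<in> J \<rightarrow>\<^sub>E A. P \<tau>} * card A ^ (card I - card J))"
  proof (rule sum_mono)
    fix g assume "g \<in> ?G"
    then show "card (?F g) \<le> card {\<tau> \<in> J \<rightarrow>\<^sub>E A. P \<tau>} * card A ^ (card I - card J)"
      by (intro card_PiE_comp_le I A) auto
  qed
  also have "\<dots> \<le> card I ^ card J * (card {\<tau> \<in> J \<rightarrow>\<^sub>E A. P \<tau>} * card A ^ (card I - card J))"
    using cG by simp
  finally show ?thesis using I by (simp add: card_funcsetE)
qed

text \<open>Sampling for patterns of length two. The indices \<open>i\<close> and \<open>j\<close>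
  differ but the entries may agree, so \<open>P\<close> holds on the diagonal of \<open>A\<close> as
  well and diagonal pairs are counted.\<close>

lemma pair_sampling:
  assumes A: "finite A"
    and ex: "\<And>f. f \<in> {..<R::nat} \<rightarrow>\<^sub>E A \<Longrightarrow> \<exists>i<R. \<exists>j<R. i \<noteq> j \<and> P (f i) (f j)"
  shows "card A ^ 2 \<le> R ^ 2 * card {(a, b) \<in> A \<times> A. P a b}"
proof (cases "A = {}")
  case False
  then have scattered_hubs: "card A > 0" using A by (simp add: card_gt_0_iff)
  let ?J = "{0, 1::nat}"
  obtain a0 where a0: "a0 \<in> A" using False by auto
  \<comment> \<open>A constant tuple already yields two distinct indices below
    \<open>R\<close>.\<close>
  have R2: "R \<ge> 2"
  proof -
    have "(\<lambda>i\<in>{..<R}. a0) \<in> {..<R} \<rightarrow>\<^sub>E A" using a0 by simp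
    from ex[OF this] obtain i j where "i < R" "j < R" "i \<noteq> j" by blast
    then show ?thesis by linarith
  qed
  have "card A ^ card {..<R} \<le> card {f \<in> {..<R} \<rightarrow>\<^sub>E A. False}
      + card {..<R} ^ card ?J * (card {\<tau> \<in> ?J \<rightarrow>\<^sub>E A. P (\<tau> 0) (\<tau> 1)} * card A ^ (card {..<R} - card ?J))"
  proof (rule sampling[where P = "\<lambda>\<tau>. P (\<tau> 0) (\<tau> 1)" and Q = "\<lambda>_. False"])
    fix f assume "f \<in> {..<R} \<rightarrow>\<^sub>E A"
    from ex[OF this] obtain i j where ij: "i < R" "j < R" "i \<noteq> j" "P (f i) (f j)" by auto
    define g where "g = (\<lambda>x::nat. if x = 0 then i else j)"
    have "inj_on g ?J" "g ` ?J \<subseteq> {..<R}" using ij by (auto simp: g_def inj_on_def)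
    moreover have "P (restrict (f \<circ> g) ?J 0) (restrict (f \<circ> g) ?J 1)" using ij by (simp add: g_def)
    ultimately show "False \<or> (\<exists>g. inj_on g ?J \<and> g ` ?J \<subseteq> {..<R} \<and> P (restrict (f \<circ> g) ?J 0) (restrict (f \<circ> g) ?J 1))"
      by (intro disjI2 exI[of _ g] conjI)
  qed (use A in auto)
  then have "card A ^ R \<le> R ^ 2 * (card {\<tau> \<in> ?J \<rightarrow>\<^sub>E A. P (\<tau> 0) (\<tau> 1)} * card A ^ (R - 2))"
    by (simp add: numeral_2_eq_2)
  moreover have "card A ^ R = card A ^ 2 * card A ^ (R - 2)"
    using R2 by (metis le_add_diff_inverse power_add)
  ultimately have "card A ^ 2 * card A ^ (R - 2) \<le> (R ^ 2 * card {\<tau> \<in> ?J \<rightarrow>\<^sub>E A. P (\<tau> 0) (\<tau> 1)}) * card A ^ (R - 2)"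
    by (simp add: mult.assoc)
  then have "card A ^ 2 \<le> R ^ 2 * card {\<tau> \<in> ?J \<rightarrow>\<^sub>E A. P (\<tau> 0) (\<tau> 1)}"
    using scattered_hubs by simp
  also have "card {\<tau> \<in> ?J \<rightarrow>\<^sub>E A. P (\<tau> 0) (\<tau> 1)} \<le> card {(a, b) \<in> A \<times> A. P a b}"
  proof (rule card_inj_on_le[where f = "\<lambda>\<tau>. (\<tau> 0, \<tau> 1)"])
    show "inj_on (\<lambda>\<tau>. (\<tau> 0, \<tau> 1)) {\<tau> \<in> ?J \<rightarrow>\<^sub>E A. P (\<tau> 0) (\<tau> 1)}"
      by (rule inj_onI, rule PiE_ext[where k = ?J and s = "\<lambda>_. A"]) auto
    show "finite {(a, b) \<in> A \<times> A. P a b}"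
      by (rule finite_subset[of _ "A \<times> A"]) (use A in auto)
  qed (auto simp: PiE_iff)
  finally show ?thesis by simp
qed simp

text \<open>\<open>pair_sampling\<close> inside every fibre of \<open>h\<close>: demanding
  \<open>P\<close> on top of \<open>h a = h b\<close> costs only the factor
  \<open>R ^ 2\<close>.\<close>

lemma fiber_pair_sampling:
  assumes A: "finite A"
    and ex: "\<And>v f. f \<in> {..<R::nat} \<rightarrow>\<^sub>E {a \<in> A. h a = v} \<Longrightarrow> \<exists>i<R. \<exists>j<R. i \<noteq> j \<and> P (f i) (f j)"
  shows "card {(a, b) \<in> A \<times> A. h a = h b} \<le> R ^ 2 * card {(a, b) \<in> A \<times> A. h a = h b \<and> P a b}"
proof -
  let ?F = "\<lambda>v. {a \<in> A. h a = v}"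
  have eq1: "{(a, b) \<in> A \<times> A. h a = h b} = (\<Union>v\<in>h ` A. ?F v \<times> ?F v)" by auto
  have eq2: "{(a, b) \<in> A \<times> A. h a = h b \<and> P a b} = (\<Union>v\<in>h ` A. {(a, b) \<in> ?F v \<times> ?F v. P a b})" by auto
  have fin: "finite {(a, b) \<in> ?F v \<times> ?F v. P a b}" for v
    by (rule finite_subset[of _ "A \<times> A"]) (use A in auto)
  have "card {(a, b) \<in> A \<times> A. h a = h b} = (\<Sum>v\<in>h ` A. card (?F v \<times> ?F v))"
    unfolding eq1 using A by (intro card_UN_disjoint) auto
  also have "\<dots> = (\<Sum>v\<in>h ` A. card (?F v) ^ 2)" by (simp add: card_cartesian_product power2_eq_square)
  also have "\<dots> \<le> (\<Sum>v\<in>h ` A. R ^ 2 * card {(a, b) \<in> ?F v \<times> ?F v. P a b})"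
    using A by (intro sum_mono pair_sampling ex) auto
  also have "\<dots> = R ^ 2 * card {(a, b) \<in> A \<times> A. h a = h b \<and> P a b}"
    unfolding eq2 using A fin by (subst card_UN_disjoint) (auto simp: sum_distrib_left)
  finally show ?thesis .
qed

text \<open>For each value, the product of the two fibre sizes is at most the sum of their squares.
  Thus a coincidence at two different positions is charged to coincidences at equal
  positions.\<close>

lemma card_collision_le:
  assumes A: "finite A"
  shows "card {(a, b) \<in> A \<times> A. f a = g b}
    \<le> card {(a, b) \<in> A \<times> A. f a = f b} + card {(a, b) \<in> A \<times> A. g a = g b}"
proof -
  let ?V = "f ` A \<union> g ` A"
  have c: "card {(a, b) \<in> A \<times> A. p a = q b} = (\<Sum>v\<in>?V. card {a \<in> A. p a = v} * card {a \<in> A. q a = v})"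
    if "p = f \<or> p = g" for p q
  proof -
    have eq: "{(a, b) \<in> A \<times> A. p a = q b} = (\<Union>v\<in>?V. {a \<in> A. p a = v} \<times> {a \<in> A. q a = v})"
      using that by auto
    show ?thesis unfolding eq using A by (subst card_UN_disjoint) (auto simp: card_cartesian_product)
  qed
  have am: "x * y \<le> x * x + y * y" for x y :: nat
  proof (cases "x \<le> y")
    case True
    then show ?thesis by (meson mult_le_mono1 trans_le_add2)
  next
    case False
    then show ?thesis by (meson mult_le_mono2 nat_le_linear trans_le_add1)
  qed
  show ?thesis
    unfolding c[of f g, OF disjI1[OF refl]] c[of f f, OF disjI1[OF refl]] c[of g g, OF disjI2[OF refl]]
      sum.distrib[symmetric]
    by (intro sum_mono am)
qed

text \<open>While one object is chosen, at most card I - 1 others are in place, each with at most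
  \<open>q\<close> vertices; hence the bound on the forbidden set \<open>B\<close>.\<close>

lemma greedy_choice:
  assumes I: "finite I" and B0: "finite B0"
    and ex: "\<And>x B. \<lbrakk>x \<in> I; finite B; card B \<le> card B0 + q * card I - q\<rbrakk> \<Longrightarrow>
      \<exists>ob. Ok x ob \<and> finite (vs ob) \<and> card (vs ob) \<le> q \<and> vs ob \<inter> B = {}"
  shows "\<exists>c. (\<forall>x\<in>I. Ok x (c x) \<and> vs (c x) \<inter> B0 = {}) \<and>
    (\<forall>x\<in>I. \<forall>y\<in>I. x \<noteq> y \<longrightarrow> vs (c x) \<inter> vs (c y) = {})"
proof -
  have "\<exists>c. (\<forall>x\<in>I'. Ok x (c x) \<and> finite (vs (c x)) \<and> card (vs (c x)) \<le> q \<and> vs (c x) \<inter> B0 = {}) \<and>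
    (\<forall>x\<in>I'. \<forall>y\<in>I'. x \<noteq> y \<longrightarrow> vs (c x) \<inter> vs (c y) = {})" if "finite I'" "I' \<subseteq> I" for I'
    using that
  proof (induction I')
    case (insert x I')
    then obtain c where c: "\<forall>x\<in>I'. Ok x (c x) \<and> finite (vs (c x)) \<and> card (vs (c x)) \<le> q \<and> vs (c x) \<inter> B0 = {}"
      "\<forall>x\<in>I'. \<forall>y\<in>I'. x \<noteq> y \<longrightarrow> vs (c x) \<inter> vs (c y) = {}" by auto
    define B where "B = B0 \<union> (\<Union>y\<in>I'. vs (c y))"
    have "card I' < card I" using insert I by (intro psubset_card_mono) auto
    then have qI: "q * card I' \<le> q * card I - q"
      by (metis Suc_leI add_diff_cancel_left' diff_le_mono mult_Suc_right mult_le_mono2)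
    have "card B \<le> card B0 + card (\<Union>y\<in>I'. vs (c y))" unfolding B_def by (rule card_Un_le)
    also have "card (\<Union>y\<in>I'. vs (c y)) \<le> (\<Sum>y\<in>I'. card (vs (c y)))"
      by (rule card_UN_le) (use insert in auto)
    also have "\<dots> \<le> (\<Sum>y\<in>I'. q)" using c by (intro sum_mono) auto
    finally have "card B \<le> card B0 + q * card I'" by (simp add: mult.commute)
    moreover have "q * card I \<ge> q" using \<open>card I' < card I\<close> by (cases "card I") auto
    ultimately have "card B \<le> card B0 + q * card I - q" using qI by linarith
    moreover have "finite B" unfolding B_def using B0 insert c by auto
    ultimately obtain ob where ob: "Ok x ob" "finite (vs ob)" "card (vs ob) \<le> q" "vs ob \<inter> B = {}"
      using ex[of x B] insert by auto
    have ne: "y \<noteq> x" if "y \<in> I'" for y using that insert by auto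
    show ?case
      by (rule exI[of _ "c(x := ob)"]) (use c ob ne in \<open>auto simp: B_def\<close>)
  qed auto
  from this[OF I] show ?thesis by (meson order_refl)
qed

text \<open>The library theorem \<open>ramsey2\<close> gives an existence statement; naming the bound keeps all later
  constants independent of the host graph.\<close>

definition ramsey_bound :: "nat \<Rightarrow> nat \<Rightarrow> nat" where
  "ramsey_bound m n = (SOME r. r \<ge> 1 \<and> (\<forall>(V::nat set) (E::nat set set). finite V \<and> card V \<ge> r \<longrightarrow>
    (\<exists>R\<subseteq>V. card R = m \<and> clique R E \<or> card R = n \<and> indep R E)))"

lemma ramsey_bound:
  assumes "finite (V::nat set)" "card V \<ge> ramsey_bound m n"
  shows "\<exists>R\<subseteq>V. card R = m \<and> clique R E \<or> card R = n \<and> indep R E"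
proof -
  have "ramsey_bound m n \<ge> 1 \<and> (\<forall>(V::nat set) (E::nat set set). finite V \<and> card V \<ge> ramsey_bound m n \<longrightarrow>
    (\<exists>R\<subseteq>V. card R = m \<and> clique R E \<or> card R = n \<and> indep R E))"
    unfolding ramsey_bound_def by (rule someI_ex) (rule ramsey2)
  then show ?thesis using assms by blast
qed

primrec multi_ramsey :: "nat \<Rightarrow> nat \<Rightarrow> nat \<Rightarrow> nat" where
  "multi_ramsey m n 0 = n"
| "multi_ramsey m n (Suc q) = ramsey_bound m (multi_ramsey m n q)"

text \<open>Ramsey's theorem is applied once per function, each time on the set left so far. The
  functions need not be injective, but a clique in \<open>E\<close> has distinct values, so it would
  give m elements pairwise related by \<open>h\<close>, against \<open>free\<close>.\<close>

lemma multi_ramsey: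
  fixes F :: "nat \<Rightarrow> nat \<Rightarrow> 'a"
  assumes sym: "\<And>a b. h a b \<Longrightarrow> h b a"
    and free: "\<And>W. finite W \<Longrightarrow> card W = m \<Longrightarrow> \<exists>a\<in>W. \<exists>b\<in>W. a \<noteq> b \<and> \<not> h a b"
    and "finite I" "card I \<ge> multi_ramsey m n q"
  shows "\<exists>S\<subseteq>I. card S = n \<and>
    (\<forall>j<q. \<forall>x\<in>S. \<forall>y\<in>S. x \<noteq> y \<longrightarrow> F j x = F j y \<or> \<not> h (F j x) (F j y))"
  using assms(3,4)
proof (induction q arbitrary: I)
  case 0
  then show ?case by (metis multi_ramsey.simps(1) not_less_zero obtain_subset_with_card_n)
next
  case (Suc q)
  define E where "E = {e. \<exists>x y. e = {x, y} \<and> F q x \<noteq> F q y \<and> h (F q x) (F q y)}"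
  have E: "{x, y} \<in> E \<longleftrightarrow> F q x \<noteq> F q y \<and> h (F q x) (F q y)" for x y
    using sym by (auto simp: E_def doubleton_eq_iff)
  obtain S where S: "S \<subseteq> I" "card S = m \<and> clique S E \<or> card S = multi_ramsey m n q \<and> indep S E"
    using ramsey_bound[OF Suc.prems(1), of m "multi_ramsey m n q" E] Suc.prems(2) by auto
  have "\<not> (card S = m \<and> clique S E)"
  proof
    assume c: "card S = m \<and> clique S E"
    then have *: "F q x \<noteq> F q y" "h (F q x) (F q y)" if "x \<in> S" "y \<in> S" "x \<noteq> y" for x y
      using that E by (auto simp: clique_def)
    then have "inj_on (F q) S" by (auto simp: inj_on_def)
    moreover have "finite S" using S(1) Suc.prems(1) by (rule finite_subset)
    ultimately obtain a b where "a \<in> F q ` S" "b \<in> F q ` S" "a \<noteq> b" "\<not> h a b"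
      using free[of "F q ` S"] c by (auto simp: card_image)
    then show False using * by blast
  qed
  then have S2: "card S = multi_ramsey m n q" "indep S E" using S(2) by auto
  have "finite S" using S(1) Suc.prems(1) by (rule finite_subset)
  then obtain S' where S': "S' \<subseteq> S" "card S' = n"
    "\<forall>j<q. \<forall>x\<in>S'. \<forall>y\<in>S'. x \<noteq> y \<longrightarrow> F j x = F j y \<or> \<not> h (F j x) (F j y)"
    using Suc.IH[of S] S2 by auto
  have "\<forall>x\<in>S'. \<forall>y\<in>S'. x \<noteq> y \<longrightarrow> F q x = F q y \<or> \<not> h (F q x) (F q y)"
    using S2(2) E S'(1) unfolding indep_def by (meson subsetD)
  then show ?case using S' S(1) by (intro exI[of _ S']) (auto simp: less_Suc_eq)
qed

section \<open>Ample tuples\<close>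

text \<open>For copy \<open>c\<close>: \<open>HW c\<close> is $w$, \<open>HY c i\<close> is $y_i$, and \<open>HU c i\<close> and \<open>HM c i j\<close> subdivide
  the edges $w y_i$ and $y_i z_{i,j}$. The leaf \<open>HZ i j\<close> is common to all copies.\<close>

datatype hvert = HW nat | HU nat nat | HY nat nat | HM nat nat nat | HZ nat nat

definition hmids :: "nat \<Rightarrow> nat \<Rightarrow> nat \<Rightarrow> hvert set" where
  "hmids l r t = {HU c i | c i. c < l \<and> i < r} \<union> {HM c i j | c i j. c < l \<and> i < r \<and> j < t}"

definition hbranch :: "nat \<Rightarrow> nat \<Rightarrow> nat \<Rightarrow> hvert set" where
  "hbranch l r t = {HW c | c. c < l} \<union> {HY c i | c i. c < l \<and> i < r} \<union> {HZ i j | i j. i < r \<and> j < t}"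

definition hverts :: "nat \<Rightarrow> nat \<Rightarrow> nat \<Rightarrow> hvert set" where
  "hverts l r t = hbranch l r t \<union> hmids l r t"

text \<open>No vertex set is mentioned: for positive l and r every vertex of H lies on an edge, so
  its image lies wherever \<open>E\<close> lives.\<close>

definition embeds :: "nat \<Rightarrow> nat \<Rightarrow> nat \<Rightarrow> ('a \<Rightarrow> 'a \<Rightarrow> bool) \<Rightarrow> bool" where
  "embeds l r t E \<longleftrightarrow> (\<exists>\<phi>. inj_on \<phi> (hverts l r t) \<and> (\<forall>c<l. \<forall>i<r.
     E (\<phi> (HW c)) (\<phi> (HU c i)) \<and> E (\<phi> (HU c i)) (\<phi> (HY c i)) \<and>
     (\<forall>j<t. E (\<phi> (HY c i)) (\<phi> (HM c i j)) \<and> E (\<phi> (HM c i j)) (\<phi> (HZ i j)))))"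

text \<open>The number of vertices of H: l roots w, l r vertices u, l r vertices y, l r t vertices m
  and r t common leaves.\<close>

definition hsize :: "nat \<Rightarrow> nat \<Rightarrow> nat \<Rightarrow> nat" where
  "hsize l r t = l + 2 * (l * r) + l * r * t + r * t"

lemma hmids_iff [simp]:
  "HW c \<notin> hmids l r t" "HY c i \<notin> hmids l r t" "HZ i j \<notin> hmids l r t"
  "HU c i \<in> hmids l r t \<longleftrightarrow> c < l \<and> i < r" "HM c i j \<in> hmids l r t \<longleftrightarrow> c < l \<and> i < r \<and> j < t"
  by (auto simp: hmids_def)

lemma hbranch_iff [simp]:
  "HW c \<in> hbranch l r t \<longleftrightarrow> c < l" "HY c i \<in> hbranch l r t \<longleftrightarrow> c < l \<and> i < r"
  "HZ i j \<in> hbranch l r t \<longleftrightarrow> i < r \<and> j < t" "HU c i \<notin> hbranch l r t" "HM c i j \<notin> hbranch l r t"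
  by (auto simp: hbranch_def)

lemma finite_hmids: "finite (hmids l r t)" and card_hmids: "card (hmids l r t) = l * r + l * r * t"
proof -
  have eq: "hmids l r t = (\<lambda>(c, i). HU c i) ` ({..<l} \<times> {..<r}) \<union> (\<lambda>(c, i, j). HM c i j) ` ({..<l} \<times> {..<r} \<times> {..<t})"
    unfolding hmids_def by (intro arg_cong2[where f = "(\<union>)"]) (auto simp: image_def)
  show "finite (hmids l r t)" by (simp add: eq)
  have "card (hmids l r t) = card ((\<lambda>(c, i). HU c i) ` ({..<l} \<times> {..<r}))
      + card ((\<lambda>(c, i, j). HM c i j) ` ({..<l} \<times> {..<r} \<times> {..<t}))"
    unfolding eq by (intro card_Un_disjoint) auto
  also have "\<dots> = l * r + l * r * t"
    by (subst (1 2) card_image) (auto simp: inj_on_def card_cartesian_product)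
  finally show "card (hmids l r t) = l * r + l * r * t" .
qed

lemma finite_hbranch: "finite (hbranch l r t)" and card_hbranch: "card (hbranch l r t) = l + l * r + r * t"
proof -
  have eq: "hbranch l r t = HW ` {..<l} \<union> (\<lambda>(c, i). HY c i) ` ({..<l} \<times> {..<r}) \<union> (\<lambda>(i, j). HZ i j) ` ({..<r} \<times> {..<t})"
    unfolding hbranch_def by (intro arg_cong2[where f = "(\<union>)"]) (auto simp: image_def)
  show "finite (hbranch l r t)" by (simp add: eq)
  have "card (hbranch l r t) = card (HW ` {..<l} \<union> (\<lambda>(c, i). HY c i) ` ({..<l} \<times> {..<r}))
      + card ((\<lambda>(i, j). HZ i j) ` ({..<r} \<times> {..<t}))"
    unfolding eq by (intro card_Un_disjoint) auto
  also have "card (HW ` {..<l} \<union> (\<lambda>(c, i). HY c i) ` ({..<l} \<times> {..<r}))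
     = card (HW ` {..<l}) + card ((\<lambda>(c, i). HY c i) ` ({..<l} \<times> {..<r}))"
    by (intro card_Un_disjoint) auto
  also have "\<dots> + card ((\<lambda>(i, j). HZ i j) ` ({..<r} \<times> {..<t})) = l + l * r + r * t"
    by (subst (1 2 3) card_image) (auto simp: inj_on_def card_cartesian_product)
  finally show "card (hbranch l r t) = l + l * r + r * t" .
qed

text \<open>The part of T' around one y_i: leg 0 leads to the root, legs 1 to t lead to the leaves.
  That \<open>y\<close> differs from every \<open>g i\<close> comes from irreflexivity of the
  host.\<close>

definition spider :: "('a \<Rightarrow> 'a \<Rightarrow> bool) \<Rightarrow> nat \<Rightarrow> 'a \<Rightarrow> (nat \<Rightarrow> 'a) \<Rightarrow> (nat \<Rightarrow> 'a) \<Rightarrow> bool" where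
  "spider E t y g \<tau> \<longleftrightarrow> inj_on g {..t} \<and> (\<forall>i\<le>t. E y (g i) \<and> E (g i) (\<tau> i))"

section \<open>H-free hosts of bounded degree: light pairs and ample tuples\<close>

locale host =
  fixes V :: "'a set" and E :: "'a \<Rightarrow> 'a \<Rightarrow> bool" and l r t \<Delta> :: nat
  assumes finV: "finite V" and sym: "E a b \<Longrightarrow> E b a" and irrefl: "\<not> E a a"
    and inV: "E a b \<Longrightarrow> a \<in> V" and deg: "card {u. E v u} \<le> \<Delta>" and \<Delta>1: "\<Delta> \<ge> 1"
    and free: "\<not> embeds l r t E" and l1: "l \<ge> 1" and r1: "r \<ge> 1" and t2: "t \<ge> 2"
begin

definition nb :: "'a \<Rightarrow> 'a set" where "nb v = {u. E v u}"
text \<open>A heavy pair has more common neighbours than \<open>H\<close> has vertices, so in any partial embedding of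
  \<open>H\<close> it can be joined by a fresh path of length two. Similarly an ample tuple always has a fresh
  spider on it. Since the host contains no \<open>H\<close>, there are no large heavy cliques, and no
  long tuple has only ample subtuples.\<close>

definition heavy :: "'a \<Rightarrow> 'a \<Rightarrow> bool" where "heavy a b \<longleftrightarrow> hsize l r t < card (nb a \<inter> nb b)"
definition lite :: "'a \<Rightarrow> 'a \<Rightarrow> bool" where "lite a b \<longleftrightarrow> a = b \<or> \<not> heavy a b"
definition ample :: "(nat \<Rightarrow> 'a) \<Rightarrow> bool" where
  "ample \<tau> \<longleftrightarrow> (\<forall>B. finite B \<and> card B \<le> hsize l r t \<longrightarrow>
     (\<exists>y g. spider E t y g \<tau> \<and> insert y (g ` {..t}) \<inter> B = {}))"

lemma nb_subset_V: "nb v \<subseteq> V" using inV sym by (auto simp: nb_def)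
lemma finite_nb[simp]: "finite (nb v)" using nb_subset_V finV by (rule finite_subset)
lemma card_nb: "card (nb v) \<le> \<Delta>" using deg by (simp add: nb_def)
lemma nb_iff[simp]: "u \<in> nb v \<longleftrightarrow> E v u" by (simp add: nb_def)
lemma heavy_sym: "heavy a b \<Longrightarrow> heavy b a" by (simp add: heavy_def Int_commute)

text \<open>H is the subdivision of a graph on its l + l r + r t branch vertices. A heavy clique of
  that size takes them in any order, and the middle vertices are picked greedily from common
  neighbourhoods.\<close>

lemma no_heavy_clique:
  assumes W: "finite W" "card W = l + l * r + r * t"
  shows "\<exists>a\<in>W. \<exists>b\<in>W. a \<noteq> b \<and> \<not> heavy a b"
proof (rule ccontr)
  assume "\<not> ?thesis"
  then have h: "heavy a b" if "a \<in> W" "b \<in> W" "a \<noteq> b" for a b using that by blast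
  obtain \<beta> where \<beta>: "bij_betw \<beta> (hbranch l r t) W"
    using finite_same_card_bij[OF finite_hbranch W(1)] W(2) card_hbranch by metis
  \<comment> \<open>\<open>e1\<close> and \<open>e2\<close> are the ends of the path of length two
    through a middle vertex.\<close>
  define e1 where "e1 x = (case x of HU c i \<Rightarrow> HW c | HM c i j \<Rightarrow> HY c i | y \<Rightarrow> y)" for x
  define e2 where "e2 x = (case x of HU c i \<Rightarrow> HY c i | HM c i j \<Rightarrow> HZ i j | y \<Rightarrow> y)" for x
  have e: "e1 x \<in> hbranch l r t" "e2 x \<in> hbranch l r t" "e1 x \<noteq> e2 x" if "x \<in> hmids l r t" for x
    using that by (auto simp: e1_def e2_def hmids_def hbranch_def)
  have "\<exists>c. (\<forall>x\<in>hmids l r t. c x \<in> nb (\<beta> (e1 x)) \<inter> nb (\<beta> (e2 x)) \<and> {c x} \<inter> W = {}) \<and>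
    (\<forall>x\<in>hmids l r t. \<forall>y\<in>hmids l r t. x \<noteq> y \<longrightarrow> {c x} \<inter> {c y} = {})"
  proof (rule greedy_choice[where q = 1 and vs = "\<lambda>v. {v}", OF finite_hmids W(1)])
    fix x and B :: "'a set" assume x: "x \<in> hmids l r t" and B: "finite B" "card B \<le> card W + 1 * card (hmids l r t) - 1"
    have "card B \<le> hsize l r t" using B(2) W(2) card_hmids by (simp add: hsize_def)
    moreover have "heavy (\<beta> (e1 x)) (\<beta> (e2 x))"
      using e[OF x] \<beta> by (intro h) (auto simp: bij_betw_def inj_on_def)
    ultimately have "card B < card (nb (\<beta> (e1 x)) \<inter> nb (\<beta> (e2 x)))" by (simp add: heavy_def)
    then have "\<not> nb (\<beta> (e1 x)) \<inter> nb (\<beta> (e2 x)) \<subseteq> B" using card_mono[OF B(1)] by (metis leD)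
    then show "\<exists>ob. ob \<in> nb (\<beta> (e1 x)) \<inter> nb (\<beta> (e2 x)) \<and> finite {ob} \<and> card {ob} \<le> 1 \<and> {ob} \<inter> B = {}"
      by auto
  qed
  then obtain c where c': "\<forall>x\<in>hmids l r t. c x \<in> nb (\<beta> (e1 x)) \<inter> nb (\<beta> (e2 x)) \<and> {c x} \<inter> W = {}"
    "\<forall>x\<in>hmids l r t. \<forall>y\<in>hmids l r t. x \<noteq> y \<longrightarrow> {c x} \<inter> {c y} = {}"
    by (elim exE conjE)
  have c: "c x \<in> nb (\<beta> (e1 x)) \<inter> nb (\<beta> (e2 x)) \<and> c x \<notin> W" if "x \<in> hmids l r t" for x
    using c'(1) that by simp
  have c2: "c x \<noteq> c y" if "x \<in> hmids l r t" "y \<in> hmids l r t" "x \<noteq> y" for x y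
    using c'(2) that by simp
  define \<phi> where "\<phi> x = (if x \<in> hmids l r t then c x else \<beta> x)" for x
  have \<phi>b: "\<phi> x = \<beta> x" if "x \<in> hbranch l r t" for x
    using that by (auto simp: \<phi>_def hbranch_def hmids_def)
  have \<phi>m: "\<phi> x = c x" if "x \<in> hmids l r t" for x using that by (simp add: \<phi>_def)
  have bW: "\<beta> x \<in> W" if "x \<in> hbranch l r t" for x using \<beta> that by (auto simp: bij_betw_def)
  have "inj_on \<phi> (hverts l r t)"
  proof (rule inj_onI)
    fix x y assume xy: "x \<in> hverts l r t" "y \<in> hverts l r t" "\<phi> x = \<phi> y"
    have \<beta>i: "inj_on \<beta> (hbranch l r t)" using \<beta> by (simp add: bij_betw_def)
    from xy(1,2) consider "x \<in> hbranch l r t" "y \<in> hbranch l r t" | "x \<in> hbranch l r t" "y \<in> hmids l r t"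
      | "x \<in> hmids l r t" "y \<in> hbranch l r t" | "x \<in> hmids l r t" "y \<in> hmids l r t"
      unfolding hverts_def by blast
    then show "x = y"
    proof cases
      case 1
      then show ?thesis using xy(3) \<phi>b \<beta>i by (metis inj_onD)
    next
      case 2
      then show ?thesis using xy(3) \<phi>b \<phi>m bW c by metis
    next
      case 3
      then show ?thesis using xy(3) \<phi>b \<phi>m bW c by metis
    next
      case 4
      then show ?thesis using xy(3) \<phi>m c2 by metis
    qed
  qed
  moreover have ed: "E (\<phi> (e1 x)) (\<phi> x) \<and> E (\<phi> x) (\<phi> (e2 x))" if "x \<in> hmids l r t" for x
    using c[OF that] \<phi>m[OF that] \<phi>b e[OF that] sym by auto
  then have "E (\<phi> (HW k)) (\<phi> (HU k i)) \<and> E (\<phi> (HU k i)) (\<phi> (HY k i)) \<and>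
     (\<forall>j<t. E (\<phi> (HY k i)) (\<phi> (HM k i j)) \<and> E (\<phi> (HM k i j)) (\<phi> (HZ i j)))" if "k < l" "i < r" for k i
  proof -
    have "HU k i \<in> hmids l r t" "\<And>j. j < t \<Longrightarrow> HM k i j \<in> hmids l r t" using that by auto
    from this[THEN ed] show ?thesis by (simp add: e1_def e2_def)
  qed
  ultimately have "embeds l r t E" unfolding embeds_def by blast
  with free show False ..
qed

lemma ample_restrict: "ample (restrict \<tau> {..t}) \<longleftrightarrow> ample \<tau>"
proof -
  have "spider E t y g (restrict \<tau> {..t}) = spider E t y g \<tau>" for y g
    by (auto simp: spider_def)
  then show ?thesis by (simp only: ample_def)
qed

text \<open>The branch vertices $w_c$ and $z_{i,j}$ are numbered $c$ and $l + it + j$. Branch $(c, i)$ is a spider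
  on the tuple \<open>root_index c i\<close>.\<close>

definition root_index :: "nat \<Rightarrow> nat \<Rightarrow> nat \<Rightarrow> nat" where
  "root_index c i k = (if k = 0 then c else l + i * t + (k - 1))"

lemma root_index_less: "c < l \<Longrightarrow> i < r \<Longrightarrow> k \<le> t \<Longrightarrow> root_index c i k < l + r * t"
proof -
  assume a: "c < l" "i < r" "k \<le> t"
  have "i * t + (k - 1) < r * t" if "k > 0"
  proof -
    have "i * t + (k - 1) < i * t + t" using that a by simp
    also have "\<dots> = Suc i * t" by simp
    also have "\<dots> \<le> r * t" using a by (intro mult_le_mono1) simp
    finally show ?thesis .
  qed
  then show ?thesis using a by (auto simp: root_index_def)
qed

lemma leaf_index_inj:
  assumes "i * t + j = i' * t + j'" "j < t" "j' < t"
  shows "i = i' \<and> j = j'"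
proof -
  have "(i * t + j) div t = i" "(i' * t + j') div t = i'" using assms(2,3) by auto
  then show ?thesis using assms by auto
qed

lemma root_index_inj: "c < l \<Longrightarrow> i < r \<Longrightarrow> inj_on (root_index c i) {..t}"
proof (rule inj_onI)
  fix a b assume "c < l" "root_index c i a = root_index c i b"
  then show "a = b" by (cases a; cases b) (simp_all add: root_index_def)
qed

text \<open>H falls into l r spiders centred at the vertices y, which meet only in the roots and
  leaves. If all these subtuples were ample, the spiders could be chosen greedily around the
  prescribed values of \<open>f\<close>.\<close>

lemma not_all_ample:
  assumes inj: "inj_on f {..<l + r * t}"
  shows "\<exists>c<l. \<exists>i<r. \<not> ample (\<lambda>k. f (root_index c i k))"
proof (rule ccontr)
  assume "\<not> ?thesis"
  then have amp: "ample (\<lambda>k. f (root_index c i k))" if "c < l" "i < r" for c i using that by blast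
  define W where "W = f ` {..<l + r * t}"
  have W: "finite W" "card W = l + r * t" using inj by (auto simp: W_def card_image)
  let ?vs = "\<lambda>(y, g). insert y (g ` {..t})"
  have "\<exists>c. (\<forall>x\<in>{..<l} \<times> {..<r}. spider E t (fst (c x)) (snd (c x)) (\<lambda>k. f (root_index (fst x) (snd x) k)) \<and> ?vs (c x) \<inter> W = {}) \<and>
    (\<forall>x\<in>{..<l} \<times> {..<r}. \<forall>y\<in>{..<l} \<times> {..<r}. x \<noteq> y \<longrightarrow> ?vs (c x) \<inter> ?vs (c y) = {})"
  \<comment> \<open>One centre and t + 1 leg vertices per spider; with the roots and leaves this
    adds up to \<open>hsize l r t\<close>.\<close>
  proof (rule greedy_choice[where q = "t + 2"])
    fix x and B :: "'a set" assume x: "x \<in> {..<l} \<times> {..<r}" and B: "finite B" "card B \<le> card W + (t + 2) * card ({..<l} \<times> {..<r}) - (t + 2)"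
    have "card B \<le> card W + (t + 2) * (l * r)" using B(2) by (simp add: card_cartesian_product)
    also have "\<dots> = hsize l r t" using W by (simp add: hsize_def algebra_simps)
    finally have cB: "card B \<le> hsize l r t" .
    have "ample (\<lambda>k. f (root_index (fst x) (snd x) k))" using x by (intro amp) auto
    then obtain y g where yg: "spider E t y g (\<lambda>k. f (root_index (fst x) (snd x) k))" "insert y (g ` {..t}) \<inter> B = {}"
      using cB B(1) unfolding ample_def by blast
    have "card (insert y (g ` {..t})) \<le> Suc (card (g ` {..t}))" by (simp add: card_insert_le_m1 card_insert_if)
    also have "card (g ` {..t}) \<le> t + 1" using card_image_le[of "{..t}" g] by simp
    finally have "card (insert y (g ` {..t})) \<le> t + 2" by simp
    then show "\<exists>ob. spider E t (fst ob) (snd ob) (\<lambda>k. f (root_index (fst x) (snd x) k)) \<and> finite (?vs ob) \<and>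
        card (?vs ob) \<le> t + 2 \<and> ?vs ob \<inter> B = {}"
      using yg by (intro exI[of _ "(y, g)"]) simp
  qed (use W in auto)
  then obtain ch where ch': "\<forall>x\<in>{..<l} \<times> {..<r}. spider E t (fst (ch x)) (snd (ch x)) (\<lambda>k. f (root_index (fst x) (snd x) k)) \<and> ?vs (ch x) \<inter> W = {}"
    "\<forall>x\<in>{..<l} \<times> {..<r}. \<forall>y\<in>{..<l} \<times> {..<r}. x \<noteq> y \<longrightarrow> ?vs (ch x) \<inter> ?vs (ch y) = {}"
    by (elim exE conjE)
  note ch = ch'(1)[THEN bspec] ch'(2)[THEN bspec, THEN bspec, THEN mp]
  define Y where "Y c i = fst (ch (c, i))" for c i
  define G where "G c i = snd (ch (c, i))" for c i
  have mid: "spider E t (Y c i) (G c i) (\<lambda>k. f (root_index c i k))"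
    and avW: "Y c i \<notin> W" "\<And>k. k \<le> t \<Longrightarrow> G c i k \<notin> W" if "c < l" "i < r" for c i
    using ch(1)[of "(c, i)"] that unfolding Y_def G_def by (auto simp: case_prod_beta)
  have ginj: "G c i k = G c i k' \<Longrightarrow> k = k'" if "c < l" "i < r" "k \<le> t" "k' \<le> t" for c i k k'
    using mid[OF that(1,2)] that by (auto simp: spider_def inj_on_def)
  have YG: "Y c i \<noteq> G c i k" if "c < l" "i < r" "k \<le> t" for c i k
    using mid[OF that(1,2)] that irrefl by (metis spider_def)
  have dis: "insert (Y c i) (G c i ` {..t}) \<inter> insert (Y c' i') (G c' i' ` {..t}) = {}"
    if "c < l" "i < r" "c' < l" "i' < r" "(c, i) \<noteq> (c', i')" for c i c' i'
    using ch(2)[of "(c, i)" "(c', i')"] that unfolding Y_def G_def by (simp add: case_prod_beta)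
  define \<phi> where "\<phi> x = (case x of HW c \<Rightarrow> f c | HU c i \<Rightarrow> G c i 0 | HY c i \<Rightarrow> Y c i
      | HM c i j \<Rightarrow> G c i (Suc j) | HZ i j \<Rightarrow> f (l + i * t + j))" for x
  have key: "(c, i) = (c', i')" if "c < l" "i < r" "c' < l" "i' < r"
      "a \<in> insert (Y c i) (G c i ` {..t})" "a \<in> insert (Y c' i') (G c' i' ` {..t})" for c i c' i' a
    using dis[of c i c' i'] that by blast
  have zlt: "l + i * t + j < l + r * t" if "i < r" "j < t" for i j
    using root_index_less[of 0 i "Suc j"] that l1 by (simp add: root_index_def)
  \<comment> \<open>\<open>inn\<close> collects the vertices inside the spiders;
    \<open>branch_of\<close> and \<open>leg\<close> are coordinates that separate them, with
    \<open>None\<close> for the centre.\<close>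
  define branch_of where "branch_of x = (case x of HU c i \<Rightarrow> (c, i) | HY c i \<Rightarrow> (c, i) | HM c i j \<Rightarrow> (c, i) | _ \<Rightarrow> (0, 0))" for x
  define inn where "inn = {x \<in> hverts l r t. case x of HW c \<Rightarrow> False | HZ i j \<Rightarrow> False | _ \<Rightarrow> True}"
  have innD: "fst (branch_of x) < l \<and> snd (branch_of x) < r \<and> \<phi> x \<in> insert (Y (fst (branch_of x)) (snd (branch_of x))) (G (fst (branch_of x)) (snd (branch_of x)) ` {..t})"
    if "x \<in> inn" for x
    using that by (cases x) (auto simp: inn_def hverts_def branch_of_def \<phi>_def)
  define leg where "leg x = (case x of HU c i \<Rightarrow> Some 0 | HM c i j \<Rightarrow> Some (Suc j) | _ \<Rightarrow> None)" for x
  have \<phi>_leg: "\<phi> x = (case leg x of None \<Rightarrow> Y (fst (branch_of x)) (snd (branch_of x)) | Some k \<Rightarrow> G (fst (branch_of x)) (snd (branch_of x)) k)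
      \<and> (\<forall>k. leg x = Some k \<longrightarrow> k \<le> t)" if "x \<in> inn" for x
    using that by (cases x) (auto simp: leg_def branch_of_def inn_def \<phi>_def hverts_def)
  have inn_same: "x = y" if "x \<in> inn" "y \<in> inn" "\<phi> x = \<phi> y" for x y
  proof -
    have s: "branch_of x = branch_of y" using innD[OF that(1)] innD[OF that(2)] key that(3) by (metis prod.collapse)
    have l: "fst (branch_of x) < l" "snd (branch_of x) < r" using innD[OF that(1)] by auto
    have "leg x = leg y"
    proof (cases "leg x"; cases "leg y")
      fix k k' assume "leg x = Some k" "leg y = Some k'"
      then show ?thesis using \<phi>_leg[OF that(1)] \<phi>_leg[OF that(2)] that(3) s l ginj by auto
    next
      fix k assume "leg x = None" "leg y = Some k"
      then show ?thesis using \<phi>_leg[OF that(1)] \<phi>_leg[OF that(2)] that(3) s l YG[of "fst (branch_of y)" "snd (branch_of y)" k] by auto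
    next
      fix k assume "leg x = Some k" "leg y = None"
      then show ?thesis using \<phi>_leg[OF that(1)] \<phi>_leg[OF that(2)] that(3) s l YG[of "fst (branch_of x)" "snd (branch_of x)" k] by auto
    qed simp
    with s that(1,2) show ?thesis
      by (cases x; cases y) (auto simp: leg_def branch_of_def inn_def)
  qed
  have inn_W: "\<phi> x \<notin> W" if "x \<in> inn" for x
    using innD[OF that] avW by (metis atMost_iff image_iff insert_iff)
  have out_W: "\<phi> x \<in> W" if "x \<in> hverts l r t" "x \<notin> inn" for x
    using that zlt unfolding W_def inn_def hverts_def by (cases x) (auto simp: \<phi>_def)
  have out_same: "x = y" if "x \<in> hverts l r t" "x \<notin> inn" "y \<in> hverts l r t" "y \<notin> inn" "\<phi> x = \<phi> y" for x y
  proof -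
    have fe: "f a = f b \<Longrightarrow> a = b" if "a < l + r * t" "b < l + r * t" for a b using inj that by (auto simp: inj_on_def)
    have out: "(\<exists>c<l. v = HW c) \<or> (\<exists>i<r. \<exists>j<t. v = HZ i j)" if "v \<in> hverts l r t" "v \<notin> inn" for v
      using that by (cases v) (auto simp: inn_def hverts_def)
    from out[OF that(1,2)] out[OF that(3,4)]
    consider c c' where "c < l" "c' < l" "x = HW c" "y = HW c'"
      | c i j where "c < l" "i < r" "j < t" "x = HW c" "y = HZ i j"
      | c i j where "c < l" "i < r" "j < t" "y = HW c" "x = HZ i j"
      | i j i' j' where "i < r" "j < t" "i' < r" "j' < t" "x = HZ i j" "y = HZ i' j'"
      by (elim disjE exE conjE) auto
    then show ?thesis
    proof cases
      case (1 c c')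
      then show ?thesis using that(5) fe[of c c'] by (simp add: \<phi>_def)
    next
      case (2 c i j)
      then show ?thesis using that(5) fe[of c "l + i * t + j"] zlt[of i j] by (simp add: \<phi>_def)
    next
      case (3 c i j)
      then show ?thesis using that(5) fe[of "l + i * t + j" c] zlt[of i j] by (simp add: \<phi>_def)
    next
      case (4 i j i' j')
      then show ?thesis
        using that(5) fe[of "l + i * t + j" "l + i' * t + j'"] zlt[of i j] zlt[of i' j'] leaf_index_inj[of i j i' j']
        by (simp add: \<phi>_def)
    qed
  qed
  have "inj_on \<phi> (hverts l r t)"
    by (rule inj_onI) (metis inn_same inn_W out_W out_same)
  moreover have "E (\<phi> (HW c)) (\<phi> (HU c i)) \<and> E (\<phi> (HU c i)) (\<phi> (HY c i)) \<and>
     (\<forall>j<t. E (\<phi> (HY c i)) (\<phi> (HM c i j)) \<and> E (\<phi> (HM c i j)) (\<phi> (HZ i j)))" if "c < l" "i < r" for c i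
  proof -
    have "E (Y c i) (G c i k) \<and> E (G c i k) (f (root_index c i k))" if "k \<le> t" for k
      using mid[OF \<open>c < l\<close> \<open>i < r\<close>] that by (simp add: spider_def)
    from this[of 0] this[of "Suc _"] show ?thesis
      using sym by (auto simp: \<phi>_def root_index_def)
  qed
  ultimately have "embeds l r t E" unfolding embeds_def by blast
  with free show False ..
qed

text \<open>The clique size is the one excluded by \<open>no_heavy_clique\<close>.\<close>

definition lite_ramsey :: "nat \<Rightarrow> nat \<Rightarrow> nat" where
  "lite_ramsey s q = multi_ramsey (l + l * r + r * t) s q"

lemma lite_family:
  assumes "finite (I::nat set)" "card I \<ge> lite_ramsey s q"
  shows "\<exists>S\<subseteq>I. card S = s \<and> (\<forall>j<q. \<forall>x\<in>S. \<forall>y\<in>S. lite (F j x) (F j y))"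
proof -
  obtain S where "S \<subseteq> I" "card S = s"
    "\<forall>j<q. \<forall>x\<in>S. \<forall>y\<in>S. x \<noteq> y \<longrightarrow> F j x = F j y \<or> \<not> heavy (F j x) (F j y)"
    using multi_ramsey[where h = heavy and F = F, OF heavy_sym no_heavy_clique assms[unfolded lite_ramsey_def]] by blast
  then show ?thesis by (metis lite_def)
qed

lemma lite_ramsey_ge: "lite_ramsey s q \<ge> s"
proof -
  obtain S where "S \<subseteq> {..<lite_ramsey s q}" "card S = s"
    using lite_family[of "{..<lite_ramsey s q}" s q "\<lambda>_ _. undefined"] by auto
  then show ?thesis using card_mono[of "{..<lite_ramsey s q}" S] by simp
qed

text \<open>With \<open>h\<close> a midpoint map, distinctness makes the midpoints legs of a spider,
  and lightness bounds the coincidences counted in \<open>sum_shared_pairs\<close>.\<close>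

definition scattered :: "('a \<Rightarrow> 'a) \<Rightarrow> (nat \<Rightarrow> 'a) \<Rightarrow> bool" where
  "scattered h \<tau> \<longleftrightarrow> (\<forall>i\<le>t. \<forall>j\<le>t. i \<noteq> j \<longrightarrow> h (\<tau> i) \<noteq> h (\<tau> j) \<and> \<not> heavy (h (\<tau> i)) (h (\<tau> j)))"

text \<open>Two functions \<open>h1\<close>, \<open>h2\<close> are to be made light on l + r t
  indices, one index for each root and leaf of H.\<close>

definition tuple_ramsey :: nat where "tuple_ramsey = lite_ramsey (l + r * t) 2"

text \<open>The role of dependent random choice: among tuples from a set that is large compared with the
  fibres of \<open>h1\<close> and \<open>h2\<close>, a constant fraction is not ample although its midpoints under \<open>h1\<close>
  and under \<open>h2\<close> are distinct and pairwise light. Not being ample then bounds the number of centres.\<close>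

lemma many_nonample:
  assumes X: "finite X"
    and k1: "\<And>v. card {x \<in> X. h1 x = v} \<le> \<kappa>" and k2: "\<And>v. card {x \<in> X. h2 x = v} \<le> \<kappa>"
    and big: "4 * tuple_ramsey ^ 2 * \<kappa> \<le> card X" and ne: "X \<noteq> {}"
  shows "card X ^ (t + 1) \<le> 2 * tuple_ramsey ^ (t + 1) *
    card {\<tau> \<in> {..t} \<rightarrow>\<^sub>E X. \<not> ample \<tau> \<and> scattered h1 \<tau> \<and> scattered h2 \<tau>}"
proof -
  let ?R = tuple_ramsey
  let ?I = "{..<?R}"
  let ?P = "\<lambda>\<tau>. \<not> ample \<tau> \<and> scattered h1 \<tau> \<and> scattered h2 \<tau>"
  let ?Q = "\<lambda>f. \<exists>i\<in>?I. \<exists>j\<in>?I. i \<noteq> j \<and> (h1 (f i) = h1 (f j) \<or> h2 (f i) = h2 (f j))"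
  have Rt: "?R \<ge> t + 1"
  proof -
    have "t + 1 \<le> l + r * t" using l1 r1 by (metis add.commute add_mono mult_le_mono1 nat_mult_1)
    also have "\<dots> \<le> ?R" unfolding tuple_ramsey_def by (rule lite_ramsey_ge)
    finally show ?thesis .
  qed
  have samp: "card X ^ card ?I \<le> card {f \<in> ?I \<rightarrow>\<^sub>E X. ?Q f}
      + card ?I ^ card {..t} * (card {\<tau> \<in> {..t} \<rightarrow>\<^sub>E X. ?P \<tau>} * card X ^ (card ?I - card {..t}))"
  proof (rule sampling[where P = ?P and Q = ?Q])
    fix f assume f: "f \<in> ?I \<rightarrow>\<^sub>E X"
    show "?Q f \<or> (\<exists>g. inj_on g {..t} \<and> g ` {..t} \<subseteq> ?I \<and> ?P (restrict (f \<circ> g) {..t}))"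
    proof (cases "?Q f")
      case False
      \<comment> \<open>Ramsey is applied to both midpoint maps, read on the indices. Outside
        \<open>Q\<close> the sampled entries are distinct, so \<open>not_all_ample\<close> applies
        to those selected.\<close>
      define F where "F j = (if j = 0 then h1 else h2) \<circ> f" for j :: nat
      obtain S where S: "S \<subseteq> ?I" "card S = l + r * t" "\<forall>j<2. \<forall>x\<in>S. \<forall>y\<in>S. lite (F j x) (F j y)"
        using lite_family[of ?I "l + r * t" 2 F] by (auto simp: tuple_ramsey_def)
      have "finite S" using S(1) by (rule finite_subset) simp
      then obtain e where e: "bij_betw e {..<l + r * t} S"
        using finite_same_card_bij[of "{..<l + r * t}" S] S(2) by auto
      have eS: "e x \<in> S" if "x < l + r * t" for x using e that by (auto simp: bij_betw_def)
      have eI: "e x \<in> ?I" if "x < l + r * t" for x using eS S(1) that by auto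
      have einj: "e x = e y \<Longrightarrow> x = y" if "x < l + r * t" "y < l + r * t" for x y
        using e that by (auto simp: bij_betw_def inj_on_def)
      have "inj_on (f \<circ> e) {..<l + r * t}"
      proof (rule inj_onI)
        fix x y assume xy: "x \<in> {..<l + r * t}" "y \<in> {..<l + r * t}" "(f \<circ> e) x = (f \<circ> e) y"
        then have "h1 (f (e x)) = h1 (f (e y))" by simp
        then have "e x = e y" using False eI xy by blast
        then show "x = y" using einj xy by simp
      qed
      then obtain c i where ci: "c < l" "i < r" "\<not> ample (\<lambda>k. (f \<circ> e) (root_index c i k))"
        using not_all_ample by blast
      let ?g = "e \<circ> root_index c i"
      have lt: "root_index c i k < l + r * t" if "k \<le> t" for k using root_index_less ci that by blast
      have ginj: "inj_on ?g {..t}"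
        using root_index_inj[OF ci(1,2)] lt einj by (auto simp: inj_on_def)
      have gI: "?g ` {..t} \<subseteq> ?I" using eI lt by auto
      have na: "\<not> ample (restrict (f \<circ> ?g) {..t})"
        using ci(3) by (simp add: ample_restrict o_def)
      have sc: "scattered h (restrict (f \<circ> ?g) {..t})" if "h = h1 \<or> h = h2" for h
        unfolding scattered_def
      proof (intro allI impI)
        fix a b assume ab: "a \<le> t" "b \<le> t" "a \<noteq> b"
        have gab: "?g a \<noteq> ?g b" "?g a \<in> ?I" "?g b \<in> ?I" "?g a \<in> S" "?g b \<in> S"
          using ginj gI ab lt eS by (auto simp: inj_on_def)
        then have "h (f (?g a)) \<noteq> h (f (?g b))" using False that by blast
        moreover have "lite (h (f (?g a))) (h (f (?g b)))"
        proof -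
          have "h \<circ> f = F 0 \<or> h \<circ> f = F 1" using that by (auto simp: F_def)
          then have "\<exists>j<2. h (f (?g a)) = F j (?g a) \<and> h (f (?g b)) = F j (?g b)"
            by (metis comp_apply one_less_numeral_iff semiring_norm(76) zero_less_numeral)
          then show ?thesis using S(3) gab(4,5) by metis
        qed
        ultimately show "h (restrict (f \<circ> ?g) {..t} a) \<noteq> h (restrict (f \<circ> ?g) {..t} b) \<and>
            \<not> heavy (h (restrict (f \<circ> ?g) {..t} a)) (h (restrict (f \<circ> ?g) {..t} b))"
          using ab by (simp add: lite_def)
      qed
      have "?P (restrict (f \<circ> ?g) {..t})" using na sc[of h1] sc[of h2] by blast
      with ginj gI show ?thesis by (intro disjI2 exI[of _ ?g] conjI) simp_all
    qed simp
  qed (use X in auto)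
  \<comment> \<open>Union bound for \<open>Q\<close>: given \<open>f i\<close>, at most 2 \<kappa>
    values of \<open>f j\<close> collide with it. By \<open>big\<close> this accounts for at most
    half of all samples.\<close>
  have "{f \<in> ?I \<rightarrow>\<^sub>E X. ?Q f} \<subseteq> (\<Union>i\<in>?I. \<Union>j\<in>?I - {i}. {f \<in> ?I \<rightarrow>\<^sub>E X. h1 (f i) = h1 (f j) \<or> h2 (f i) = h2 (f j)})"
  proof
    fix f assume "f \<in> {f \<in> ?I \<rightarrow>\<^sub>E X. ?Q f}"
    note f = CollectD[OF this, THEN conjunct1] and q = CollectD[OF this, THEN conjunct2]
    from q obtain i j where ij: "i \<in> ?I" "j \<in> ?I" "i \<noteq> j" "h1 (f i) = h1 (f j) \<or> h2 (f i) = h2 (f j)"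
      by (elim bexE conjE)
    then have "j \<in> ?I - {i}" by simp
    moreover have "f \<in> {f \<in> ?I \<rightarrow>\<^sub>E X. h1 (f i) = h1 (f j) \<or> h2 (f i) = h2 (f j)}"
      by (intro CollectI conjI f ij(4))
    ultimately have "f \<in> (\<Union>j\<in>?I - {i}. {f \<in> ?I \<rightarrow>\<^sub>E X. h1 (f i) = h1 (f j) \<or> h2 (f i) = h2 (f j)})"
      by (rule UN_I)
    then show "f \<in> (\<Union>i\<in>?I. \<Union>j\<in>?I - {i}. {f \<in> ?I \<rightarrow>\<^sub>E X. h1 (f i) = h1 (f j) \<or> h2 (f i) = h2 (f j)})"
      by (rule UN_I[OF ij(1)])
  qed
  then have "card {f \<in> ?I \<rightarrow>\<^sub>E X. ?Q f} \<le> card (\<Union>i\<in>?I. \<Union>j\<in>?I - {i}. {f \<in> ?I \<rightarrow>\<^sub>E X. h1 (f i) = h1 (f j) \<or> h2 (f i) = h2 (f j)})"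
  proof (intro card_mono finite_UN_I)
    have "finite (?I \<rightarrow>\<^sub>E X)" using X by (intro finite_PiE) auto
    then show "finite {f \<in> ?I \<rightarrow>\<^sub>E X. h1 (f i) = h1 (f j) \<or> h2 (f i) = h2 (f j)}" for i j by simp
  qed auto
  also have "\<dots> \<le> (\<Sum>i\<in>?I. \<Sum>j\<in>?I - {i}. card {f \<in> ?I \<rightarrow>\<^sub>E X. h1 (f i) = h1 (f j) \<or> h2 (f i) = h2 (f j)})"
    by (intro order_trans[OF card_UN_le] sum_mono card_UN_le) auto
  also have "\<dots> \<le> (\<Sum>i\<in>?I. \<Sum>j\<in>?I - {i}. (2 * \<kappa>) * card X ^ (card ?I - 1))"
  proof (intro sum_mono card_PiE_rel_le)
    fix a assume "a \<in> X"
    have "card {b \<in> X. h1 a = h1 b \<or> h2 a = h2 b} = card ({b \<in> X. h1 b = h1 a} \<union> {b \<in> X. h2 b = h2 a})"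
      by (rule arg_cong[where f = card]) auto
    also have "\<dots> \<le> card {b \<in> X. h1 b = h1 a} + card {b \<in> X. h2 b = h2 a}" by (rule card_Un_le)
    also have "\<dots> \<le> 2 * \<kappa>" using k1[of "h1 a"] k2[of "h2 a"] by simp
    finally show "card {b \<in> X. h1 a = h1 b \<or> h2 a = h2 b} \<le> 2 * \<kappa>" .
  qed (use X in auto)
  also have "\<dots> = ?R * (?R - 1) * (2 * \<kappa> * card X ^ (?R - 1))"
    by (simp add: card_Diff_singleton)
  also have "\<dots> \<le> ?R ^ 2 * (2 * \<kappa> * card X ^ (?R - 1))"
    by (intro mult_le_mono1) (simp add: power2_eq_square)
  finally have "2 * card {f \<in> ?I \<rightarrow>\<^sub>E X. ?Q f} \<le> (4 * ?R ^ 2 * \<kappa>) * card X ^ (?R - 1)"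
    by (simp add: algebra_simps)
  also have "\<dots> \<le> card X * card X ^ (?R - 1)" using big by (rule mult_le_mono1)
  also have "\<dots> = card X ^ ?R" using Rt by (metis Suc_pred' add_gr_0 le_trans less_numeral_extra(1) power_Suc zero_less_iff_neq_zero not_one_le_zero le_add2 gr_zeroI)
  finally have q: "2 * card {f \<in> ?I \<rightarrow>\<^sub>E X. ?Q f} \<le> card X ^ ?R" .
  let ?M = "card {\<tau> \<in> {..t} \<rightarrow>\<^sub>E X. ?P \<tau>}"
  have "card X ^ ?R \<le> card {f \<in> ?I \<rightarrow>\<^sub>E X. ?Q f} + ?R ^ (t + 1) * (?M * card X ^ (?R - (t + 1)))"
    using samp by simp
  with q have "card X ^ ?R \<le> 2 * (?R ^ (t + 1) * (?M * card X ^ (?R - (t + 1))))" by linarith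
  moreover have "card X ^ ?R = card X ^ (t + 1) * card X ^ (?R - (t + 1))"
    using Rt by (metis le_add_diff_inverse power_add)
  ultimately have "card X ^ (t + 1) * card X ^ (?R - (t + 1)) \<le> (2 * ?R ^ (t + 1) * ?M) * card X ^ (?R - (t + 1))"
    by (simp add: mult.assoc)
  moreover have "card X ^ (?R - (t + 1)) > 0" using X ne by (simp add: card_gt_0_iff)
  ultimately show ?thesis by (meson mult_le_cancel2)
qed

end

section \<open>Moments of the number of common second neighbours\<close>

lemma sum_card_swap:
  assumes "finite A" "finite B"
  shows "(\<Sum>a\<in>A. card {b \<in> B. R a b}) = (\<Sum>b\<in>B. card {a \<in> A. R a b})"
proof -
  have "(\<Sum>a\<in>A. card {b \<in> B. R a b}) = (\<Sum>a\<in>A. \<Sum>b\<in>B. if R a b then 1 else 0)"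
    using assms by (simp add: sum.inter_filter[symmetric])
  also have "\<dots> = (\<Sum>b\<in>B. \<Sum>a\<in>A. if R a b then 1 else 0)" by (rule sum.swap)
  also have "\<dots> = (\<Sum>b\<in>B. card {a \<in> A. R a b})"
    using assms by (simp add: sum.inter_filter[symmetric])
  finally show ?thesis .
qed

lemma card_UN_bound:
  assumes "finite A" "card A \<le> m" "\<And>x. x \<in> A \<Longrightarrow> card (F x) \<le> k"
  shows "card (\<Union>x\<in>A. F x) \<le> m * k"
proof -
  have "card (\<Union>x\<in>A. F x) \<le> (\<Sum>x\<in>A. card (F x))" by (rule card_UN_le[OF assms(1)])
  also have "\<dots> \<le> (\<Sum>x\<in>A. k)" by (intro sum_mono assms)
  also have "\<dots> \<le> m * k" using assms(2) by simp
  finally show ?thesis .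
qed

lemma nat_power_sum_le:
  fixes p :: "'a \<Rightarrow> nat"
  assumes "finite A" "card A \<le> m" "n \<ge> 1"
  shows "(\<Sum>x\<in>A. p x) ^ n \<le> m ^ (n - 1) * (\<Sum>x\<in>A. p x ^ n)"
proof -
  have "(\<Sum>x\<in>A. real (p x)) ^ n \<le> real (card A) ^ (n - 1) * (\<Sum>x\<in>A. real (p x) ^ n)"
    by (rule power_sum_le') (use assms in auto)
  then have "real ((\<Sum>x\<in>A. p x) ^ n) \<le> real (card A ^ (n - 1) * (\<Sum>x\<in>A. p x ^ n))" by simp
  then have "(\<Sum>x\<in>A. p x) ^ n \<le> card A ^ (n - 1) * (\<Sum>x\<in>A. p x ^ n)" by (simp only: of_nat_le_iff)
  also have "\<dots> \<le> m ^ (n - 1) * (\<Sum>x\<in>A. p x ^ n)"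
    by (intro mult_le_mono1 power_mono) (use assms in auto)
  finally show ?thesis .
qed

lemma nat_power_add_le: "((a::nat) + b) ^ n \<le> 2 ^ n * (a ^ n + b ^ n)"
proof -
  have "a + b \<le> 2 * max a b" by simp
  then have "(a + b) ^ n \<le> (2 * max a b) ^ n" by (rule power_mono) simp
  also have "\<dots> = 2 ^ n * max a b ^ n" by (simp add: power_mult_distrib)
  also have "max a b ^ n \<le> a ^ n + b ^ n" by (simp add: max_def)
  finally show ?thesis by simp
qed

lemma small_or_power_le: "(p::nat) < q \<Longrightarrow> p ^ (n + 1) \<le> q ^ n * p"
  by (simp only: power_add power_one_right) (intro mult_le_mono1 power_mono, simp_all)

context host
begin

abbreviation "hsz \<equiv> hsize l r t"

text \<open>\<open>mid a b\<close> is a canonical common neighbour, meaningful only if \<open>b \<in> nb2 a\<close>. Fixing it loses at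
  most the constant factor \<open>hsize l r t\<close>, since light pairs have few common neighbours.\<close>

definition nb2 :: "'a \<Rightarrow> 'a set" where
  "nb2 a = {b. a \<noteq> b \<and> nb a \<inter> nb b \<noteq> {} \<and> \<not> heavy a b}"
definition mid :: "'a \<Rightarrow> 'a \<Rightarrow> 'a" where "mid a b = (SOME u. E a u \<and> E u b)"
definition k :: "'a \<Rightarrow> 'a \<Rightarrow> nat" where "k a b = card (nb2 a \<inter> nb2 b)"

lemma finite_nb_Collect[simp]: "finite {m. E z m \<and> Q m}"
  by (rule finite_subset[OF _ finite_nb[of z]]) auto
lemma D_eq: "(\<Delta> ^ 2) ^ (t + 1) = \<Delta> ^ (2 * t + 2)"
  by (simp only: power_mult[symmetric] distrib_left mult_1_right)
lemma hsz_ge_1: "hsz \<ge> 1" using l1 by (simp add: hsize_def)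
lemma E_sym: "E a b \<longleftrightarrow> E b a" using sym by blast
lemma nb2_sym: "b \<in> nb2 a \<longleftrightarrow> a \<in> nb2 b" using heavy_sym by (auto simp: nb2_def)
lemma nb2_subset: "nb2 a \<subseteq> (\<Union>u\<in>nb a. nb u)" using E_sym by (auto simp: nb2_def)
lemma nb2_subset_V: "nb2 a \<subseteq> V" using nb2_subset nb_subset_V by blast
lemma finite_nb2[simp]: "finite (nb2 a)" using nb2_subset_V finV by (rule finite_subset)
lemma card_nb2: "card (nb2 a) \<le> \<Delta> ^ 2"
proof -
  have "card (nb2 a) \<le> card (\<Union>u\<in>nb a. nb u)" by (intro card_mono nb2_subset) auto
  also have "\<dots> \<le> \<Delta> * \<Delta>" by (intro card_UN_bound card_nb) auto
  finally show ?thesis by (simp add: power2_eq_square)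
qed
lemma mid_adj: "b \<in> nb2 a \<Longrightarrow> E a (mid a b) \<and> E (mid a b) b"
proof -
  assume "b \<in> nb2 a"
  then have "\<exists>u. E a u \<and> E u b" using E_sym by (auto simp: nb2_def)
  then show ?thesis unfolding mid_def by (rule someI_ex)
qed
lemma not_heavy: "\<not> heavy a b \<Longrightarrow> card (nb a \<inter> nb b) \<le> hsz" by (simp add: heavy_def)
lemma card_mid_fiber: "card {x \<in> nb2 c. mid c x = u} \<le> \<Delta>"
proof -
  have "card {x \<in> nb2 c. mid c x = u} \<le> card (nb u)" using mid_adj by (intro card_mono) auto
  then show ?thesis using card_nb[of u] by simp
qed
lemma k_le: "k a b \<le> \<Delta> ^ 2"
  unfolding k_def by (rule order_trans[OF card_mono card_nb2[of a]]) simp_all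

lemma sum_k: "(\<Sum>b\<in>V. k a b) \<le> \<Delta> ^ 4"
proof -
  have "(\<Sum>b\<in>V. k a b) = (\<Sum>b\<in>V. card {x \<in> nb2 a. x \<in> nb2 b})" by (simp add: k_def Int_def)
  also have "\<dots> = (\<Sum>x\<in>nb2 a. card {b \<in> V. x \<in> nb2 b})" by (intro sum_card_swap finV) simp
  also have "\<dots> \<le> (\<Sum>x\<in>nb2 a. \<Delta> ^ 2)"
  proof (intro sum_mono)
    fix x
    have "card {b \<in> V. x \<in> nb2 b} \<le> card (nb2 x)" using nb2_sym by (intro card_mono) auto
    then show "card {b \<in> V. x \<in> nb2 b} \<le> \<Delta> ^ 2" using card_nb2[of x] by simp
  qed
  also have "\<dots> \<le> \<Delta> ^ 2 * \<Delta> ^ 2" unfolding sum_constant of_nat_id by (intro mult_le_mono1 card_nb2)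
  also have "\<dots> = \<Delta> ^ (2 + 2)" by (simp only: power_add)
  finally show ?thesis by simp
qed

section \<open>Walks of length three\<close>

lemma \<Delta>_mono: "i \<le> j \<Longrightarrow> \<Delta> ^ i \<le> \<Delta> ^ j" using \<Delta>1 by (intro power_increasing)

text \<open>First vertices v of walks z - v - x - m with x a light second neighbour of z;
  \<open>mid3\<close> selects one such x. Only the vertices v are counted, not the walks.\<close>

definition starts :: "'a \<Rightarrow> 'a \<Rightarrow> 'a set" where
  "starts z m = {v \<in> nb z. \<exists>x\<in>nb2 z. E v x \<and> E x m}"
definition mid3 :: "'a \<Rightarrow> 'a \<Rightarrow> 'a \<Rightarrow> 'a" where
  "mid3 z m v = (SOME x. x \<in> nb2 z \<and> E v x \<and> E x m)"

lemma mid3: "v \<in> starts z m \<Longrightarrow> mid3 z m v \<in> nb2 z \<and> E v (mid3 z m v) \<and> E (mid3 z m v) m"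
proof -
  assume "v \<in> starts z m"
  then have "\<exists>x. x \<in> nb2 z \<and> E v x \<and> E x m" by (auto simp: starts_def)
  then show ?thesis unfolding mid3_def by (rule someI_ex)
qed

lemma finite_starts[simp]: "finite (starts z m)" by (rule finite_subset[OF _ finite_nb[of z]]) (auto simp: starts_def)

lemma sum_starts: "(\<Sum>m\<in>V. card (starts z m)) \<le> \<Delta> ^ 3"
proof -
  have "(\<Sum>m\<in>V. card (starts z m)) = (\<Sum>m\<in>V. card {v \<in> nb z. v \<in> starts z m})"
    by (intro sum.cong arg_cong[where f = card]) (auto simp: starts_def)
  also have "\<dots> = (\<Sum>v\<in>nb z. card {m \<in> V. v \<in> starts z m})" by (intro sum_card_swap finV) simp
  also have "\<dots> \<le> (\<Sum>v\<in>nb z. \<Delta> * \<Delta>)"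
  proof (intro sum_mono)
    fix v
    have "card {m \<in> V. v \<in> starts z m} \<le> card (\<Union>x\<in>nb v. nb x)" by (intro card_mono) (auto simp: starts_def)
    also have "\<dots> \<le> \<Delta> * \<Delta>" by (intro card_UN_bound card_nb) auto
    finally show "card {m \<in> V. v \<in> starts z m} \<le> \<Delta> * \<Delta>" .
  qed
  also have "\<dots> \<le> \<Delta> * (\<Delta> * \<Delta>)" using card_nb[of z] by simp
  finally show ?thesis by (simp add: power3_eq_cube mult.assoc)
qed

text \<open>Failure of ampleness means that a bounded set meets every spider on the tuple. This is
  how non-ample tuples are seen to have few centres.\<close>

lemma nonample_hit:
  assumes "\<not> ample \<tau>"
  obtains B where "finite B" "card B \<le> hsz"
    "\<And>y g. spider E t y g \<tau> \<Longrightarrow> y \<in> B \<or> (\<exists>i\<le>t. g i \<in> B)"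
proof -
  from assms obtain B where B: "finite B" "card B \<le> hsz"
    "\<And>y g. \<not> (spider E t y g \<tau> \<and> insert y (g ` {..t}) \<inter> B = {})"
    unfolding ample_def by meson
  show thesis
  proof (rule that[OF B(1,2)])
    fix y g assume "spider E t y g \<tau>"
    with B(3) have "insert y (g ` {..t}) \<inter> B \<noteq> {}" by blast
    then show "y \<in> B \<or> (\<exists>i\<le>t. g i \<in> B)" by auto
  qed
qed

definition "C1 = (4 * tuple_ramsey ^ 2 * hsz) ^ t + 4 * hsz * tuple_ramsey ^ (t + 1)"

text \<open>By \<open>many_nonample\<close>, a large set \<open>starts z m\<close> contains many
  non-ample tuples that \<open>mid3\<close> turns into spiders centred at m. Conversely, a non-ample
  tuple in \<open>nb z\<close> is hit by a bounded set, which leaves O(\<Delta>) centres m. Double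
  counting over at most \<Delta>^(t+1) tuples gives the moment.\<close>

lemma sum_starts_power: "(\<Sum>m\<in>V. card (starts z m) ^ (t + 1)) \<le> C1 * \<Delta> ^ (t + 2)"
proof -
  let ?q = "4 * tuple_ramsey ^ 2 * hsz"
  let ?T = "{\<tau> \<in> {..t} \<rightarrow>\<^sub>E nb z. \<not> ample \<tau>}"
  let ?rel = "\<lambda>m \<tau>. (\<forall>i\<le>t. \<tau> i \<in> starts z m) \<and> scattered (mid3 z m) \<tau>"
  have finT: "finite ?T" by (intro finite_subset[of ?T "{..t} \<rightarrow>\<^sub>E nb z"] finite_PiE) auto
  have one: "card (starts z m) ^ (t + 1) \<le> ?q ^ t * card (starts z m) + 2 * tuple_ramsey ^ (t + 1) * card {\<tau> \<in> ?T. ?rel m \<tau>}" for m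
  proof (cases "card (starts z m) < ?q \<or> starts z m = {}")
    case True
    then have "card (starts z m) ^ (t + 1) \<le> ?q ^ t * card (starts z m)"
    proof
      assume "card (starts z m) < ?q"
      then show ?thesis by (rule small_or_power_le)
    qed simp
    then show ?thesis by (rule trans_le_add1)
  next
    case False
    \<comment> \<open>z and x form a light pair, and all v with this x are common neighbours of the
      two.\<close>
    have fib: "card {v \<in> starts z m. mid3 z m v = x} \<le> hsz" for x
    proof (cases "x \<in> nb2 z")
      case True
      have "card {v \<in> starts z m. mid3 z m v = x} \<le> card (nb z \<inter> nb x)"
      proof (intro card_mono subsetI)
        fix v assume "v \<in> {v \<in> starts z m. mid3 z m v = x}"
        then have "v \<in> starts z m" "E v x" using mid3[of v z m] by auto
        then show "v \<in> nb z \<inter> nb x" using sym by (auto simp: starts_def)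
      qed simp
      also have "\<dots> \<le> hsz" using True by (intro not_heavy) (auto simp: nb2_def)
      finally show ?thesis .
    next
      case False
      then have "{v \<in> starts z m. mid3 z m v = x} = {}" using mid3[of _ z m] by auto
      then show ?thesis by (simp only: card.empty)
    qed
    have "card (starts z m) ^ (t + 1) \<le> 2 * tuple_ramsey ^ (t + 1) *
        card {\<tau> \<in> {..t} \<rightarrow>\<^sub>E starts z m. \<not> ample \<tau> \<and> scattered (mid3 z m) \<tau> \<and> scattered (mid3 z m) \<tau>}"
      by (rule many_nonample[where \<kappa> = hsz]) (use False fib in auto)
    also have "card {\<tau> \<in> {..t} \<rightarrow>\<^sub>E starts z m. \<not> ample \<tau> \<and> scattered (mid3 z m) \<tau> \<and> scattered (mid3 z m) \<tau>}
        \<le> card {\<tau> \<in> ?T. ?rel m \<tau>}"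
    proof (intro card_mono subsetI)
      show "finite {\<tau> \<in> ?T. ?rel m \<tau>}" by (rule finite_subset[OF _ finT]) auto
    qed (auto simp: PiE_iff starts_def)
    finally show ?thesis by simp
  qed
  have hit: "card {m \<in> V. ?rel m \<tau>} \<le> hsz + hsz * \<Delta>" if "\<tau> \<in> ?T" for \<tau>
  proof -
    have na: "\<not> ample \<tau>" using that by simp
    obtain B where B: "finite B" "card B \<le> hsz" "\<And>y g. spider E t y g \<tau> \<Longrightarrow> y \<in> B \<or> (\<exists>i\<le>t. g i \<in> B)"
      using na nonample_hit by blast
    have "{m \<in> V. ?rel m \<tau>} \<subseteq> B \<union> (\<Union>b\<in>B. nb b)"
    proof
      fix m assume m: "m \<in> {m \<in> V. ?rel m \<tau>}"
      have a: "E m (mid3 z m (\<tau> i)) \<and> E (mid3 z m (\<tau> i)) (\<tau> i)" if "i \<le> t" for i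
        using m mid3[of "\<tau> i" z m] that sym by blast
      moreover have "inj_on (\<lambda>i. mid3 z m (\<tau> i)) {..t}"
        using m unfolding scattered_def inj_on_def by (metis (mono_tags, lifting) atMost_iff mem_Collect_eq)
      ultimately have "spider E t m (\<lambda>i. mid3 z m (\<tau> i)) \<tau>" by (simp add: spider_def)
      from B(3)[OF this] show "m \<in> B \<union> (\<Union>b\<in>B. nb b)" using a sym by auto
    qed
    then have "card {m \<in> V. ?rel m \<tau>} \<le> card (B \<union> (\<Union>b\<in>B. nb b))" using B by (intro card_mono) auto
    also have "\<dots> \<le> card B + card (\<Union>b\<in>B. nb b)" by (rule card_Un_le)
    also have "card (\<Union>b\<in>B. nb b) \<le> hsz * \<Delta>" by (rule card_UN_bound) (use B card_nb in auto)
    finally show ?thesis using B(2) by simp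
  qed
  have cT: "card ?T \<le> \<Delta> ^ (t + 1)"
  proof -
    have "card ?T \<le> card ({..t} \<rightarrow>\<^sub>E nb z)" by (intro card_mono finite_PiE) auto
    also have "\<dots> \<le> \<Delta> ^ (t + 1)" using card_nb[of z] power_mono[of "card (nb z)" \<Delta> "t + 1"] by (simp add: card_funcsetE)
    finally show ?thesis .
  qed
  have "(\<Sum>m\<in>V. card {\<tau> \<in> ?T. ?rel m \<tau>}) = (\<Sum>\<tau>\<in>?T. card {m \<in> V. ?rel m \<tau>})"
    by (intro sum_card_swap finV finT)
  also have "\<dots> \<le> (\<Sum>\<tau>\<in>?T. hsz + hsz * \<Delta>)" by (intro sum_mono hit)
  also have "\<dots> = card ?T * (hsz + hsz * \<Delta>)" by simp
  also have "\<dots> \<le> \<Delta> ^ (t + 1) * (2 * hsz * \<Delta>)"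
    using \<Delta>1 cT by (intro mult_le_mono) auto
  finally have spread: "(\<Sum>m\<in>V. card {\<tau> \<in> ?T. ?rel m \<tau>}) \<le> 2 * hsz * \<Delta> ^ (t + 2)" by (simp add: algebra_simps)
  have "(\<Sum>m\<in>V. card (starts z m) ^ (t + 1)) \<le>
      (\<Sum>m\<in>V. ?q ^ t * card (starts z m) + 2 * tuple_ramsey ^ (t + 1) * card {\<tau> \<in> ?T. ?rel m \<tau>})"
    by (intro sum_mono one)
  also have "\<dots> = ?q ^ t * (\<Sum>m\<in>V. card (starts z m)) + 2 * tuple_ramsey ^ (t + 1) * (\<Sum>m\<in>V. card {\<tau> \<in> ?T. ?rel m \<tau>})"
    by (simp only: sum.distrib sum_distrib_left)
  also have "\<dots> \<le> ?q ^ t * \<Delta> ^ (t + 2) + 2 * tuple_ramsey ^ (t + 1) * (2 * hsz * \<Delta> ^ (t + 2))"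
  proof (intro add_mono mult_le_mono2 spread)
    show "(\<Sum>m\<in>V. card (starts z m)) \<le> \<Delta> ^ (t + 2)"
      using sum_starts[of z] \<Delta>_mono[of 3 "t + 2"] t2 by linarith
  qed
  finally show ?thesis by (simp add: C1_def algebra_simps)
qed

section \<open>Pairs of hubs of a tuple\<close>

definition nice :: "'a \<Rightarrow> 'a \<Rightarrow> (nat \<Rightarrow> 'a) \<Rightarrow> bool" where
  "nice z z' \<tau> \<longleftrightarrow> lite z z' \<and> (\<forall>j\<le>t. lite (mid z (\<tau> j)) (mid z' (\<tau> j)))"

text \<open>t + 2 functions: the vertex itself and its midpoints towards the t + 1 entries of the
  tuple.\<close>

definition "pair_ramsey = lite_ramsey 2 (t + 2)"

lemma nice_exists: "\<exists>i<pair_ramsey. \<exists>j<pair_ramsey. i \<noteq> j \<and> nice (f i) (f j) \<tau>"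
proof -
  define F where "F j i = (if j = 0 then f i else mid (f i) (\<tau> (j - 1)))" for i j :: nat
  obtain S where S: "S \<subseteq> {..<pair_ramsey}" "card S = 2" "\<forall>j<t + 2. \<forall>x\<in>S. \<forall>y\<in>S. lite (F j x) (F j y)"
    using lite_family[of "{..<pair_ramsey}" 2 "t + 2" F] by (auto simp: pair_ramsey_def)
  obtain a b where ab: "S = {a, b}" "a \<noteq> b" using S(2) by (auto simp: card_2_iff)
  have "lite (f a) (f b)" using S(3)[rule_format, of 0 a b] ab by (simp add: F_def)
  moreover have "lite (mid (f a) (\<tau> j)) (mid (f b) (\<tau> j))" if "j \<le> t" for j
    using S(3)[rule_format, of "Suc j" a b] ab that by (simp add: F_def)
  ultimately have "nice (f a) (f b) \<tau>" by (simp add: nice_def)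
  then show ?thesis using ab S(1) by auto
qed

lemma nice_pairs: "finite A \<Longrightarrow> card A ^ 2 \<le> pair_ramsey ^ 2 * card {(z, z') \<in> A \<times> A. nice z z' \<tau>}"
  by (rule pair_sampling[where P = "\<lambda>z z'. nice z z' \<tau>"]) (assumption, rule nice_exists)

lemma nice_fiber_pairs:
  "finite A \<Longrightarrow> card {(z, z') \<in> A \<times> A. h z = h z'} \<le> pair_ramsey ^ 2 * card {(z, z') \<in> A \<times> A. h z = h z' \<and> nice z z' \<tau>}"
  by (rule fiber_pair_sampling[where P = "\<lambda>z z'. nice z z' \<tau>"]) (assumption, rule nice_exists)

definition lite_common :: "'a \<Rightarrow> 'a \<Rightarrow> 'a set" where
  "lite_common z z' = {x \<in> nb2 z \<inter> nb2 z'. lite (mid z x) (mid z' x)}"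
definition tuples :: "(nat \<Rightarrow> 'a) set" where "tuples = {..t} \<rightarrow>\<^sub>E V"
definition hubs :: "(nat \<Rightarrow> 'a) \<Rightarrow> 'a set" where "hubs \<tau> = {z \<in> V. \<forall>i\<le>t. \<tau> i \<in> nb2 z}"
definition scattered_hubs :: "(nat \<Rightarrow> 'a) \<Rightarrow> 'a set" where "scattered_hubs \<tau> = {z \<in> hubs \<tau>. scattered (mid z) \<tau>}"

lemma finite_tuples[simp]: "finite tuples" unfolding tuples_def using finV by (intro finite_PiE) auto
lemma finite_hubs[simp]: "finite (hubs \<tau>)" using finV by (simp add: hubs_def)
lemma finite_scattered_hubs[simp]: "finite (scattered_hubs \<tau>)" by (simp add: scattered_hubs_def)
lemma finite_lite_common[simp]: "finite (lite_common z z')" by (simp add: lite_common_def)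
lemma lite_common_le_k: "card (lite_common z z') \<le> k z z'" unfolding k_def by (intro card_mono) (auto simp: lite_common_def)

lemma card_tuples: "X \<subseteq> V \<Longrightarrow> card {\<tau> \<in> tuples. \<forall>i\<le>t. \<tau> i \<in> X} = card X ^ (t + 1)"
proof -
  assume "X \<subseteq> V"
  then have "{\<tau> \<in> tuples. \<forall>i\<le>t. \<tau> i \<in> X} = {..t} \<rightarrow>\<^sub>E X" by (auto simp: tuples_def PiE_def Pi_def)
  then show ?thesis by (simp add: card_funcsetE)
qed

lemma sum_pairs_swap:
  "(\<Sum>\<tau>\<in>tuples. card {(z, z') \<in> V \<times> V. R z z' \<tau>}) = (\<Sum>z\<in>V. \<Sum>z'\<in>V. card {\<tau> \<in> tuples. R z z' \<tau>})"
proof -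
  have eq: "{(z, z') \<in> V \<times> V. R z z' \<tau>} = {p \<in> V \<times> V. R (fst p) (snd p) \<tau>}" for \<tau> by auto
  have "(\<Sum>\<tau>\<in>tuples. card {p \<in> V \<times> V. R (fst p) (snd p) \<tau>}) = (\<Sum>p\<in>V \<times> V. card {\<tau> \<in> tuples. R (fst p) (snd p) \<tau>})"
    using finV by (intro sum_card_swap) auto
  also have "\<dots> = (\<Sum>z\<in>V. \<Sum>z'\<in>V. card {\<tau> \<in> tuples. R z z' \<tau>})"
    by (simp add: sum.cartesian_product case_prod_beta)
  finally show ?thesis by (simp only: eq)
qed

text \<open>Counted by tuples, the moment is the sum of the squared numbers of hubs. Sampling
  reduces each square to nice pairs, and counting back by pairs leaves only light pairs with light
  midpoints.\<close>

lemma sum_k_power_le_lite_common: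
  "(\<Sum>z\<in>V. \<Sum>z'\<in>V. k z z' ^ (t + 1)) \<le> pair_ramsey ^ 2 * (\<Sum>z\<in>V. \<Sum>z'\<in>V. if lite z z' then card (lite_common z z') ^ (t + 1) else 0)"
proof -
  have "(\<Sum>z\<in>V. \<Sum>z'\<in>V. k z z' ^ (t + 1)) = (\<Sum>z\<in>V. \<Sum>z'\<in>V. card {\<tau> \<in> tuples. \<forall>i\<le>t. \<tau> i \<in> nb2 z \<inter> nb2 z'})"
    using nb2_subset_V by (intro sum.cong refl) (subst card_tuples, auto simp: k_def)
  also have "\<dots> = (\<Sum>\<tau>\<in>tuples. card {(z, z') \<in> V \<times> V. \<forall>i\<le>t. \<tau> i \<in> nb2 z \<inter> nb2 z'})" by (rule sum_pairs_swap[symmetric])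
  also have "\<dots> = (\<Sum>\<tau>\<in>tuples. card (hubs \<tau>) ^ 2)"
  proof (intro sum.cong refl)
    fix \<tau>
    have "{(z, z') \<in> V \<times> V. \<forall>i\<le>t. \<tau> i \<in> nb2 z \<inter> nb2 z'} = hubs \<tau> \<times> hubs \<tau>" by (auto simp: hubs_def)
    then show "card {(z, z') \<in> V \<times> V. \<forall>i\<le>t. \<tau> i \<in> nb2 z \<inter> nb2 z'} = card (hubs \<tau>) ^ 2"
      by (simp add: card_cartesian_product power2_eq_square)
  qed
  also have "\<dots> \<le> (\<Sum>\<tau>\<in>tuples. pair_ramsey ^ 2 * card {(z, z') \<in> hubs \<tau> \<times> hubs \<tau>. nice z z' \<tau>})"
    by (intro sum_mono nice_pairs) simp
  also have "\<dots> = pair_ramsey ^ 2 * (\<Sum>\<tau>\<in>tuples. card {(z, z') \<in> V \<times> V. z \<in> hubs \<tau> \<and> z' \<in> hubs \<tau> \<and> nice z z' \<tau>})"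
    unfolding sum_distrib_left
    by (intro sum.cong refl arg_cong2[where f = "(*)"] arg_cong[where f = card]) (auto simp: hubs_def)
  also have "(\<Sum>\<tau>\<in>tuples. card {(z, z') \<in> V \<times> V. z \<in> hubs \<tau> \<and> z' \<in> hubs \<tau> \<and> nice z z' \<tau>})
     = (\<Sum>z\<in>V. \<Sum>z'\<in>V. card {\<tau> \<in> tuples. z \<in> hubs \<tau> \<and> z' \<in> hubs \<tau> \<and> nice z z' \<tau>})" by (rule sum_pairs_swap)
  also have "\<dots> = (\<Sum>z\<in>V. \<Sum>z'\<in>V. if lite z z' then card (lite_common z z') ^ (t + 1) else 0)"
  proof (intro sum.cong refl)
    fix z z' assume z: "z \<in> V" "z' \<in> V"
    show "card {\<tau> \<in> tuples. z \<in> hubs \<tau> \<and> z' \<in> hubs \<tau> \<and> nice z z' \<tau>} = (if lite z z' then card (lite_common z z') ^ (t + 1) else 0)"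
    proof (cases "lite z z'")
      case True
      then have "{\<tau> \<in> tuples. z \<in> hubs \<tau> \<and> z' \<in> hubs \<tau> \<and> nice z z' \<tau>} = {\<tau> \<in> tuples. \<forall>i\<le>t. \<tau> i \<in> lite_common z z'}"
        using z by (auto simp: hubs_def nice_def lite_common_def)
      moreover have "lite_common z z' \<subseteq> V" using nb2_subset_V by (auto simp: lite_common_def)
      ultimately show ?thesis using True by (simp add: card_tuples)
    next
      case False
      then show ?thesis by (simp add: nice_def)
    qed
  qed
  finally show ?thesis .
qed

text \<open>\<open>b\<close> stands for a midpoint shared by z and z'; lightness towards
  \<open>b\<close> is what closes the count in \<open>sum_shared_spoke\<close>.\<close>

definition lite_common_at :: "'a \<Rightarrow> 'a \<Rightarrow> 'a \<Rightarrow> 'a set" where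
  "lite_common_at z z' b = {x \<in> lite_common z z'. \<not> heavy b (mid z' x)}"

text \<open>Let v and m be the midpoints of x towards z and z'. If v = m, then x is adjacent to a
  common neighbour of z and z'. Otherwise v, m is a light pair, v lies in \<open>starts z m\<close>,
  and x is one of boundedly many common neighbours of v and m.\<close>

lemma card_lite_common_at:
  assumes "z' \<in> nb2 z"
  shows "card (lite_common_at z z' b) \<le> hsz * \<Delta> + (\<Sum>m\<in>{m \<in> nb z'. \<not> heavy b m}. hsz * card (starts z m))"
proof -
  let ?M = "{m \<in> nb z'. \<not> heavy b m}"
  let ?X = "\<Union>m\<in>nb z \<inter> nb z'. nb m"
  let ?Y = "\<Union>m\<in>?M. \<Union>v\<in>{v \<in> starts z m. \<not> heavy v m}. nb v \<inter> nb m"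
  have "lite_common_at z z' b \<subseteq> ?X \<union> ?Y"
  proof
    fix x assume x: "x \<in> lite_common_at z z' b"
    define m where "m = mid z' x"
    define v where "v = mid z x"
    have xN: "x \<in> nb2 z" "x \<in> nb2 z'" and lt: "lite v m" and hb: "\<not> heavy b m"
      using x by (auto simp: lite_common_at_def lite_common_def v_def m_def)
    have m: "E z' m" "E m x" using mid_adj[OF xN(2)] by (auto simp: m_def)
    have v: "E z v" "E v x" using mid_adj[OF xN(1)] by (auto simp: v_def)
    show "x \<in> ?X \<union> ?Y"
    proof (cases "v = m")
      case True
      then show ?thesis using m v by auto
    next
      case False
      then have "\<not> heavy v m" using lt by (simp add: lite_def)
      moreover have "v \<in> starts z m" using v m xN sym by (auto simp: starts_def)
      ultimately show ?thesis using m v hb by auto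
    qed
  qed
  then have "card (lite_common_at z z' b) \<le> card (?X \<union> ?Y)" by (intro card_mono) auto
  also have "\<dots> \<le> card ?X + card ?Y" by (rule card_Un_le)
  also have "card ?X \<le> hsz * \<Delta>"
    by (rule card_UN_bound) (use assms card_nb not_heavy in \<open>auto simp: nb2_def\<close>)
  also have "card ?Y \<le> (\<Sum>m\<in>?M. card (\<Union>v\<in>{v \<in> starts z m. \<not> heavy v m}. nb v \<inter> nb m))"
    by (rule card_UN_le) simp
  also have "\<dots> \<le> (\<Sum>m\<in>?M. hsz * card (starts z m))"
  proof (intro sum_mono)
    fix m
    have "card {v \<in> starts z m. \<not> heavy v m} \<le> card (starts z m)" by (intro card_mono) auto
    then have "card (\<Union>v\<in>{v \<in> starts z m. \<not> heavy v m}. nb v \<inter> nb m) \<le> card (starts z m) * hsz"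
      by (intro card_UN_bound) (use not_heavy in auto)
    then show "card (\<Union>v\<in>{v \<in> starts z m. \<not> heavy v m}. nb v \<inter> nb m) \<le> hsz * card (starts z m)"
      by (simp add: mult.commute)
  qed
  finally show ?thesis by simp
qed

lemma lite_common_at_power:
  assumes "z' \<in> nb2 z"
  shows "card (lite_common_at z z' b) ^ t \<le> 2 ^ t * hsz ^ t * (\<Delta> ^ t + \<Delta> ^ (t - 1) * (\<Sum>m\<in>{m \<in> nb z'. \<not> heavy b m}. card (starts z m) ^ t))"
proof -
  let ?M = "{m \<in> nb z'. \<not> heavy b m}"
  have cM: "card ?M \<le> \<Delta>"
    by (rule order_trans[OF card_mono[OF finite_nb] card_nb[of z']]) auto
  have "card (lite_common_at z z' b) ^ t \<le> (hsz * \<Delta> + (\<Sum>m\<in>?M. hsz * card (starts z m))) ^ t"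
    using card_lite_common_at[OF assms] by (rule power_mono) simp
  also have "\<dots> \<le> 2 ^ t * ((hsz * \<Delta>) ^ t + (\<Sum>m\<in>?M. hsz * card (starts z m)) ^ t)" by (rule nat_power_add_le)
  also have "(\<Sum>m\<in>?M. hsz * card (starts z m)) ^ t = hsz ^ t * (\<Sum>m\<in>?M. card (starts z m)) ^ t"
    by (simp add: sum_distrib_left[symmetric] power_mult_distrib)
  also have "(\<Sum>m\<in>?M. card (starts z m)) ^ t \<le> \<Delta> ^ (t - 1) * (\<Sum>m\<in>?M. card (starts z m) ^ t)"
    by (rule nat_power_sum_le) (use cM t2 in auto)
  finally show ?thesis by (simp add: power_mult_distrib algebra_simps)
qed

definition "C3 = 1 + 2 ^ t * hsz ^ t * (1 + hsz * C1)"

text \<open>\<open>lite_common_at_power\<close> leads to t-th powers of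
  \<open>card (starts z m)\<close>. Counting the pairs z', b for a given m supplies one more factor
  of the same kind, so that \<open>sum_starts_power\<close> applies.\<close>

lemma sum_shared_spoke:
  assumes z: "z \<in> V"
  shows "(\<Sum>z'\<in>nb2 z. \<Sum>b\<in>nb z \<inter> nb z'. \<Delta> * card (lite_common_at z z' b) ^ t) \<le> 2 ^ t * hsz ^ t * (1 + hsz * C1) * \<Delta> ^ (2 * t + 2)"
proof -
  let ?S = "\<lambda>b z'. \<Sum>m\<in>{m \<in> nb z'. \<not> heavy b m}. card (starts z m) ^ t"
  let ?B = "\<lambda>z'. nb z \<inter> nb z'"
  have c: "(\<Sum>z'\<in>nb2 z. card (?B z')) \<le> \<Delta> ^ 2"
  proof -
    have "(\<Sum>z'\<in>nb2 z. card (?B z')) = (\<Sum>z'\<in>nb2 z. card {b \<in> nb z. b \<in> nb z'})" by (simp add: Int_def)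
    also have "\<dots> = (\<Sum>b\<in>nb z. card {z' \<in> nb2 z. b \<in> nb z'})" by (intro sum_card_swap) auto
    also have "\<dots> \<le> (\<Sum>b\<in>nb z. \<Delta>)"
    proof (intro sum_mono)
      fix b
      have "card {z' \<in> nb2 z. b \<in> nb z'} \<le> card (nb b)" using sym by (intro card_mono) auto
      then show "card {z' \<in> nb2 z. b \<in> nb z'} \<le> \<Delta>" using card_nb[of b] by simp
    qed
    also have "\<dots> \<le> \<Delta> ^ 2" using card_nb[of z] by (simp add: power2_eq_square)
    finally show ?thesis .
  qed
  have s: "(\<Sum>z'\<in>nb2 z. \<Sum>b\<in>?B z'. ?S b z') \<le> hsz * (C1 * \<Delta> ^ (t + 2))"
  proof -
    let ?I = "{(z', b). z' \<in> nb2 z \<and> b \<in> ?B z'}"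
    have finI: "finite ?I" by (rule finite_subset[of _ "nb2 z \<times> nb z"]) auto
    have "(\<Sum>z'\<in>nb2 z. \<Sum>b\<in>?B z'. ?S b z') = (\<Sum>(z', b)\<in>?I. ?S b z')"
      by (subst sum.Sigma) (auto intro!: sum.cong)
    also have "\<dots> = (\<Sum>p\<in>?I. \<Sum>m\<in>V. if E (fst p) m \<and> \<not> heavy (snd p) m then card (starts z m) ^ t else 0)"
    proof (intro sum.cong refl, clarify)
      fix z' b
      have "{m \<in> V. E z' m \<and> \<not> heavy b m} = {m \<in> nb z'. \<not> heavy b m}" using inV sym by auto
      then show "?S b z' = (\<Sum>m\<in>V. if E (fst (z', b)) m \<and> \<not> heavy (snd (z', b)) m then card (starts z m) ^ t else 0)"
        using finV by (simp add: sum.inter_filter[symmetric])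
    qed
    also have "\<dots> = (\<Sum>m\<in>V. \<Sum>p\<in>?I. if E (fst p) m \<and> \<not> heavy (snd p) m then card (starts z m) ^ t else 0)"
      by (rule sum.swap)
    also have "\<dots> = (\<Sum>m\<in>V. card {p \<in> ?I. E (fst p) m \<and> \<not> heavy (snd p) m} * card (starts z m) ^ t)"
      using finI by (simp add: sum.inter_filter[symmetric])
    also have "\<dots> \<le> (\<Sum>m\<in>V. (card (starts z m) * hsz) * card (starts z m) ^ t)"
    proof (intro sum_mono mult_le_mono1)
      fix m
      let ?Q = "{p \<in> ?I. E (fst p) m \<and> \<not> heavy (snd p) m}"
      let ?W = "\<Union>b\<in>{b \<in> starts z m. \<not> heavy b m}. (\<lambda>z'. (z', b)) ` (nb b \<inter> nb m)"
      \<comment> \<open>z' itself is the third vertex of a walk z - b - z' - m, so b is in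
        \<open>starts z m\<close>; as b, m is light, z' has boundedly many choices.\<close>
      have "?Q \<subseteq> ?W"
      proof clarify
        fix z' b assume a: "z' \<in> nb2 z" "b \<in> nb z" "b \<in> nb z'" "E (fst (z', b)) m" "\<not> heavy (snd (z', b)) m"
        then have "b \<in> starts z m" using sym by (auto simp: starts_def)
        then show "(z', b) \<in> ?W" using a sym by auto
      qed
      then have "card ?Q \<le> card ?W" by (intro card_mono) auto
      also have "\<dots> \<le> card (starts z m) * hsz"
      proof (rule card_UN_bound)
        show "card {b \<in> starts z m. \<not> heavy b m} \<le> card (starts z m)" by (intro card_mono) auto
        fix b assume "b \<in> {b \<in> starts z m. \<not> heavy b m}"
        then show "card ((\<lambda>z'. (z', b)) ` (nb b \<inter> nb m)) \<le> hsz"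
          using not_heavy[of b m] card_image_le[of "nb b \<inter> nb m" "\<lambda>z'. (z', b)"] by auto
      qed simp
      finally show "card ?Q \<le> card (starts z m) * hsz" .
    qed
    also have "\<dots> = hsz * (\<Sum>m\<in>V. card (starts z m) ^ (t + 1))" by (simp add: sum_distrib_left algebra_simps)
    also have "\<dots> \<le> hsz * (C1 * \<Delta> ^ (t + 2))" by (intro mult_le_mono2 sum_starts_power)
    finally show ?thesis .
  qed
  have "(\<Sum>z'\<in>nb2 z. \<Sum>b\<in>?B z'. \<Delta> * card (lite_common_at z z' b) ^ t)
      \<le> (\<Sum>z'\<in>nb2 z. \<Sum>b\<in>?B z'. \<Delta> * (2 ^ t * hsz ^ t * (\<Delta> ^ t + \<Delta> ^ (t - 1) * ?S b z')))"
    by (intro sum_mono mult_le_mono2 lite_common_at_power) auto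
  also have "\<dots> = \<Delta> * (2 ^ t * hsz ^ t) * (\<Delta> ^ t * (\<Sum>z'\<in>nb2 z. card (?B z')) + \<Delta> ^ (t - 1) * (\<Sum>z'\<in>nb2 z. \<Sum>b\<in>?B z'. ?S b z'))"
    by (simp add: sum_distrib_left sum.distrib algebra_simps)
  also have "\<dots> \<le> \<Delta> * (2 ^ t * hsz ^ t) * (\<Delta> ^ t * \<Delta> ^ 2 + \<Delta> ^ (t - 1) * (hsz * (C1 * \<Delta> ^ (t + 2))))"
    by (intro mult_le_mono2 add_mono c s)
  also have "\<dots> = 2 ^ t * hsz ^ t * (\<Delta> ^ (t + 3) + hsz * C1 * \<Delta> ^ (2 * t + 2))"
  proof -
    have "Suc (t - 1) + (t + 2) = 2 * t + 2" "Suc t + 2 = t + 3" using t2 by auto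
    then have a: "\<Delta> * \<Delta> ^ (t - 1) * \<Delta> ^ (t + 2) = \<Delta> ^ (2 * t + 2)" "\<Delta> * \<Delta> ^ t * \<Delta> ^ 2 = \<Delta> ^ (t + 3)"
      by (metis power_Suc power_add)+
    have "\<Delta> * (2 ^ t * hsz ^ t) * (\<Delta> ^ t * \<Delta> ^ 2 + \<Delta> ^ (t - 1) * (hsz * (C1 * \<Delta> ^ (t + 2))))
      = 2 ^ t * hsz ^ t * (\<Delta> * \<Delta> ^ t * \<Delta> ^ 2 + hsz * C1 * (\<Delta> * \<Delta> ^ (t - 1) * \<Delta> ^ (t + 2)))"
      by (simp only: distrib_left mult_ac)
    then show ?thesis by (simp only: a)
  qed
  also have "\<dots> \<le> 2 ^ t * hsz ^ t * (\<Delta> ^ (2 * t + 2) + hsz * C1 * \<Delta> ^ (2 * t + 2))"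
    using \<Delta>_mono[of "t + 3" "2 * t + 2"] t2 by simp
  finally show ?thesis by (simp add: algebra_simps)
qed

text \<open>A single hub has at most \<Delta>^(2 t + 2) tuples; this is the diagonal. Otherwise z
  and z' share the neighbour b = \<open>mid z (\<tau> i)\<close> and, being light, form an
  \<open>nb2\<close> pair. Then \<open>\<tau> i\<close> is one of at most \<Delta> neighbours of b,
  and the other entries lie in \<open>lite_common_at z z' b\<close>.\<close>

lemma sum_shared_pairs:
  assumes i: "i \<le> t"
  shows "(\<Sum>\<tau>\<in>tuples. card {(z, z') \<in> scattered_hubs \<tau> \<times> scattered_hubs \<tau>. mid z (\<tau> i) = mid z' (\<tau> i) \<and> nice z z' \<tau>})
    \<le> C3 * card V * \<Delta> ^ (2 * t + 2)"
proof -
  let ?R = "\<lambda>z z' \<tau>. z \<in> scattered_hubs \<tau> \<and> z' \<in> scattered_hubs \<tau> \<and> mid z (\<tau> i) = mid z' (\<tau> i) \<and> nice z z' \<tau>"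
  let ?f = "\<lambda>z z'. card {\<tau> \<in> tuples. ?R z z' \<tau>}"
  have "(\<Sum>\<tau>\<in>tuples. card {(z, z') \<in> scattered_hubs \<tau> \<times> scattered_hubs \<tau>. mid z (\<tau> i) = mid z' (\<tau> i) \<and> nice z z' \<tau>})
     = (\<Sum>\<tau>\<in>tuples. card {(z, z') \<in> V \<times> V. ?R z z' \<tau>})"
    by (intro sum.cong refl arg_cong[where f = card]) (auto simp: scattered_hubs_def hubs_def)
  also have "\<dots> = (\<Sum>z\<in>V. \<Sum>z'\<in>V. ?f z z')" by (rule sum_pairs_swap)
  also have "\<dots> \<le> (\<Sum>z\<in>V. C3 * \<Delta> ^ (2 * t + 2))"
  proof (intro sum_mono)
    fix z assume z: "z \<in> V"
    have diag: "?f z z \<le> \<Delta> ^ (2 * t + 2)"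
    proof -
      have "?f z z \<le> card {\<tau> \<in> tuples. \<forall>i\<le>t. \<tau> i \<in> nb2 z}" by (intro card_mono) (auto simp: scattered_hubs_def hubs_def)
      also have "\<dots> = card (nb2 z) ^ (t + 1)" by (rule card_tuples[OF nb2_subset_V])
      also have "\<dots> \<le> (\<Delta> ^ 2) ^ (t + 1)" by (intro power_mono card_nb2) simp
      finally show ?thesis by (simp only: D_eq)
    qed
    have zero: "?f z z' = 0" if "z' \<noteq> z" "z' \<notin> nb2 z" for z'
    proof -
      have "\<not> ?R z z' \<tau>" for \<tau>
      proof
        assume R: "?R z z' \<tau>"
        then have "z \<in> hubs \<tau>" "z' \<in> hubs \<tau>" by (auto simp: scattered_hubs_def)
        then have "\<tau> i \<in> nb2 z" "\<tau> i \<in> nb2 z'" using i by (auto simp: hubs_def)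
        from mid_adj[OF this(1)] mid_adj[OF this(2)] have "mid z (\<tau> i) \<in> nb z \<inter> nb z'" using R by auto
        moreover have "\<not> heavy z z'" using R that by (auto simp: nice_def lite_def)
        ultimately show False using that by (auto simp: nb2_def)
      qed
      then show ?thesis by simp
    qed
    have off: "?f z z' \<le> (\<Sum>b\<in>nb z \<inter> nb z'. \<Delta> * card (lite_common_at z z' b) ^ t)" if "z' \<in> nb2 z" for z'
    proof -
      let ?Pi = "\<lambda>b. PiE {..t} (\<lambda>j. if j = i then nb b else lite_common_at z z' b)"
      have "{\<tau> \<in> tuples. ?R z z' \<tau>} \<subseteq> (\<Union>b\<in>nb z \<inter> nb z'. ?Pi b)"
      proof
        fix \<tau> assume \<tau>: "\<tau> \<in> {\<tau> \<in> tuples. ?R z z' \<tau>}"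
        define b where "b = mid z (\<tau> i)"
        have N: "\<tau> j \<in> nb2 z" "\<tau> j \<in> nb2 z'" if "j \<le> t" for j using \<tau> that by (auto simp: scattered_hubs_def hubs_def)
        have b': "b = mid z' (\<tau> i)" using \<tau> by (simp add: b_def)
        have "b \<in> nb z \<inter> nb z'" "\<tau> i \<in> nb b"
          using mid_adj[OF N(1)[OF i]] mid_adj[OF N(2)[OF i]] b' by (auto simp: b_def)
        moreover have "\<tau> j \<in> lite_common_at z z' b" if "j \<le> t" "j \<noteq> i" for j
        proof -
          have "lite (mid z (\<tau> j)) (mid z' (\<tau> j))" using \<tau> that by (auto simp: nice_def)
          moreover have "\<not> heavy (mid z' (\<tau> i)) (mid z' (\<tau> j))"
            using \<tau> that i unfolding scattered_hubs_def scattered_def by blast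
          ultimately show ?thesis using N that b' by (simp add: lite_common_at_def lite_common_def)
        qed
        ultimately have "\<tau> \<in> ?Pi b" using \<tau> by (auto simp: tuples_def PiE_iff)
        then show "\<tau> \<in> (\<Union>b\<in>nb z \<inter> nb z'. ?Pi b)" using \<open>b \<in> nb z \<inter> nb z'\<close> by blast
      qed
      then have "?f z z' \<le> card (\<Union>b\<in>nb z \<inter> nb z'. ?Pi b)"
        by (intro card_mono finite_UN_I finite_PiE) (auto simp: lite_common_at_def)
      also have "\<dots> \<le> (\<Sum>b\<in>nb z \<inter> nb z'. card (?Pi b))" by (rule card_UN_le) simp
      also have "\<dots> \<le> (\<Sum>b\<in>nb z \<inter> nb z'. \<Delta> * card (lite_common_at z z' b) ^ t)"
      proof (intro sum_mono)
        fix b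
        have "card (?Pi b) = (\<Prod>j\<in>{..t}. card (if j = i then nb b else lite_common_at z z' b))" by (intro card_PiE) simp
        also have "\<dots> = card (nb b) * (\<Prod>j\<in>{..t} - {i}. card (if j = i then nb b else lite_common_at z z' b))"
          using i by (subst prod.remove[of _ i]) auto
        also have "(\<Prod>j\<in>{..t} - {i}. card (if j = i then nb b else lite_common_at z z' b)) = (\<Prod>j\<in>{..t} - {i}. card (lite_common_at z z' b))"
          by (intro prod.cong) auto
        also have "\<dots> = card (lite_common_at z z' b) ^ t" using i by (simp add: card_Diff_singleton)
        finally show "card (?Pi b) \<le> \<Delta> * card (lite_common_at z z' b) ^ t" using card_nb[of b] by simp
      qed
      finally show ?thesis .
    qed
    have "(\<Sum>z'\<in>V. ?f z z') = (\<Sum>z'\<in>insert z (nb2 z). ?f z z')"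
      using zero z nb2_subset_V[of z] finV by (intro sum.mono_neutral_right) auto
    also have "\<dots> = ?f z z + (\<Sum>z'\<in>nb2 z. ?f z z')"
    proof (rule sum.insert)
      show "z \<notin> nb2 z" by (simp add: nb2_def)
    qed simp
    also have "\<dots> \<le> \<Delta> ^ (2 * t + 2) + (\<Sum>z'\<in>nb2 z. \<Sum>b\<in>nb z \<inter> nb z'. \<Delta> * card (lite_common_at z z' b) ^ t)"
      by (intro add_mono diag sum_mono off)
    also have "\<dots> \<le> \<Delta> ^ (2 * t + 2) + 2 ^ t * hsz ^ t * (1 + hsz * C1) * \<Delta> ^ (2 * t + 2)"
      by (intro add_left_mono sum_shared_spoke z)
    finally show "(\<Sum>z'\<in>V. ?f z z') \<le> C3 * \<Delta> ^ (2 * t + 2)" by (simp add: C3_def algebra_simps)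
  qed
  finally show ?thesis by (simp add: algebra_simps)
qed

text \<open>A scattered hub is the centre of a spider on the tuple, so the hub or one of its
  midpoints is in the hitting set. This sorts the hubs into at most \<open>hsz * (t + 2)\<close>
  classes; a class is a single vertex or consists of hubs sharing a midpoint.\<close>

lemma card_scattered_hubs_square:
  assumes na: "\<not> ample \<tau>"
  shows "card (scattered_hubs \<tau>) ^ 2 \<le> (hsz * (t + 2)) * (card (scattered_hubs \<tau>) +
    pair_ramsey ^ 2 * (\<Sum>i\<le>t. card {(z, z') \<in> scattered_hubs \<tau> \<times> scattered_hubs \<tau>. mid z (\<tau> i) = mid z' (\<tau> i) \<and> nice z z' \<tau>}))"
proof -
  obtain B where B: "finite B" "card B \<le> hsz" "\<And>y g. spider E t y g \<tau> \<Longrightarrow> y \<in> B \<or> (\<exists>i\<le>t. g i \<in> B)"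
    using na nonample_hit by blast
  let ?F = "\<lambda>i b. {z \<in> scattered_hubs \<tau>. mid z (\<tau> i) = b}"
  \<comment> \<open>Index \<open>Suc t\<close> stands for the centre, the indices up to t for the
    midpoints.\<close>
  define G where "G = (\<lambda>(b, i). if i = Suc t then scattered_hubs \<tau> \<inter> {b} else ?F i b)"
  let ?I = "B \<times> {..Suc t}"
  have "scattered_hubs \<tau> \<subseteq> (\<Union>p\<in>?I. G p)"
  proof
    fix z assume z: "z \<in> scattered_hubs \<tau>"
    have "spider E t z (\<lambda>i. mid z (\<tau> i)) \<tau>"
      unfolding spider_def
    proof
      show "inj_on (\<lambda>i. mid z (\<tau> i)) {..t}"
        using z unfolding scattered_hubs_def scattered_def inj_on_def by (metis (mono_tags, lifting) atMost_iff mem_Collect_eq)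
      show "\<forall>i\<le>t. E z (mid z (\<tau> i)) \<and> E (mid z (\<tau> i)) (\<tau> i)"
        using z mid_adj by (auto simp: scattered_hubs_def hubs_def)
    qed
    from B(3)[OF this] show "z \<in> (\<Union>p\<in>?I. G p)"
    proof
      assume "z \<in> B"
      then show ?thesis using z by (intro UN_I[of "(z, Suc t)"]) (auto simp: G_def)
    next
      assume "\<exists>i\<le>t. mid z (\<tau> i) \<in> B"
      then obtain i where "i \<le> t" "mid z (\<tau> i) \<in> B" by blast
      then show ?thesis using z by (intro UN_I[of "(mid z (\<tau> i), i)"]) (auto simp: G_def)
    qed
  qed
  moreover have finG: "finite (G p)" for p by (auto simp: G_def split: prod.split)
  ultimately have "card (scattered_hubs \<tau>) \<le> card (\<Union>p\<in>?I. G p)" using B(1) by (intro card_mono) auto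
  also have "\<dots> \<le> (\<Sum>p\<in>?I. card (G p))" using B(1) by (intro card_UN_le) simp
  finally have "card (scattered_hubs \<tau>) ^ 2 \<le> (\<Sum>p\<in>?I. card (G p)) ^ 2" by (rule power_mono) simp
  also have "\<dots> \<le> (hsz * (t + 2)) ^ (2 - 1) * (\<Sum>p\<in>?I. card (G p) ^ 2)"
  proof (rule nat_power_sum_le)
    have "card ?I = card B * (t + 2)" by (simp add: card_cartesian_product)
    then show "card ?I \<le> hsz * (t + 2)" using B(2) by (simp only: mult_le_mono1)
  qed (use B in auto)
  also have "\<dots> = (hsz * (t + 2)) * (\<Sum>p\<in>?I. card (G p) ^ 2)" by simp
  also have "(\<Sum>p\<in>?I. card (G p) ^ 2) = (\<Sum>b\<in>B. card (scattered_hubs \<tau> \<inter> {b}) ^ 2) + (\<Sum>i\<le>t. \<Sum>b\<in>B. card (?F i b) ^ 2)"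
  proof -
    have "(\<Sum>p\<in>?I. card (G p) ^ 2) = (\<Sum>b\<in>B. \<Sum>i\<le>Suc t. card (G (b, i)) ^ 2)"
      by (simp only: sum.cartesian_product case_prod_eta) (simp add: case_prod_beta)
    also have "\<dots> = (\<Sum>b\<in>B. (\<Sum>i\<le>t. card (?F i b) ^ 2) + card (scattered_hubs \<tau> \<inter> {b}) ^ 2)"
      by (intro sum.cong refl) (simp add: G_def)
    also have "\<dots> = (\<Sum>i\<le>t. \<Sum>b\<in>B. card (?F i b) ^ 2) + (\<Sum>b\<in>B. card (scattered_hubs \<tau> \<inter> {b}) ^ 2)"
      by (simp only: sum.distrib) (subst sum.swap, rule refl)
    finally show ?thesis by simp
  qed
  also have "\<dots> \<le> card (scattered_hubs \<tau>) + (\<Sum>i\<le>t. pair_ramsey ^ 2 * card {(z, z') \<in> scattered_hubs \<tau> \<times> scattered_hubs \<tau>. mid z (\<tau> i) = mid z' (\<tau> i) \<and> nice z z' \<tau>})"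
  proof (intro add_mono sum_mono)
    have "(\<Sum>b\<in>B. card (scattered_hubs \<tau> \<inter> {b}) ^ 2) = (\<Sum>b\<in>B. if b \<in> scattered_hubs \<tau> then 1 else 0)"
      by (intro sum.cong refl) auto
    also have "\<dots> = card {b \<in> B. b \<in> scattered_hubs \<tau>}" using B(1) by (simp add: sum.inter_filter[symmetric])
    also have "\<dots> \<le> card (scattered_hubs \<tau>)" by (intro card_mono) auto
    finally show "(\<Sum>b\<in>B. card (scattered_hubs \<tau> \<inter> {b}) ^ 2) \<le> card (scattered_hubs \<tau>)" .
    fix i
    have "(\<Sum>b\<in>B. card (?F i b) ^ 2) = (\<Sum>b\<in>B. card (?F i b \<times> ?F i b))"
      by (simp add: card_cartesian_product power2_eq_square)
    also have "\<dots> = card (\<Union>b\<in>B. ?F i b \<times> ?F i b)"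
      using B(1) by (intro card_UN_disjoint[symmetric]) auto
    also have "\<dots> \<le> card {(z, z') \<in> scattered_hubs \<tau> \<times> scattered_hubs \<tau>. mid z (\<tau> i) = mid z' (\<tau> i)}"
    proof (rule card_mono)
      show "finite {(z, z') \<in> scattered_hubs \<tau> \<times> scattered_hubs \<tau>. mid z (\<tau> i) = mid z' (\<tau> i)}"
        by (rule finite_subset[of _ "scattered_hubs \<tau> \<times> scattered_hubs \<tau>"]) auto
    qed auto
    also have "\<dots> \<le> pair_ramsey ^ 2 * card {(z, z') \<in> scattered_hubs \<tau> \<times> scattered_hubs \<tau>. mid z (\<tau> i) = mid z' (\<tau> i) \<and> nice z z' \<tau>}"
      by (rule nice_fiber_pairs) simp
    finally show "(\<Sum>b\<in>B. card (?F i b) ^ 2) \<le> \<dots>" .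
  qed
  finally show ?thesis by (simp only: sum_distrib_left mult_le_mono2)
qed

definition "C2 = pair_ramsey ^ 2 * (1 + (4 * tuple_ramsey ^ 2) ^ t + 2 * tuple_ramsey ^ (t + 1) * ((hsz * (t + 2)) * (1 + pair_ramsey ^ 2 * ((t + 1) * C3))))"

text \<open>The bound has the order of the diagonal z = z', where k may be \<Delta>^2. Small sets
  \<open>lite_common z z'\<close> are controlled by the first moment \<open>sum_k\<close>, using t +
  4 <= 2 t + 2. Large ones contain many non-ample scattered tuples, and these are counted by
  \<open>card_scattered_hubs_square\<close>.\<close>

lemma sum_k_power: "(\<Sum>z\<in>V. \<Sum>z'\<in>V. k z z' ^ (t + 1)) \<le> C2 * card V * \<Delta> ^ (2 * t + 2)"
proof -
  let ?D = "card V * \<Delta> ^ (2 * t + 2)"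
  \<comment> \<open>\<Delta> bounds the fibres of \<open>mid z\<close>, so this is the size
    threshold of \<open>many_nonample\<close>.\<close>
  let ?q = "4 * tuple_ramsey ^ 2 * \<Delta>"
  let ?T = "{\<tau> \<in> tuples. \<not> ample \<tau>}"
  let ?R = "\<lambda>z z' \<tau>. \<not> ample \<tau> \<and> z \<in> scattered_hubs \<tau> \<and> z' \<in> scattered_hubs \<tau>"
  let ?c = "hsz * (t + 2)"
  have one: "(if lite z z' then card (lite_common z z') ^ (t + 1) else 0) \<le>
      (if z = z' then \<Delta> ^ (2 * t + 2) else 0) + ?q ^ t * k z z' + 2 * tuple_ramsey ^ (t + 1) * card {\<tau> \<in> tuples. ?R z z' \<tau>}"
    if zV: "z \<in> V" "z' \<in> V" for z z'
  proof (cases "z = z'")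
    case True
    have "card (lite_common z z') ^ (t + 1) \<le> (\<Delta> ^ 2) ^ (t + 1)"
      using lite_common_le_k[of z z'] k_le[of z z'] by (intro power_mono) auto
    also have "\<dots> = \<Delta> ^ (2 * t + 2)" by (rule D_eq)
    finally show ?thesis using True by (simp add: lite_def)
  next
    case False
    show ?thesis
    proof (cases "card (lite_common z z') < ?q \<or> lite_common z z' = {}")
      case True
      then have "card (lite_common z z') ^ (t + 1) \<le> ?q ^ t * card (lite_common z z')"
        using small_or_power_le[of "card (lite_common z z')" ?q t] by auto
      also have "\<dots> \<le> ?q ^ t * k z z'" by (intro mult_le_mono2 lite_common_le_k)
      finally show ?thesis by simp
    next
      case big: False
      have f: "card {x \<in> lite_common z z'. mid z x = v} \<le> \<Delta>" for v
        using card_mid_fiber[of z v] card_mono[of "{x \<in> nb2 z. mid z x = v}" "{x \<in> lite_common z z'. mid z x = v}"]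
        by (force simp: lite_common_def)
      have f': "card {x \<in> lite_common z z'. mid z' x = v} \<le> \<Delta>" for v
        using card_mid_fiber[of z' v] card_mono[of "{x \<in> nb2 z'. mid z' x = v}" "{x \<in> lite_common z z'. mid z' x = v}"]
        by (force simp: lite_common_def)
      have "card (lite_common z z') ^ (t + 1) \<le> 2 * tuple_ramsey ^ (t + 1) *
          card {\<tau> \<in> {..t} \<rightarrow>\<^sub>E lite_common z z'. \<not> ample \<tau> \<and> scattered (mid z) \<tau> \<and> scattered (mid z') \<tau>}"
        by (rule many_nonample[where \<kappa> = \<Delta>]) (use big f f' in auto)
      also have "card {\<tau> \<in> {..t} \<rightarrow>\<^sub>E lite_common z z'. \<not> ample \<tau> \<and> scattered (mid z) \<tau> \<and> scattered (mid z') \<tau>}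
          \<le> card {\<tau> \<in> tuples. ?R z z' \<tau>}"
      proof (intro card_mono subsetI)
        fix \<tau> assume \<tau>: "\<tau> \<in> {\<tau> \<in> {..t} \<rightarrow>\<^sub>E lite_common z z'. \<not> ample \<tau> \<and> scattered (mid z) \<tau> \<and> scattered (mid z') \<tau>}"
        then have "\<tau> i \<in> nb2 z" "\<tau> i \<in> nb2 z'" if "i \<le> t" for i
          using that by (auto simp: PiE_iff lite_common_def)
        then show "\<tau> \<in> {\<tau> \<in> tuples. ?R z z' \<tau>}" using \<tau> nb2_subset_V zV by (fastforce simp: tuples_def scattered_hubs_def hubs_def PiE_iff)
      qed simp
      finally show ?thesis by simp
    qed
  qed
  have s1: "(\<Sum>z\<in>V. \<Sum>z'\<in>V. if z = z' then \<Delta> ^ (2 * t + 2) else 0) = ?D"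
    using finV by simp
  have spread: "(\<Sum>z\<in>V. \<Sum>z'\<in>V. ?q ^ t * k z z') \<le> (4 * tuple_ramsey ^ 2) ^ t * ?D"
  proof -
    have "(\<Sum>z\<in>V. \<Sum>z'\<in>V. ?q ^ t * k z z') = ?q ^ t * (\<Sum>z\<in>V. \<Sum>z'\<in>V. k z z')"
      by (simp add: sum_distrib_left)
    also have "\<dots> \<le> ?q ^ t * (\<Sum>z\<in>V. \<Delta> ^ 4)" by (intro mult_le_mono2 sum_mono sum_k)
    also have "\<dots> = (4 * tuple_ramsey ^ 2) ^ t * (card V * \<Delta> ^ (t + 4))" by (simp add: power_mult_distrib power_add algebra_simps)
    also have "\<dots> \<le> (4 * tuple_ramsey ^ 2) ^ t * ?D" using \<Delta>_mono[of "t + 4" "2 * t + 2"] t2 by simp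
    finally show ?thesis .
  qed
  have a0: "(\<Sum>\<tau>\<in>tuples. card (scattered_hubs \<tau>)) \<le> ?D"
  proof -
    have "(\<Sum>\<tau>\<in>tuples. card (scattered_hubs \<tau>)) \<le> (\<Sum>\<tau>\<in>tuples. card {z \<in> V. \<forall>i\<le>t. \<tau> i \<in> nb2 z})"
      using finV by (intro sum_mono card_mono) (auto simp: scattered_hubs_def hubs_def)
    also have "\<dots> = (\<Sum>z\<in>V. card {\<tau> \<in> tuples. \<forall>i\<le>t. \<tau> i \<in> nb2 z})" by (intro sum_card_swap finV) simp
    also have "\<dots> = (\<Sum>z\<in>V. card (nb2 z) ^ (t + 1))" by (intro sum.cong refl card_tuples nb2_subset_V)
    also have "\<dots> \<le> (\<Sum>z\<in>V. (\<Delta> ^ 2) ^ (t + 1))" by (intro sum_mono power_mono card_nb2) simp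
    also have "\<dots> = ?D" by (simp only: D_eq sum_constant of_nat_id)
    finally show ?thesis .
  qed
  have s3: "(\<Sum>z\<in>V. \<Sum>z'\<in>V. card {\<tau> \<in> tuples. ?R z z' \<tau>}) \<le> ?c * (1 + pair_ramsey ^ 2 * ((t + 1) * C3)) * ?D"
  proof -
    let ?h = "\<lambda>\<tau> i. card {(z, z') \<in> scattered_hubs \<tau> \<times> scattered_hubs \<tau>. mid z (\<tau> i) = mid z' (\<tau> i) \<and> nice z z' \<tau>}"
    have "(\<Sum>z\<in>V. \<Sum>z'\<in>V. card {\<tau> \<in> tuples. ?R z z' \<tau>}) = (\<Sum>\<tau>\<in>tuples. card {(z, z') \<in> V \<times> V. ?R z z' \<tau>})"
      by (rule sum_pairs_swap[symmetric])
    also have "\<dots> \<le> (\<Sum>\<tau>\<in>tuples. ?c * (card (scattered_hubs \<tau>) + pair_ramsey ^ 2 * (\<Sum>i\<le>t. ?h \<tau> i)))"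
    proof (intro sum_mono)
      fix \<tau>
      show "card {(z, z') \<in> V \<times> V. ?R z z' \<tau>} \<le> ?c * (card (scattered_hubs \<tau>) + pair_ramsey ^ 2 * (\<Sum>i\<le>t. ?h \<tau> i))"
      proof (cases "ample \<tau>")
        case False
        have "card {(z, z') \<in> V \<times> V. ?R z z' \<tau>} \<le> card (scattered_hubs \<tau> \<times> scattered_hubs \<tau>)" by (intro card_mono) auto
        also have "\<dots> = card (scattered_hubs \<tau>) ^ 2" by (simp add: card_cartesian_product power2_eq_square)
        finally show ?thesis using card_scattered_hubs_square[OF False] by linarith
      qed simp
    qed
    also have "\<dots> = ?c * ((\<Sum>\<tau>\<in>tuples. card (scattered_hubs \<tau>)) + pair_ramsey ^ 2 * (\<Sum>i\<le>t. \<Sum>\<tau>\<in>tuples. ?h \<tau> i))"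
    proof -
      have "(\<Sum>i\<le>t. \<Sum>\<tau>\<in>tuples. ?h \<tau> i) = (\<Sum>\<tau>\<in>tuples. \<Sum>i\<le>t. ?h \<tau> i)" by (rule sum.swap)
      then show ?thesis by (simp only: sum_distrib_left[symmetric] sum.distrib)
    qed
    also have "\<dots> \<le> ?c * (?D + pair_ramsey ^ 2 * (\<Sum>i\<le>t. C3 * card V * \<Delta> ^ (2 * t + 2)))"
      by (intro mult_le_mono2 add_mono a0 sum_mono sum_shared_pairs) auto
    also have "\<dots> = ?c * (1 + pair_ramsey ^ 2 * ((t + 1) * C3)) * ?D" by (simp add: algebra_simps)
    finally show ?thesis .
  qed
  have "(\<Sum>z\<in>V. \<Sum>z'\<in>V. if lite z z' then card (lite_common z z') ^ (t + 1) else 0)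
      \<le> (\<Sum>z\<in>V. \<Sum>z'\<in>V. (if z = z' then \<Delta> ^ (2 * t + 2) else 0) + ?q ^ t * k z z' + 2 * tuple_ramsey ^ (t + 1) * card {\<tau> \<in> tuples. ?R z z' \<tau>})"
    by (intro sum_mono one)
  also have "\<dots> = (\<Sum>z\<in>V. \<Sum>z'\<in>V. if z = z' then \<Delta> ^ (2 * t + 2) else 0) + (\<Sum>z\<in>V. \<Sum>z'\<in>V. ?q ^ t * k z z')
      + 2 * tuple_ramsey ^ (t + 1) * (\<Sum>z\<in>V. \<Sum>z'\<in>V. card {\<tau> \<in> tuples. ?R z z' \<tau>})"
    by (simp only: sum.distrib sum_distrib_left)
  also have "\<dots> \<le> ?D + (4 * tuple_ramsey ^ 2) ^ t * ?D + 2 * tuple_ramsey ^ (t + 1) * (?c * (1 + pair_ramsey ^ 2 * ((t + 1) * C3)) * ?D)"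
    using s1 by (intro add_mono spread mult_le_mono2 s3) simp
  finally have "(\<Sum>z\<in>V. \<Sum>z'\<in>V. if lite z z' then card (lite_common z z') ^ (t + 1) else 0)
      \<le> (1 + (4 * tuple_ramsey ^ 2) ^ t + 2 * tuple_ramsey ^ (t + 1) * (?c * (1 + pair_ramsey ^ 2 * ((t + 1) * C3)))) * ?D"
    by (simp add: algebra_simps)
  then have "pair_ramsey ^ 2 * (\<Sum>z\<in>V. \<Sum>z'\<in>V. if lite z z' then card (lite_common z z') ^ (t + 1) else 0) \<le> C2 * ?D"
    unfolding C2_def mult.assoc by (intro mult_le_mono2)
  with sum_k_power_le_lite_common show ?thesis by (simp only: mult.assoc)
qed

end

lemma nat_split_power_le: "A * (x * y ^ n) \<le> y ^ Suc n + (A * x) ^ Suc n" for A x y :: nat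
proof -
  have "real (A * (x * y ^ n)) \<le> real (y ^ Suc n + (A * x) ^ Suc n)"
    using split_power_le[of "real x" "real y" "real A" n] by simp
  then show ?thesis by (simp only: of_nat_le_iff)
qed

definition matched :: "('y \<times> 'z) set \<Rightarrow> ('y \<times> 'z) set \<Rightarrow> ('y \<times> 'z \<times> 'y) set" where
  "matched A B = {(y, Z, y'). (y, Z) \<in> A \<and> (y', Z) \<in> B}"

lemma finite_matched [simp]: "finite A \<Longrightarrow> finite B \<Longrightarrow> finite (matched A B)"
proof -
  assume "finite A" "finite B"
  then have "finite ((\<lambda>(p, q). (fst p, snd p, fst q)) ` (A \<times> B))" by simp
  moreover have "matched A B \<subseteq> (\<lambda>(p, q). (fst p, snd p, fst q)) ` (A \<times> B)"
    unfolding matched_def by (auto simp: image_iff) force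
  ultimately show ?thesis by (rule finite_subset[rotated])
qed

text \<open>Sorted by the common component Z, the three cardinalities are scalar products of the
  vectors of fibre sizes.\<close>

lemma matched_Cauchy_Schwarz:
  assumes "finite A" "finite B"
  shows "card (matched A B) ^ 2 \<le> card (matched A A) * card (matched B B)"
proof -
  let ?Z = "snd ` A \<union> snd ` B"
  let ?f = "\<lambda>A Z. {y. (y, Z) \<in> A}"
  have fin: "finite (?f A Z)" if "finite A" for A :: "('a \<times> 'b) set" and Z
    by (rule finite_subset[of _ "fst ` A"]) (use that in force)+
  have eq: "card (matched P Q) = (\<Sum>Z\<in>?Z. card (?f P Z) * card (?f Q Z))"
    if "P = A \<or> P = B" "Q = A \<or> Q = B" for P Q
  proof -
    have f: "finite P" "finite Q" using that assms by auto
    have "card (matched P Q) = card (\<Union>Z\<in>?Z. (\<lambda>(y, y'). (y, Z, y')) ` (?f P Z \<times> ?f Q Z))"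
      using that by (intro arg_cong[where f = card]) (force simp: matched_def)
    also have "\<dots> = (\<Sum>Z\<in>?Z. card ((\<lambda>(y, y'). (y, Z, y')) ` (?f P Z \<times> ?f Q Z)))"
      using assms f by (intro card_UN_disjoint) (auto simp: fin)
    also have "\<dots> = (\<Sum>Z\<in>?Z. card (?f P Z \<times> ?f Q Z))"
      by (intro sum.cong refl card_image) (auto simp: inj_on_def)
    finally show ?thesis by (simp add: card_cartesian_product)
  qed
  have "(\<Sum>Z\<in>?Z. real (card (?f A Z)) * real (card (?f B Z)))\<^sup>2
      \<le> (\<Sum>Z\<in>?Z. (real (card (?f A Z)))\<^sup>2) * (\<Sum>Z\<in>?Z. (real (card (?f B Z)))\<^sup>2)"
    by (rule Cauchy_Schwarz_ineq_sum)
  then have "real (card (matched A B) ^ 2) \<le> real (card (matched A A) * card (matched B B))"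
    by (simp add: eq power2_eq_square)
  then show ?thesis by (simp only: of_nat_le_iff)
qed

section \<open>Branches of height one\<close>

text \<open>The average degree is within the factor \<open>K\<close> of the degree bound; this is
  what makes lower bounds for the number of trees possible.\<close>

locale dense_host = host +
  fixes K :: nat
  assumes r7: "r \<ge> 7" and rt: "r \<ge> t + 1" and avg: "card V * \<Delta> \<le> K * (\<Sum>v\<in>V. card (nb v))" and Vne: "V \<noteq> {}"
begin

abbreviation "D \<equiv> \<Delta> ^ (2 * t + 2)"
abbreviation "n \<equiv> card V"

lemma n1: "n \<ge> 1" using Vne finV by (simp add: Suc_le_eq card_gt_0_iff)
lemma K1: "K \<ge> 1"
proof (rule ccontr)
  assume "\<not> K \<ge> 1"
  then have "K = 0" by simp
  then have "n * \<Delta> = 0" using avg by simp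
  then show False using n1 \<Delta>1 by simp
qed

lemma pair_ramsey_ge_2: "pair_ramsey \<ge> 2" unfolding pair_ramsey_def by (rule lite_ramsey_ge)
lemma C2_ge_1: "C2 \<ge> 1"
proof -
  have "1 * 1 \<le> pair_ramsey ^ 2 * (1 + (4 * tuple_ramsey ^ 2) ^ t + 2 * tuple_ramsey ^ (t + 1) * ((hsz * (t + 2)) * (1 + pair_ramsey ^ 2 * ((t + 1) * C3))))"
    using pair_ramsey_ge_2 by (intro mult_le_mono) auto
  then show ?thesis by (simp add: C2_def)
qed

text \<open>\<open>\<kappa>\<close> is the loss in \<open>many_nb2\<close> and
  \<open>\<kappa>1\<close> its (t+1)-st power. \<open>M\<close> makes each of the four losses in
  \<open>many_S\<close> at most an eighth of the lower bound there. \<open>C6\<close> and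
  \<open>C8\<close> are Markov thresholds that leave a share of at most 1/M. \<open>C9\<close>
  counts degenerate legs: two vertices, two fibres and the popular set for one leg, three
  coincidences for a pair of legs.\<close>

definition "\<kappa> = 2 * K ^ 2 * pair_ramsey ^ 2 * hsz"
definition "\<kappa>1 = \<kappa> ^ (t + 1)"
definition "M = 8 * \<kappa>1"
definition "C6 = 2 * C2 * M"
definition "C8 = C6 * M"
definition "C9 = t * (4 + C6) + 3 * t ^ 2"

lemma \<kappa>1_1: "\<kappa>1 \<ge> 1" using K1 pair_ramsey_ge_2 hsz_ge_1 by (simp add: \<kappa>1_def \<kappa>_def Suc_le_eq)
lemma M1: "M \<ge> 1" using \<kappa>1_1 by (simp add: M_def)
lemma C6_ge_1: "C6 \<ge> 1" using M1 C2_ge_1 by (simp add: C6_def Suc_le_eq)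
lemma C8_ge_1: "C8 \<ge> 1" using M1 C6_ge_1 by (simp add: C8_def Suc_le_eq)

text \<open>Averaging shows that only a small part of the vertices, midpoints and legs is not \<open>good\<close>, has a large
  \<open>load\<close>, or is \<open>popular\<close>. Excluding them turns the averaged moment bounds into pointwise ones.\<close>

definition spread :: "'a \<Rightarrow> nat" where "spread w = (\<Sum>y\<in>nb2 w. \<Sum>y'\<in>nb2 w. k y y' ^ t)"
definition good :: "'a set" where
  "good = {z \<in> V. (\<Sum>z'\<in>V. k z z' ^ (t + 1)) \<le> C6 * D \<and> spread z \<le> C6 * D}"
definition load :: "'a \<Rightarrow> 'a \<Rightarrow> nat" where
  "load w u = (\<Sum>y\<in>{y \<in> nb2 w. mid w y = u}. \<Sum>y'\<in>{y \<in> nb2 w. mid w y = u}. k y y' ^ t)"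
definition spread_via :: "'a \<Rightarrow> 'a \<Rightarrow> nat" where
  "spread_via w v = (\<Sum>y\<in>nb2 w \<inter> nb2 v. \<Sum>y'\<in>nb2 w \<inter> nb2 v. k y y' ^ (t - 1))"
definition popular :: "'a \<Rightarrow> 'a set" where "popular w = {v \<in> V. spread_via w v > \<Delta> ^ (2 * t + 1)}"

text \<open>\<open>good_leg\<close> and \<open>good_leg_pair\<close> rule out the coincidences
  inside a branch that adjacency and \<open>nb2\<close> do not. The last conjunct keeps the number
  of branch pairs through a given leaf small.\<close>

definition good_leg :: "'a \<Rightarrow> 'a \<Rightarrow> 'a \<Rightarrow> bool" where
  "good_leg w y z \<longleftrightarrow> z \<noteq> w \<and> z \<noteq> mid w y \<and> mid y z \<noteq> w \<and> mid y z \<noteq> mid w y \<and> z \<notin> popular w"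
definition good_leg_pair :: "'a \<Rightarrow> 'a \<Rightarrow> 'a \<Rightarrow> bool" where
  "good_leg_pair y z z' \<longleftrightarrow> mid y z \<noteq> mid y z' \<and> mid y z \<noteq> z' \<and> mid y z' \<noteq> z"
definition nondegenerate :: "'a \<Rightarrow> 'a \<Rightarrow> (nat \<Rightarrow> 'a) \<Rightarrow> bool" where
  "nondegenerate w y Z \<longleftrightarrow> (\<forall>j<t. good_leg w y (Z j)) \<and> (\<forall>i<t. \<forall>j<t. i \<noteq> j \<longrightarrow> good_leg_pair y (Z i) (Z j))"
definition legs :: "'a \<Rightarrow> 'a \<Rightarrow> (nat \<Rightarrow> 'a) set" where
  "legs w y = {Z \<in> {..<t} \<rightarrow>\<^sub>E nb2 y. nondegenerate w y Z}"
definition centers :: "'a \<Rightarrow> 'a set" where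
  "centers w = {y \<in> nb2 w. y \<in> good \<and> load w (mid w y) \<le> C8 * \<Delta> ^ (2 * t + 1)}"
definition S :: "'a \<Rightarrow> ('a \<times> (nat \<Rightarrow> 'a)) set" where "S w = Sigma (centers w) (legs w)"

lemma good_subset_V: "good \<subseteq> V" by (auto simp: good_def)
lemma finite_good [simp]: "finite good" using good_subset_V finV by (rule finite_subset)
lemma finite_centers [simp]: "finite (centers w)" by (simp add: centers_def)
lemma finite_legs [simp]: "finite (legs w y)"
  by (rule finite_subset[of _ "{..<t} \<rightarrow>\<^sub>E nb2 y"]) (auto simp: legs_def intro!: finite_PiE)
lemma finite_S [simp]: "finite (S w)" by (simp add: S_def)
lemma centers_subset_nb2: "centers w \<subseteq> nb2 w" and centers_subset_good: "centers w \<subseteq> good" by (auto simp: centers_def)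
lemma card_centers: "card (centers w) \<le> \<Delta> ^ 2"
  by (rule order_trans[OF card_mono[OF finite_nb2 centers_subset_nb2] card_nb2])
lemma good_sum_k: "z \<in> good \<Longrightarrow> (\<Sum>z'\<in>V. k z z' ^ (t + 1)) \<le> C6 * D" by (simp add: good_def)
lemma good_spread: "z \<in> good \<Longrightarrow> spread z \<le> C6 * D" by (simp add: good_def)

lemma card_funcset_nb2: "card ({..<t} \<rightarrow>\<^sub>E nb2 y) \<le> \<Delta> ^ (2 * t)"
proof -
  have "card ({..<t} \<rightarrow>\<^sub>E nb2 y) = card (nb2 y) ^ t" by (simp add: card_funcsetE)
  also have "\<dots> \<le> (\<Delta> ^ 2) ^ t" by (intro power_mono card_nb2) simp
  finally show ?thesis by (simp only: power_mult)
qed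

text \<open>For y and y' in \<open>nb2 z\<close>, the vertex z is itself one of their common light
  second neighbours; summing over z raises the exponent from t to t + 1.\<close>

lemma sum_spread: "(\<Sum>z\<in>V. spread z) = (\<Sum>y\<in>V. \<Sum>y'\<in>V. k y y' ^ (t + 1))"
proof -
  have "spread z = (\<Sum>y\<in>V. \<Sum>y'\<in>V. if z \<in> nb2 y \<inter> nb2 y' then k y y' ^ t else 0)" for z
  proof -
    have i: "(\<Sum>y'\<in>nb2 z. f y') = (\<Sum>y'\<in>V. if z \<in> nb2 y' then f y' else 0)" for f :: "'a \<Rightarrow> nat"
    proof -
      have "nb2 z = {y' \<in> V. z \<in> nb2 y'}" using nb2_sym nb2_subset_V by blast
      then show ?thesis using finV by (simp only: sum.inter_filter)
    qed
    show ?thesis unfolding spread_def i by (intro sum.cong refl) auto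
  qed
  then have "(\<Sum>z\<in>V. spread z) = (\<Sum>z\<in>V. \<Sum>y\<in>V. \<Sum>y'\<in>V. if z \<in> nb2 y \<inter> nb2 y' then k y y' ^ t else 0)" by simp
  also have "\<dots> = (\<Sum>y\<in>V. \<Sum>z\<in>V. \<Sum>y'\<in>V. if z \<in> nb2 y \<inter> nb2 y' then k y y' ^ t else 0)" by (rule sum.swap)
  also have "\<dots> = (\<Sum>y\<in>V. \<Sum>y'\<in>V. \<Sum>z\<in>V. if z \<in> nb2 y \<inter> nb2 y' then k y y' ^ t else 0)"
    by (intro sum.cong refl sum.swap)
  also have "\<dots> = (\<Sum>y\<in>V. \<Sum>y'\<in>V. k y y' ^ (t + 1))"
  proof (intro sum.cong refl)
    fix y y'
    have "{z \<in> V. z \<in> nb2 y \<inter> nb2 y'} = nb2 y \<inter> nb2 y'" using nb2_subset_V by blast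
    then show "(\<Sum>z\<in>V. if z \<in> nb2 y \<inter> nb2 y' then k y y' ^ t else 0) = k y y' ^ (t + 1)"
      using finV by (simp add: sum.inter_filter[symmetric] k_def)
  qed
  finally show ?thesis .
qed

lemma markov:
  fixes f :: "'b \<Rightarrow> nat"
  assumes "finite A" "B \<subseteq> A" "\<And>x. x \<in> B \<Longrightarrow> c \<le> f x"
  shows "card B * c \<le> (\<Sum>x\<in>A. f x)"
proof -
  have "card B * c = (\<Sum>x\<in>B. c)" by simp
  also have "\<dots> \<le> (\<Sum>x\<in>B. f x)" by (intro sum_mono assms)
  also have "\<dots> \<le> (\<Sum>x\<in>A. f x)" using assms by (intro sum_mono2) auto
  finally show ?thesis .
qed

text \<open>Both sums in \<open>good\<close> have the same total over z, hence the factor 2 in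
  \<open>C6\<close>.\<close>

lemma card_not_good: "card (V - good) * M \<le> n"
proof -
  have "card (V - good) * (C6 * D) \<le> (\<Sum>z\<in>V. (\<Sum>z'\<in>V. k z z' ^ (t + 1)) + spread z)"
    by (rule markov) (use finV in \<open>auto simp: good_def\<close>)
  also have "\<dots> = 2 * (\<Sum>z\<in>V. \<Sum>z'\<in>V. k z z' ^ (t + 1))" by (simp add: sum.distrib sum_spread)
  also have "\<dots> \<le> 2 * (C2 * n * D)" by (intro mult_le_mono2 sum_k_power)
  finally have "(card (V - good) * M) * (2 * C2 * D) \<le> n * (2 * C2 * D)" by (simp add: C6_def algebra_simps)
  moreover have "2 * C2 * D > 0" using C2_ge_1 \<Delta>1 by (simp add: Suc_le_eq)
  ultimately show ?thesis by (meson mult_le_cancel2)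
qed

text \<open>Summed over v, \<open>spread_via w v\<close> returns \<open>spread w\<close>: the
  prescribed leaf v contributes the missing factor k.\<close>

lemma card_popular:
  assumes w: "w \<in> good"
  shows "card (popular w) \<le> C6 * \<Delta>"
proof -
  have "card (popular w) * \<Delta> ^ (2 * t + 1) \<le> (\<Sum>v\<in>V. spread_via w v)"
    by (rule markov) (use finV in \<open>auto simp: popular_def\<close>)
  also have "\<dots> = (\<Sum>v\<in>V. \<Sum>y\<in>nb2 w. \<Sum>y'\<in>nb2 w. if v \<in> nb2 y \<inter> nb2 y' then k y y' ^ (t - 1) else 0)"
  proof (intro sum.cong refl)
    fix v
    have i: "(\<Sum>y\<in>nb2 w \<inter> nb2 v. f y) = (\<Sum>y\<in>nb2 w. if v \<in> nb2 y then f y else 0)" for f :: "'a \<Rightarrow> nat"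
    proof -
      have "nb2 w \<inter> nb2 v = {y \<in> nb2 w. v \<in> nb2 y}" using nb2_sym by blast
      then show ?thesis by (simp only: sum.inter_filter finite_nb2)
    qed
    show "spread_via w v = (\<Sum>y\<in>nb2 w. \<Sum>y'\<in>nb2 w. if v \<in> nb2 y \<inter> nb2 y' then k y y' ^ (t - 1) else 0)"
      unfolding spread_via_def i by (intro sum.cong refl) auto
  qed
  also have "\<dots> = (\<Sum>y\<in>nb2 w. \<Sum>v\<in>V. \<Sum>y'\<in>nb2 w. if v \<in> nb2 y \<inter> nb2 y' then k y y' ^ (t - 1) else 0)"
    by (rule sum.swap)
  also have "\<dots> = (\<Sum>y\<in>nb2 w. \<Sum>y'\<in>nb2 w. \<Sum>v\<in>V. if v \<in> nb2 y \<inter> nb2 y' then k y y' ^ (t - 1) else 0)"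
    by (intro sum.cong refl sum.swap)
  also have "\<dots> = spread w"
    unfolding spread_def
  proof (intro sum.cong refl)
    fix y y'
    have "{v \<in> V. v \<in> nb2 y \<inter> nb2 y'} = nb2 y \<inter> nb2 y'" using nb2_subset_V by blast
    then have "(\<Sum>v\<in>V. if v \<in> nb2 y \<inter> nb2 y' then k y y' ^ (t - 1) else 0) = k y y' * k y y' ^ (t - 1)"
      using finV by (simp add: sum.inter_filter[symmetric] k_def)
    also have "\<dots> = k y y' ^ t" using t2 by (metis One_nat_def Suc_pred less_le_trans pos2 power_Suc)
    finally show "(\<Sum>v\<in>V. if v \<in> nb2 y \<inter> nb2 y' then k y y' ^ (t - 1) else 0) = k y y' ^ t" .
  qed
  also have "\<dots> \<le> C6 * D" by (rule good_spread[OF w])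
  finally have "card (popular w) * \<Delta> ^ (2 * t + 1) \<le> (C6 * \<Delta>) * \<Delta> ^ (2 * t + 1)" by (simp add: algebra_simps)
  moreover have "\<Delta> ^ (2 * t + 1) > 0" using \<Delta>1 by simp
  ultimately show ?thesis by (meson mult_le_cancel2)
qed

text \<open>Every coincidence confines one entry to O(\<Delta>) values. The set X is general because
  both \<open>nb2 y\<close> and its intersection with some \<open>nb2 y'\<close> are needed.\<close>

lemma card_bad_legs:
  assumes w: "w \<in> good" and X: "X \<subseteq> nb2 y"
  shows "card {Z \<in> {..<t} \<rightarrow>\<^sub>E X. \<not> nondegenerate w y Z} \<le> C9 * \<Delta> * card X ^ (t - 1)"
proof -
  have finX: "finite X" using X finite_nb2 by (rule finite_subset)
  have fib: "card {z \<in> X. mid y z = u} \<le> \<Delta>" for u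
    by (rule order_trans[OF card_mono card_mid_fiber[of y u]]) (use X in auto)
  have one: "card (X \<inter> {z. \<not> good_leg w y z}) \<le> (4 + C6) * \<Delta>"
  proof -
    have finP: "finite (popular w)" using finV by (simp add: popular_def)
    have "X \<inter> {z. \<not> good_leg w y z} \<subseteq> {w, mid w y} \<union> ({z \<in> X. mid y z = w} \<union> {z \<in> X. mid y z = mid w y} \<union> popular w)"
      by (auto simp: good_leg_def)
    then have "card (X \<inter> {z. \<not> good_leg w y z}) \<le> card ({w, mid w y} \<union> ({z \<in> X. mid y z = w} \<union> {z \<in> X. mid y z = mid w y} \<union> popular w))"
      using finX finP by (intro card_mono) auto
    also have "\<dots> \<le> card {w, mid w y} + (card {z \<in> X. mid y z = w} + card {z \<in> X. mid y z = mid w y} + card (popular w))"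
      by (intro order_trans[OF card_Un_le] add_mono order_refl)
    also have "\<dots> \<le> 2 * \<Delta> + (\<Delta> + \<Delta> + C6 * \<Delta>)"
    proof (intro add_mono fib card_popular w)
      show "card {w, mid w y} \<le> 2 * \<Delta>" using \<Delta>1 by (simp add: card_insert_if)
    qed
    finally show ?thesis by (simp add: algebra_simps)
  qed
  have two: "card {z' \<in> X. \<not> good_leg_pair y z z'} \<le> 3 * \<Delta>" for z
  proof -
    have "{z' \<in> X. \<not> good_leg_pair y z z'} \<subseteq> {mid y z} \<union> ({z' \<in> X. mid y z' = mid y z} \<union> {z' \<in> X. mid y z' = z})"
      by (auto simp: good_leg_pair_def)
    then have "card {z' \<in> X. \<not> good_leg_pair y z z'} \<le> card ({mid y z} \<union> ({z' \<in> X. mid y z' = mid y z} \<union> {z' \<in> X. mid y z' = z}))"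
      using finX by (intro card_mono) auto
    also have "\<dots> \<le> card {mid y z} + (card {z' \<in> X. mid y z' = mid y z} + card {z' \<in> X. mid y z' = z})"
      by (intro order_trans[OF card_Un_le] add_mono order_refl)
    also have "\<dots> \<le> \<Delta> + (\<Delta> + \<Delta>)"
    proof (intro add_mono fib)
      show "card {mid y z} \<le> \<Delta>" using \<Delta>1 by simp
    qed
    finally show ?thesis by simp
  qed
  let ?F = "{..<t} \<rightarrow>\<^sub>E X"
  have finF: "finite ?F" using finX by (intro finite_PiE) auto
  let ?A = "\<Union>j\<in>{..<t}. {Z \<in> ?F. Z j \<in> {z. \<not> good_leg w y z}}"
  let ?B = "\<Union>i\<in>{..<t}. \<Union>j\<in>{..<t} - {i}. {Z \<in> ?F. \<not> good_leg_pair y (Z i) (Z j)}"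
  have "{Z \<in> ?F. \<not> nondegenerate w y Z} \<subseteq> ?A \<union> ?B"
  proof
    fix Z assume "Z \<in> {Z \<in> ?F. \<not> nondegenerate w y Z}"
    then have Z: "Z \<in> ?F" "\<not> nondegenerate w y Z" by simp_all
    from Z(2) consider j where "j < t" "\<not> good_leg w y (Z j)" | i j where "i < t" "j < t" "i \<noteq> j" "\<not> good_leg_pair y (Z i) (Z j)"
      unfolding nondegenerate_def by blast
    then show "Z \<in> ?A \<union> ?B"
    proof cases
      case (1 j)
      then show ?thesis using Z(1) by (intro UnI1 UN_I[of j]) auto
    next
      case (2 i j)
      have "Z \<in> {Z \<in> ?F. \<not> good_leg_pair y (Z i) (Z j)}" using Z(1) 2(4) by simp
      moreover have "j \<in> {..<t} - {i}" "i \<in> {..<t}" using 2 by auto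
      ultimately have "Z \<in> ?B" by (intro UN_I[of i "{..<t}"] UN_I[of j "{..<t} - {i}"])
      then show ?thesis by (rule UnI2)
    qed
  qed
  then have "card {Z \<in> ?F. \<not> nondegenerate w y Z} \<le> card (?A \<union> ?B)" using finF by (intro card_mono) auto
  also have "\<dots> \<le> card ?A + card ?B" by (rule card_Un_le)
  also have "\<dots> \<le> t * ((4 + C6) * \<Delta> * card X ^ (t - 1)) + t * (t * (3 * \<Delta> * card X ^ (t - 1)))"
  proof (intro add_mono card_UN_bound)
    fix j assume j: "j \<in> {..<t}"
    have "card {Z \<in> ?F. Z j \<in> {z. \<not> good_leg w y z}} \<le> card (X \<inter> {z. \<not> good_leg w y z}) * card X ^ (card {..<t} - 1)"
      by (rule card_PiE_elem_le) (use j finX in auto)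
    also have "\<dots> \<le> (4 + C6) * \<Delta> * card X ^ (t - 1)" unfolding card_lessThan by (intro mult_le_mono1 one)
    finally show "card {Z \<in> ?F. Z j \<in> {z. \<not> good_leg w y z}} \<le> (4 + C6) * \<Delta> * card X ^ (t - 1)" .
  next
    fix i j assume "i \<in> {..<t}" "j \<in> {..<t} - {i}"
    then have "card {Z \<in> ?F. \<not> good_leg_pair y (Z i) (Z j)} \<le> 3 * \<Delta> * card X ^ (card {..<t} - 1)"
      by (intro card_PiE_rel_le two finX) auto
    then show "card {Z \<in> ?F. \<not> good_leg_pair y (Z i) (Z j)} \<le> 3 * \<Delta> * card X ^ (t - 1)" by simp
  next
    fix i
    show "card ({..<t} - {i}) \<le> t" using card_mono[of "{..<t}" "{..<t} - {i}"] by simp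
  qed auto
  also have "\<dots> = C9 * \<Delta> * card X ^ (t - 1)" by (simp add: C9_def power2_eq_square algebra_simps)
  finally show ?thesis .
qed

text \<open>From this degree on, the diagonal pairs in \<open>many_nb2\<close> are absorbed by half
  of the left side.\<close>

definition "deg_min = 2 * K ^ 2 * pair_ramsey ^ 2"

text \<open>By sampling, a constant fraction of the pairs of neighbours of v is equal or light, and
  a light pair is counted for at most \<open>hsz\<close> vertices v. Convexity and the average
  degree give the left side.\<close>

lemma many_nb2:
  assumes big: "deg_min \<le> \<Delta>"
  shows "n * \<Delta> ^ 2 \<le> \<kappa> * (\<Sum>y\<in>V. card (nb2 y))"
proof -
  let ?N = "\<Sum>y\<in>V. card (nb2 y)"
  have one: "card (nb v) ^ 2 \<le> pair_ramsey ^ 2 * (\<Delta> + card {(a, b) \<in> nb v \<times> nb v. b \<in> nb2 a})" for v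
  proof -
    have "card (nb v) ^ 2 \<le> pair_ramsey ^ 2 * card {(a, b) \<in> nb v \<times> nb v. lite a b}"
    proof (rule pair_sampling)
      fix f :: "nat \<Rightarrow> 'a"
      show "\<exists>i<pair_ramsey. \<exists>j<pair_ramsey. i \<noteq> j \<and> lite (f i) (f j)"
        using nice_exists[of f "\<lambda>_. undefined"] unfolding nice_def by blast
    qed simp
    also have "card {(a, b) \<in> nb v \<times> nb v. lite a b} \<le> card ((\<lambda>a. (a, a)) ` nb v \<union> {(a, b) \<in> nb v \<times> nb v. b \<in> nb2 a})"
    proof (intro card_mono)
      show "finite ((\<lambda>a. (a, a)) ` nb v \<union> {(a, b) \<in> nb v \<times> nb v. b \<in> nb2 a})"
      proof (intro finite_UnI)
        show "finite {(a, b) \<in> nb v \<times> nb v. b \<in> nb2 a}"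
          by (rule finite_subset[of _ "nb v \<times> nb v"]) auto
      qed simp
      show "{(a, b) \<in> nb v \<times> nb v. lite a b} \<subseteq> (\<lambda>a. (a, a)) ` nb v \<union> {(a, b) \<in> nb v \<times> nb v. b \<in> nb2 a}"
      proof
        fix p assume "p \<in> {(a, b) \<in> nb v \<times> nb v. lite a b}"
        then obtain a b where p: "p = (a, b)" "a \<in> nb v" "b \<in> nb v" "lite a b" by blast
        show "p \<in> (\<lambda>a. (a, a)) ` nb v \<union> {(a, b) \<in> nb v \<times> nb v. b \<in> nb2 a}"
        proof (cases "a = b")
          case False
          have "v \<in> nb a \<inter> nb b" using p sym by simp
          then have "b \<in> nb2 a" using False p by (auto simp: nb2_def lite_def)
          then show ?thesis using p by simp
        qed (use p in simp)
      qed
    qed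
    also have "\<dots> \<le> card ((\<lambda>a. (a, a)) ` nb v) + card {(a, b) \<in> nb v \<times> nb v. b \<in> nb2 a}" by (rule card_Un_le)
    also have "card ((\<lambda>a. (a, a)) ` nb v) \<le> \<Delta>" by (rule order_trans[OF card_image_le card_nb]) simp
    finally show ?thesis by simp
  qed
  have two: "(\<Sum>v\<in>V. card {(a, b) \<in> nb v \<times> nb v. b \<in> nb2 a}) \<le> hsz * ?N"
  proof -
    let ?I = "Sigma V nb2"
    have finI: "finite ?I" using finV by simp
    have "(\<Sum>v\<in>V. card {(a, b) \<in> nb v \<times> nb v. b \<in> nb2 a}) = (\<Sum>v\<in>V. card {p \<in> ?I. fst p \<in> nb v \<and> snd p \<in> nb v})"
      using inV[OF sym] by (intro sum.cong refl arg_cong[where f = card]) auto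
    also have "\<dots> = (\<Sum>p\<in>?I. card {v \<in> V. fst p \<in> nb v \<and> snd p \<in> nb v})" by (intro sum_card_swap finV finI)
    also have "\<dots> \<le> (\<Sum>p\<in>?I. hsz)"
    proof (intro sum_mono)
      fix p assume p: "p \<in> ?I"
      have "card {v \<in> V. fst p \<in> nb v \<and> snd p \<in> nb v} \<le> card (nb (fst p) \<inter> nb (snd p))"
        using sym by (intro card_mono) auto
      also have "\<dots> \<le> hsz" using p by (intro not_heavy) (auto simp: nb2_def)
      finally show "card {v \<in> V. fst p \<in> nb v \<and> snd p \<in> nb v} \<le> hsz" .
    qed
    also have "\<dots> = hsz * ?N" using finV by simp
    finally show ?thesis .
  qed
  have "(n * \<Delta>) ^ 2 \<le> (K * (\<Sum>v\<in>V. card (nb v))) ^ 2" using avg by (rule power_mono) simp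
  also have "\<dots> = K ^ 2 * (\<Sum>v\<in>V. card (nb v)) ^ 2" by (simp add: power_mult_distrib)
  also have "(\<Sum>v\<in>V. card (nb v)) ^ 2 \<le> n ^ (2 - 1) * (\<Sum>v\<in>V. card (nb v) ^ 2)"
    by (rule nat_power_sum_le) (use finV in auto)
  also have "(\<Sum>v\<in>V. card (nb v) ^ 2) \<le> (\<Sum>v\<in>V. pair_ramsey ^ 2 * (\<Delta> + card {(a, b) \<in> nb v \<times> nb v. b \<in> nb2 a}))"
    by (intro sum_mono one)
  also have "\<dots> = pair_ramsey ^ 2 * (n * \<Delta> + (\<Sum>v\<in>V. card {(a, b) \<in> nb v \<times> nb v. b \<in> nb2 a}))"
    by (simp add: sum_distrib_left[symmetric] sum.distrib)
  also have "\<dots> \<le> pair_ramsey ^ 2 * (n * \<Delta> + hsz * ?N)" by (intro mult_le_mono2 add_left_mono two)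
  finally have "(n * \<Delta>) ^ 2 \<le> K ^ 2 * (n * (pair_ramsey ^ 2 * (n * \<Delta> + hsz * ?N)))" by (simp add: mult_le_mono2)
  then have "n * (n * \<Delta> ^ 2) \<le> n * (K ^ 2 * pair_ramsey ^ 2 * (n * \<Delta> + hsz * ?N))"
    by (simp add: power2_eq_square algebra_simps)
  then have "n * \<Delta> ^ 2 \<le> K ^ 2 * pair_ramsey ^ 2 * (n * \<Delta> + hsz * ?N)" using n1 by (simp only: mult_le_cancel1)
  then have "2 * (n * \<Delta> ^ 2) \<le> deg_min * (n * \<Delta>) + \<kappa> * ?N"
    by (simp add: deg_min_def \<kappa>_def algebra_simps)
  moreover have "deg_min * (n * \<Delta>) \<le> \<Delta> * (n * \<Delta>)" using big by (rule mult_le_mono1)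
  moreover have "\<Delta> * (n * \<Delta>) = n * \<Delta> ^ 2" by (simp add: power2_eq_square)
  ultimately show ?thesis by linarith
qed

text \<open>Splitting \<open>spread w\<close> by the midpoint of y shows that few midpoints are
  overloaded, and each of them is the midpoint for at most \<Delta> vertices y.\<close>

lemma card_overloaded:
  assumes w: "w \<in> good"
  shows "card {y \<in> nb2 w. C8 * \<Delta> ^ (2 * t + 1) < load w (mid w y)} * M \<le> \<Delta> ^ 2"
proof -
  let ?U = "{u \<in> nb w. C8 * \<Delta> ^ (2 * t + 1) < load w u}"
  let ?f = "\<lambda>u. {y \<in> nb2 w. mid w y = u}"
  have "card ?U * (C8 * \<Delta> ^ (2 * t + 1)) \<le> (\<Sum>u\<in>nb w. load w u)"
    by (rule markov) auto
  also have "\<dots> \<le> (\<Sum>u\<in>nb w. \<Sum>y\<in>?f u. \<Sum>y'\<in>nb2 w. k y y' ^ t)"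
    unfolding load_def by (intro sum_mono sum_mono2) auto
  also have "\<dots> = spread w"
    unfolding spread_def by (rule sum.group) (use mid_adj in auto)
  also have "\<dots> \<le> C6 * D" by (rule good_spread[OF w])
  finally have "(card ?U * M) * (C6 * \<Delta> ^ (2 * t + 1)) \<le> \<Delta> * (C6 * \<Delta> ^ (2 * t + 1))"
    by (simp add: C8_def algebra_simps)
  moreover have "C6 * \<Delta> ^ (2 * t + 1) > 0" using C6_ge_1 \<Delta>1 by simp
  ultimately have U: "card ?U * M \<le> \<Delta>" by (meson mult_le_cancel2)
  have "{y \<in> nb2 w. C8 * \<Delta> ^ (2 * t + 1) < load w (mid w y)} \<subseteq> (\<Union>u\<in>?U. ?f u)" using mid_adj by auto
  then have "card {y \<in> nb2 w. C8 * \<Delta> ^ (2 * t + 1) < load w (mid w y)} \<le> card (\<Union>u\<in>?U. ?f u)"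
    by (intro card_mono finite_UN_I) auto
  also have "\<dots> \<le> card ?U * \<Delta>" by (rule card_UN_bound) (use card_mid_fiber in auto)
  finally have "card {y \<in> nb2 w. C8 * \<Delta> ^ (2 * t + 1) < load w (mid w y)} * M \<le> (card ?U * M) * \<Delta>"
    using mult_le_mono1[of _ "card ?U * \<Delta>" M] by (simp only: mult.assoc mult.commute[of \<Delta> M])
  also have "\<dots> \<le> \<Delta> * \<Delta>" using U by (rule mult_le_mono1)
  finally show ?thesis by (simp add: power2_eq_square)
qed

lemma card_S: "card (S w) = (\<Sum>y\<in>centers w. card (legs w y))"
  unfolding S_def by (intro card_SigmaI) auto

text \<open>Without exclusions there are at least n D / \<open>\<kappa>1\<close> triples of root,
  centre and leaves, by convexity. Bad roots, bad centres, overloaded midpoints and degenerate legs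
  cost at most n D / \<open>M\<close> each, together half of this.\<close>

lemma many_S:
  assumes big: "deg_min \<le> \<Delta>" "M * C9 \<le> \<Delta>"
  shows "n * D \<le> 2 * \<kappa>1 * (\<Sum>w\<in>good. card (S w))"
proof -
  let ?Raw = "\<Sum>w\<in>V. \<Sum>y\<in>nb2 w. card (nb2 y) ^ t"
  let ?ovl = "\<lambda>w y. w \<in> good \<and> C8 * \<Delta> ^ (2 * t + 1) < load w (mid w y)"
  have raw: "?Raw = (\<Sum>y\<in>V. card (nb2 y) ^ (t + 1))"
  proof -
    have "?Raw = (\<Sum>w\<in>V. \<Sum>y\<in>V. if w \<in> nb2 y then card (nb2 y) ^ t else 0)"
    proof (rule sum.cong[OF refl])
      fix w
      have "nb2 w = {y \<in> V. w \<in> nb2 y}" using nb2_sym nb2_subset_V by blast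
      then show "(\<Sum>y\<in>nb2 w. card (nb2 y) ^ t) = (\<Sum>y\<in>V. if w \<in> nb2 y then card (nb2 y) ^ t else 0)"
        using finV by (simp only: sum.inter_filter)
    qed
    also have "\<dots> = (\<Sum>y\<in>V. \<Sum>w\<in>V. if w \<in> nb2 y then card (nb2 y) ^ t else 0)" by (rule sum.swap)
    also have "\<dots> = (\<Sum>y\<in>V. card (nb2 y) ^ (t + 1))"
    proof (intro sum.cong refl)
      fix y
      have "{w \<in> V. w \<in> nb2 y} = nb2 y" using nb2_subset_V by blast
      then show "(\<Sum>w\<in>V. if w \<in> nb2 y then card (nb2 y) ^ t else 0) = card (nb2 y) ^ (t + 1)"
        using finV by (simp add: sum.inter_filter[symmetric])
    qed
    finally show ?thesis .
  qed
  have lower: "n * D \<le> \<kappa>1 * ?Raw"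
  proof -
    have "(n * \<Delta> ^ 2) ^ (t + 1) \<le> (\<kappa> * (\<Sum>y\<in>V. card (nb2 y))) ^ (t + 1)"
      using many_nb2[OF big(1)] by (rule power_mono) simp
    also have "\<dots> = \<kappa>1 * (\<Sum>y\<in>V. card (nb2 y)) ^ (t + 1)" by (simp only: power_mult_distrib \<kappa>1_def)
    also have "(\<Sum>y\<in>V. card (nb2 y)) ^ (t + 1) \<le> n ^ (t + 1 - 1) * ?Raw"
      unfolding raw by (rule nat_power_sum_le) (use finV in auto)
    finally have "(n * \<Delta> ^ 2) ^ (t + 1) \<le> \<kappa>1 * (n ^ t * ?Raw)" by (simp add: mult_le_mono2)
    moreover have "(n * \<Delta> ^ 2) ^ (t + 1) = n ^ t * (n * D)"
      by (simp only: power_mult_distrib D_eq) simp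
    ultimately have "n ^ t * (n * D) \<le> n ^ t * (\<kappa>1 * ?Raw)" by (simp only: mult.left_commute)
    moreover have "n ^ t > 0" using n1 by simp
    ultimately show ?thesis by (meson mult_le_cancel1)
  qed
  have pt: "card (nb2 y) ^ t \<le> (if w \<in> good \<and> y \<in> centers w then card (legs w y) else 0) + (if w \<notin> good then \<Delta> ^ (2 * t) else 0)
      + (if y \<notin> good then \<Delta> ^ (2 * t) else 0) + (if ?ovl w y then \<Delta> ^ (2 * t) else 0) + C9 * \<Delta> ^ (2 * t - 1)"
    if y: "y \<in> nb2 w" for w y
  proof (cases "w \<in> good \<and> y \<in> centers w")
    case True
    let ?F = "{..<t} \<rightarrow>\<^sub>E nb2 y"
    have fin: "finite ?F" by (intro finite_PiE) auto
    have "card (nb2 y) ^ t = card ?F" by (simp add: card_funcsetE)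
    also have "\<dots> = card (legs w y \<union> {Z \<in> ?F. \<not> nondegenerate w y Z})" by (rule arg_cong[where f = card]) (auto simp: legs_def)
    also have "\<dots> \<le> card (legs w y) + card {Z \<in> ?F. \<not> nondegenerate w y Z}" by (rule card_Un_le)
    also have "card {Z \<in> ?F. \<not> nondegenerate w y Z} \<le> C9 * \<Delta> * card (nb2 y) ^ (t - 1)"
      by (rule card_bad_legs) (use True in auto)
    also have "\<dots> \<le> C9 * \<Delta> * (\<Delta> ^ 2) ^ (t - 1)" by (intro mult_le_mono2 power_mono card_nb2) simp
    also have "\<dots> = C9 * \<Delta> ^ (2 * t - 1)"
    proof -
      have "Suc (2 * (t - 1)) = 2 * t - 1" using t2 by simp
      then have "\<Delta> * (\<Delta> ^ 2) ^ (t - 1) = \<Delta> ^ (2 * t - 1)" by (metis power_Suc power_mult)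
      then show ?thesis by (simp only: mult.assoc)
    qed
    finally show ?thesis using True by simp
  next
    case False
    have "card (nb2 y) ^ t \<le> \<Delta> ^ (2 * t)" using card_funcset_nb2[of y] by (simp add: card_funcsetE)
    moreover have "w \<notin> good \<or> y \<notin> good \<or> ?ovl w y" using False y by (auto simp: centers_def not_le)
    ultimately show ?thesis by auto
  qed
  have D2t: "\<Delta> ^ 2 * \<Delta> ^ (2 * t) = D" by (simp only: power_add[symmetric] add.commute)
  have a1: "(\<Sum>w\<in>V. \<Sum>y\<in>nb2 w. if w \<in> good \<and> y \<in> centers w then card (legs w y) else 0) = (\<Sum>w\<in>good. card (S w))"
  proof -
    have "(\<Sum>w\<in>V. \<Sum>y\<in>nb2 w. if w \<in> good \<and> y \<in> centers w then card (legs w y) else 0) = (\<Sum>w\<in>V. if w \<in> good then card (S w) else 0)"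
    proof (intro sum.cong refl)
      fix w
      have "{y \<in> nb2 w. y \<in> centers w} = centers w" using centers_subset_nb2 by blast
      then show "(\<Sum>y\<in>nb2 w. if w \<in> good \<and> y \<in> centers w then card (legs w y) else 0) = (if w \<in> good then card (S w) else 0)"
        by (simp add: sum.inter_filter[symmetric] card_S)
    qed
    also have "\<dots> = (\<Sum>w\<in>good. card (S w))"
    proof -
      have "{w \<in> V. w \<in> good} = good" using good_subset_V by blast
      then show ?thesis using finV by (simp only: sum.inter_filter[symmetric])
    qed
    finally show ?thesis .
  qed
  have sumN2: "(\<Sum>y\<in>nb2 w. \<Delta> ^ (2 * t)) \<le> D" for w
    using card_nb2[of w] D2t by (metis mult_le_mono1 of_nat_id sum_constant)
  have a2: "M * (\<Sum>w\<in>V. \<Sum>y\<in>nb2 w. if w \<notin> good then \<Delta> ^ (2 * t) else 0) \<le> n * D"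
  proof -
    have "(\<Sum>w\<in>V. \<Sum>y\<in>nb2 w. if w \<notin> good then \<Delta> ^ (2 * t) else 0) \<le> (\<Sum>w\<in>V. if w \<notin> good then D else 0)"
      using sumN2 by (intro sum_mono) auto
    also have "\<dots> = card (V - good) * D"
    proof -
      have "{w \<in> V. w \<notin> good} = V - good" by blast
      then show ?thesis using finV by (simp add: sum.inter_filter[symmetric])
    qed
    finally have "M * (\<Sum>w\<in>V. \<Sum>y\<in>nb2 w. if w \<notin> good then \<Delta> ^ (2 * t) else 0) \<le> M * (card (V - good) * D)"
      by (rule mult_le_mono2)
    also have "\<dots> = card (V - good) * M * D" by (simp only: mult_ac)
    also have "\<dots> \<le> n * D" using card_not_good by (rule mult_le_mono1)
    finally show ?thesis .
  qed
  have a3: "M * (\<Sum>w\<in>V. \<Sum>y\<in>nb2 w. if y \<notin> good then \<Delta> ^ (2 * t) else 0) \<le> n * D"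
  proof -
    have "(\<Sum>w\<in>V. \<Sum>y\<in>nb2 w. if y \<notin> good then \<Delta> ^ (2 * t) else 0) = (\<Sum>w\<in>V. \<Sum>y\<in>nb2 w. if w \<notin> good then \<Delta> ^ (2 * t) else 0)"
    proof -
      have i: "(\<Sum>y\<in>nb2 w. f y) = (\<Sum>y\<in>V. if w \<in> nb2 y then f y else 0)" for f :: "'a \<Rightarrow> nat" and w
      proof -
        have "nb2 w = {y \<in> V. w \<in> nb2 y}" using nb2_sym nb2_subset_V by blast
        then show ?thesis using finV by (simp only: sum.inter_filter)
      qed
      show ?thesis unfolding i by (subst sum.swap) (intro sum.cong refl, use nb2_sym in auto)
    qed
    then show ?thesis using a2 by simp
  qed
  have a4: "M * (\<Sum>w\<in>V. \<Sum>y\<in>nb2 w. if ?ovl w y then \<Delta> ^ (2 * t) else 0) \<le> n * D"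
  proof -
    have "M * (\<Sum>y\<in>nb2 w. if ?ovl w y then \<Delta> ^ (2 * t) else 0) \<le> D" for w
    proof (cases "w \<in> good")
      case True
      then have "(\<Sum>y\<in>nb2 w. if ?ovl w y then \<Delta> ^ (2 * t) else 0) = card {y \<in> nb2 w. C8 * \<Delta> ^ (2 * t + 1) < load w (mid w y)} * \<Delta> ^ (2 * t)"
        by (simp add: sum.inter_filter[symmetric])
      then have "M * (\<Sum>y\<in>nb2 w. if ?ovl w y then \<Delta> ^ (2 * t) else 0) = card {y \<in> nb2 w. C8 * \<Delta> ^ (2 * t + 1) < load w (mid w y)} * M * \<Delta> ^ (2 * t)"
        by (simp only: mult.assoc mult.left_commute)
      also have "\<dots> \<le> \<Delta> ^ 2 * \<Delta> ^ (2 * t)" using card_overloaded[OF True] by (rule mult_le_mono1)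
      finally show ?thesis by (simp only: D2t)
    qed simp
    then have "(\<Sum>w\<in>V. M * (\<Sum>y\<in>nb2 w. if ?ovl w y then \<Delta> ^ (2 * t) else 0)) \<le> (\<Sum>w\<in>V. D)" by (intro sum_mono)
    then show ?thesis by (simp add: sum_distrib_left)
  qed
  have a5: "M * (\<Sum>w\<in>V. \<Sum>y\<in>nb2 w. C9 * \<Delta> ^ (2 * t - 1)) \<le> n * D"
  proof -
    have "Suc (2 * t - 1) = 2 * t" using t2 by simp
    then have e: "\<Delta> * \<Delta> ^ (2 * t - 1) = \<Delta> ^ (2 * t)" by (metis power_Suc)
    have "M * (\<Sum>y\<in>nb2 w. C9 * \<Delta> ^ (2 * t - 1)) \<le> D" for w
    proof -
      have "M * (\<Sum>y\<in>nb2 w. C9 * \<Delta> ^ (2 * t - 1)) = card (nb2 w) * (M * C9 * \<Delta> ^ (2 * t - 1))"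
        by simp
      also have "\<dots> \<le> \<Delta> ^ 2 * (\<Delta> * \<Delta> ^ (2 * t - 1))" by (intro mult_le_mono card_nb2 big(2) order_refl)
      finally show ?thesis by (simp only: e D2t)
    qed
    then have "(\<Sum>w\<in>V. M * (\<Sum>y\<in>nb2 w. C9 * \<Delta> ^ (2 * t - 1))) \<le> (\<Sum>w\<in>V. D)" by (intro sum_mono)
    then show ?thesis by (simp only: sum_distrib_left[symmetric] sum_constant of_nat_id)
  qed
  have "?Raw \<le> (\<Sum>w\<in>V. \<Sum>y\<in>nb2 w. (if w \<in> good \<and> y \<in> centers w then card (legs w y) else 0) + (if w \<notin> good then \<Delta> ^ (2 * t) else 0)
      + (if y \<notin> good then \<Delta> ^ (2 * t) else 0) + (if ?ovl w y then \<Delta> ^ (2 * t) else 0) + C9 * \<Delta> ^ (2 * t - 1))"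
    by (intro sum_mono pt)
  then have "M * ?Raw \<le> M * (\<Sum>w\<in>V. \<Sum>y\<in>nb2 w. (if w \<in> good \<and> y \<in> centers w then card (legs w y) else 0) + (if w \<notin> good then \<Delta> ^ (2 * t) else 0)
      + (if y \<notin> good then \<Delta> ^ (2 * t) else 0) + (if ?ovl w y then \<Delta> ^ (2 * t) else 0) + C9 * \<Delta> ^ (2 * t - 1))"
    by (rule mult_le_mono2)
  also have "\<dots> \<le> M * (\<Sum>w\<in>good. card (S w)) + n * D + n * D + n * D + n * D"
    using a2 a3 a4 a5 by (simp only: sum.distrib a1 distrib_left)
  finally have "M * ?Raw \<le> M * (\<Sum>w\<in>good. card (S w)) + 4 * (n * D)" by simp
  moreover have "8 * (n * D) \<le> M * ?Raw" using lower by (simp add: M_def)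
  ultimately have "4 * (n * D) \<le> M * (\<Sum>w\<in>good. card (S w))" by linarith
  moreover have "M * (\<Sum>w\<in>good. card (S w)) = 4 * (2 * \<kappa>1 * (\<Sum>w\<in>good. card (S w)))" by (simp add: M_def)
  ultimately have "4 * (n * D) \<le> 4 * (2 * \<kappa>1 * (\<Sum>w\<in>good. card (S w)))" by (simp only:)
  then show ?thesis by (simp only: mult_le_cancel1)
qed

end

section \<open>Pairs of trees with the same leaves\<close>

datatype branch_pos = BU | BY | BM nat | BZ nat

lemma card_matched_le:
  assumes fin: "finite P" "finite Q" "\<And>y. y \<in> P \<Longrightarrow> finite (F y)" and A: "A \<subseteq> Sigma P F" and B: "fst ` B \<subseteq> Q"
    and le: "\<And>y y'. y \<in> P \<Longrightarrow> y' \<in> Q \<Longrightarrow> card {Z. (y, Z) \<in> A \<and> (y', Z) \<in> B} \<le> c y y'"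
  shows "card (matched A B) \<le> (\<Sum>y\<in>P. \<Sum>y'\<in>Q. c y y')"
proof -
  let ?X = "\<lambda>p. (\<lambda>Z. (fst p, Z, snd p)) ` {Z. (fst p, Z) \<in> A \<and> (snd p, Z) \<in> B}"
  have f: "finite {Z. (fst p, Z) \<in> A \<and> (snd p, Z) \<in> B}" if "p \<in> P \<times> Q" for p
    by (rule finite_subset[OF _ fin(3)[of "fst p"]]) (use A that in auto)
  have "matched A B \<subseteq> (\<Union>p\<in>P \<times> Q. ?X p)"
  proof
    fix x assume "x \<in> matched A B"
    then obtain y Z y' where x: "x = (y, Z, y')" "(y, Z) \<in> A" "(y', Z) \<in> B" by (auto simp: matched_def)
    then have "(y, y') \<in> P \<times> Q" using A B by force
    then show "x \<in> (\<Union>p\<in>P \<times> Q. ?X p)" using x by (intro UN_I[of "(y, y')"]) auto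
  qed
  then have "card (matched A B) \<le> card (\<Union>p\<in>P \<times> Q. ?X p)"
    using fin f by (intro card_mono finite_UN_I finite_imageI) auto
  also have "\<dots> \<le> (\<Sum>p\<in>P \<times> Q. card (?X p))" using fin by (intro card_UN_le) auto
  also have "\<dots> \<le> (\<Sum>p\<in>P \<times> Q. c (fst p) (snd p))"
  proof (rule sum_mono)
    fix p assume p: "p \<in> P \<times> Q"
    have "card (?X p) \<le> card {Z. (fst p, Z) \<in> A \<and> (snd p, Z) \<in> B}" by (rule card_image_le[OF f[OF p]])
    also have "\<dots> \<le> c (fst p) (snd p)" using p by (intro le) auto
    finally show "card (?X p) \<le> c (fst p) (snd p)" .
  qed
  also have "\<dots> = (\<Sum>y\<in>P. \<Sum>y'\<in>Q. c y y')" by (simp add: sum.cartesian_product case_prod_beta)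
  finally show ?thesis .
qed

context dense_host
begin

text \<open>\<open>\<Psi> w w'\<close> consists of the pairs of branches at \<open>w\<close> and \<open>w'\<close> with the same leaves; the $r$-th
  power of its size \<open>psi\<close> counts pairs of trees with roots \<open>w\<close>, \<open>w'\<close> and the same leaves.\<close>

definition \<Psi> :: "'a \<Rightarrow> 'a \<Rightarrow> ('a \<times> (nat \<Rightarrow> 'a) \<times> 'a) set" where "\<Psi> w w' = matched (S w) (S w')"
definition psi :: "'a \<Rightarrow> 'a \<Rightarrow> nat" where "psi w w' = card (\<Psi> w w')"

lemma finite_\<Psi> [simp]: "finite (\<Psi> w w')" by (simp add: \<Psi>_def)

lemma S_D:
  assumes "(y, Z) \<in> S w"
  shows "y \<in> nb2 w" "y \<in> good" "load w (mid w y) \<le> C8 * \<Delta> ^ (2 * t + 1)" "Z \<in> {..<t} \<rightarrow>\<^sub>E nb2 y" "nondegenerate w y Z"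
  using assms by (auto simp: S_def centers_def legs_def)

lemma card_common_legs:
  "card {Z. (y, Z) \<in> S w \<and> (y', Z) \<in> S w'} \<le> k y y' ^ t"
proof -
  have "card {Z. (y, Z) \<in> S w \<and> (y', Z) \<in> S w'} \<le> card ({..<t} \<rightarrow>\<^sub>E (nb2 y \<inter> nb2 y'))"
  proof (intro card_mono finite_PiE subsetI)
    fix Z assume "Z \<in> {Z. (y, Z) \<in> S w \<and> (y', Z) \<in> S w'}"
    then have "Z \<in> {..<t} \<rightarrow>\<^sub>E nb2 y" "Z \<in> {..<t} \<rightarrow>\<^sub>E nb2 y'" using S_D(4) by blast+
    then show "Z \<in> {..<t} \<rightarrow>\<^sub>E (nb2 y \<inter> nb2 y')" by (auto simp: PiE_iff)
  qed auto
  then show ?thesis by (simp add: card_funcsetE k_def)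
qed

lemma psi_le_sum: "psi w w' \<le> (\<Sum>y\<in>centers w. \<Sum>y'\<in>centers w'. k y y' ^ t)"
  unfolding psi_def \<Psi>_def
proof (rule card_matched_le[where F = "legs w"])
  fix y y'
  show "card {Z. (y, Z) \<in> S w \<and> (y', Z) \<in> S w'} \<le> k y y' ^ t" by (rule card_common_legs)
qed (auto simp: S_def)

lemma psi_self: "w \<in> good \<Longrightarrow> psi w w \<le> C6 * D"
proof -
  assume w: "w \<in> good"
  have "psi w w \<le> (\<Sum>y\<in>centers w. \<Sum>y'\<in>centers w. k y y' ^ t)" by (rule psi_le_sum)
  also have "\<dots> \<le> (\<Sum>y\<in>centers w. \<Sum>y'\<in>nb2 w. k y y' ^ t)" using centers_subset_nb2 by (intro sum_mono sum_mono2) auto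
  also have "\<dots> \<le> spread w" unfolding spread_def using centers_subset_nb2 by (intro sum_mono2) auto
  also have "\<dots> \<le> C6 * D" by (rule good_spread[OF w])
  finally show ?thesis .
qed

text \<open>Cauchy-Schwarz between the exponents t - 1 and t + 1: the lower moment is at most
  \<Delta>^(2 t) by k <= \<Delta>^2 and \<open>sum_k\<close>, the upper one is bounded because y is
  good.\<close>

lemma sum_k_t:
  assumes y: "y \<in> good"
  shows "(\<Sum>y'\<in>V. k y y' ^ t) \<le> C6 * \<Delta> ^ (2 * t + 1)"
proof -
  have tt: "t = Suc (Suc (t - 2))" using t2 by simp
  have "k y y' ^ (t - 1) \<le> \<Delta> ^ (2 * t - 4) * k y y'" for y'
  proof -
    have "k y y' ^ (t - 1) = k y y' ^ (t - 2) * k y y'" using tt by (metis diff_Suc_1 power_Suc2)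
    also have "\<dots> \<le> (\<Delta> ^ 2) ^ (t - 2) * k y y'" by (intro mult_le_mono1 power_mono k_le) simp
    also have "(\<Delta> ^ 2) ^ (t - 2) = \<Delta> ^ (2 * t - 4)" by (simp add: power_mult[symmetric] diff_mult_distrib2)
    finally show ?thesis .
  qed
  then have "(\<Sum>y'\<in>V. k y y' ^ (t - 1)) \<le> \<Delta> ^ (2 * t - 4) * (\<Sum>y'\<in>V. k y y')"
    unfolding sum_distrib_left by (intro sum_mono)
  also have "\<dots> \<le> \<Delta> ^ (2 * t - 4) * \<Delta> ^ 4" by (intro mult_le_mono2 sum_k)
  also have "\<dots> = \<Delta> ^ (2 * t)" using t2 by (simp only: power_add[symmetric]) simp
  finally have a: "(\<Sum>y'\<in>V. k y y' ^ (t - 1)) \<le> \<Delta> ^ (2 * t)" .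
  have "(\<Sum>y'\<in>V. sqrt (real (k y y' ^ (t - 1))) * sqrt (real (k y y' ^ (t + 1))))\<^sup>2
      \<le> (\<Sum>y'\<in>V. (sqrt (real (k y y' ^ (t - 1))))\<^sup>2) * (\<Sum>y'\<in>V. (sqrt (real (k y y' ^ (t + 1))))\<^sup>2)"
    by (rule Cauchy_Schwarz_ineq_sum)
  moreover have "sqrt (real (k y y' ^ (t - 1))) * sqrt (real (k y y' ^ (t + 1))) = real (k y y' ^ t)" for y'
  proof -
    have "(t - 1) + (t + 1) = t * 2" using t2 by simp
    then have "k y y' ^ (t - 1) * k y y' ^ (t + 1) = (k y y' ^ t) ^ 2" by (metis power_add power_mult)
    then have "sqrt (real (k y y' ^ (t - 1) * k y y' ^ (t + 1))) = real (k y y' ^ t)" by simp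
    then show ?thesis by (simp only: of_nat_mult real_sqrt_mult)
  qed
  ultimately have "real ((\<Sum>y'\<in>V. k y y' ^ t) ^ 2) \<le> real ((\<Sum>y'\<in>V. k y y' ^ (t - 1)) * (\<Sum>y'\<in>V. k y y' ^ (t + 1)))"
    by simp
  then have "(\<Sum>y'\<in>V. k y y' ^ t) ^ 2 \<le> (\<Sum>y'\<in>V. k y y' ^ (t - 1)) * (\<Sum>y'\<in>V. k y y' ^ (t + 1))"
    by (simp only: of_nat_le_iff)
  also have "\<dots> \<le> \<Delta> ^ (2 * t) * (C6 * D)" by (intro mult_le_mono a good_sum_k y)
  also have "\<dots> = C6 * (\<Delta> ^ (2 * t + 1)) ^ 2"
    by (simp add: power_add power2_eq_square power_mult algebra_simps)
  also have "\<dots> \<le> C6 ^ 2 * (\<Delta> ^ (2 * t + 1)) ^ 2"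
    using C6_ge_1 by (intro mult_le_mono1) (simp add: power2_eq_square)
  also have "\<dots> = (C6 * \<Delta> ^ (2 * t + 1)) ^ 2" by (simp only: power_mult_distrib)
  finally show ?thesis by (rule power2_le_imp_le) simp
qed

text \<open>Each of the centres y and y' serves at most \<Delta>^2 roots; what remains is
  \<open>sum_k_t\<close>.\<close>

lemma sum_psi: "(\<Sum>w\<in>good. \<Sum>w'\<in>good. psi w w') \<le> C6 * n * \<Delta> ^ (2 * t + 5)"
proof -
  have sw: "(\<Sum>w\<in>good. \<Sum>y\<in>centers w. f y) \<le> (\<Sum>y\<in>good. \<Delta> ^ 2 * f y)" for f :: "'a \<Rightarrow> nat"
  proof -
    have "(\<Sum>w\<in>good. \<Sum>y\<in>centers w. f y) = (\<Sum>w\<in>good. \<Sum>y\<in>good. if y \<in> centers w then f y else 0)"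
    proof (rule sum.cong[OF refl])
      fix w
      have "{y \<in> good. y \<in> centers w} = centers w" using centers_subset_good by blast
      then show "(\<Sum>y\<in>centers w. f y) = (\<Sum>y\<in>good. if y \<in> centers w then f y else 0)"
        using sum.inter_filter[OF finite_good, of f "\<lambda>y. y \<in> centers w"] by (simp only:)
    qed
    also have "\<dots> = (\<Sum>y\<in>good. \<Sum>w\<in>good. if y \<in> centers w then f y else 0)" by (rule sum.swap)
    also have "\<dots> \<le> (\<Sum>y\<in>good. \<Delta> ^ 2 * f y)"
    proof (rule sum_mono)
      fix y
      have "(\<Sum>w\<in>good. if y \<in> centers w then f y else 0) = card {w \<in> good. y \<in> centers w} * f y"
        by (simp add: sum.inter_filter[symmetric])
      also have "card {w \<in> good. y \<in> centers w} \<le> card (nb2 y)"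
        using centers_subset_nb2 nb2_sym by (intro card_mono) auto
      also have "\<dots> \<le> \<Delta> ^ 2" by (rule card_nb2)
      finally show "(\<Sum>w\<in>good. if y \<in> centers w then f y else 0) \<le> \<Delta> ^ 2 * f y" by simp
    qed
    finally show ?thesis .
  qed
  have "(\<Sum>w\<in>good. \<Sum>w'\<in>good. psi w w') \<le> (\<Sum>w\<in>good. \<Sum>w'\<in>good. \<Sum>y\<in>centers w. \<Sum>y'\<in>centers w'. k y y' ^ t)"
    by (intro sum_mono psi_le_sum)
  also have "\<dots> = (\<Sum>w\<in>good. \<Sum>y\<in>centers w. \<Sum>w'\<in>good. \<Sum>y'\<in>centers w'. k y y' ^ t)"
    by (rule sum.cong[OF refl]) (rule sum.swap)
  also have "\<dots> \<le> (\<Sum>y\<in>good. \<Delta> ^ 2 * (\<Sum>w'\<in>good. \<Sum>y'\<in>centers w'. k y y' ^ t))" by (rule sw)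
  also have "\<dots> \<le> (\<Sum>y\<in>good. \<Delta> ^ 2 * (\<Sum>y'\<in>good. \<Delta> ^ 2 * k y y' ^ t))"
    by (intro sum_mono mult_le_mono2 sw)
  also have "\<dots> = \<Delta> ^ 4 * (\<Sum>y\<in>good. \<Sum>y'\<in>good. k y y' ^ t)"
  proof -
    have "\<Delta> ^ 4 = \<Delta> ^ 2 * \<Delta> ^ 2" by (simp only: power_add[symmetric]) simp
    then show ?thesis by (simp only: sum_distrib_left mult.assoc)
  qed
  also have "\<dots> \<le> \<Delta> ^ 4 * (\<Sum>y\<in>good. \<Sum>y'\<in>V. k y y' ^ t)"
    using good_subset_V finV by (intro mult_le_mono2 sum_mono sum_mono2) auto
  also have "\<dots> \<le> \<Delta> ^ 4 * (\<Sum>y\<in>good. C6 * \<Delta> ^ (2 * t + 1))" by (intro mult_le_mono2 sum_mono sum_k_t)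
  also have "\<dots> = card good * (C6 * \<Delta> ^ (2 * t + 5))"
  proof -
    have "\<Delta> ^ 4 * \<Delta> ^ (2 * t + 1) = \<Delta> ^ (2 * t + 5)" by (simp only: power_add[symmetric]) (simp add: add.commute)
    then show ?thesis by (simp add: algebra_simps)
  qed
  also have "\<dots> \<le> n * (C6 * \<Delta> ^ (2 * t + 5))" using good_subset_V finV by (intro mult_le_mono1 card_mono) auto
  finally show ?thesis by (simp only: mult_ac)
qed

section \<open>Branches through a prescribed vertex\<close>

definition branch_positions :: "branch_pos set" where "branch_positions = {BU, BY} \<union> BM ` {..<t} \<union> BZ ` {..<t}"
definition branch_vert :: "'a \<Rightarrow> 'a \<Rightarrow> (nat \<Rightarrow> 'a) \<Rightarrow> branch_pos \<Rightarrow> 'a" where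
  "branch_vert w y Z b = (case b of BU \<Rightarrow> mid w y | BY \<Rightarrow> y | BM j \<Rightarrow> mid y (Z j) | BZ j \<Rightarrow> Z j)"
definition S_at :: "'a \<Rightarrow> branch_pos \<Rightarrow> 'a \<Rightarrow> ('a \<times> (nat \<Rightarrow> 'a)) set" where
  "S_at w b v = {(y, Z) \<in> S w. branch_vert w y Z b = v}"

lemma S_at_subset: "S_at w b v \<subseteq> S w" by (auto simp: S_at_def)
lemma finite_S_at [simp]: "finite (S_at w b v)" using S_at_subset finite_S by (rule finite_subset)

text \<open>Prescribing a vertex saves at least a factor \<Delta> against D, up to a constant, in
  every position: for u by the load of the midpoint, for y and m by direct counting, for a leaf
  because it is not popular.\<close>

lemma matched_S_at:
  assumes b: "b \<in> branch_positions"
  shows "card (matched (S_at w b v) (S_at w b v)) \<le> C8 * \<Delta> ^ (2 * t + 1)"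
proof (cases "S_at w b v = {}")
  case True
  then have "matched (S_at w b v) (S_at w b v) = {}" by (auto simp: matched_def)
  then show ?thesis by (simp only: card.empty)
next
  case False
  \<comment> \<open>Membership of one branch in \<open>S w\<close> certifies the load bound for v in
    the case \<open>BU\<close> and that v is not popular in the case \<open>BZ\<close>.\<close>
  then obtain p where "p \<in> S_at w b v" by blast
  then have y0: "(fst p, snd p) \<in> S w" "branch_vert w (fst p) (snd p) b = v" by (auto simp: S_at_def)
  define y0 Z0 where "y0 = fst p" and "Z0 = snd p"
  note y0 = y0[folded y0_def Z0_def]
  have F: "S_at w b v \<subseteq> Sigma P (legs w)" if "fst ` S_at w b v \<subseteq> P" for P
    using that S_at_subset[of w b v] by (force simp: S_def)
  have C8le: "\<Delta> ^ (2 * t + 1) \<le> C8 * \<Delta> ^ (2 * t + 1)" using C8_ge_1 by simp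
  consider "b = BU" | "b = BY" | j where "b = BM j" "j < t" | j where "b = BZ j" "j < t"
    using b by (auto simp: branch_positions_def)
  then show ?thesis
  proof cases
    case 1
    let ?P = "{y \<in> nb2 w. mid w y = v}"
    have P: "fst ` S_at w b v \<subseteq> ?P" using 1 S_D(1) by (force simp: S_at_def branch_vert_def)
    have "card (matched (S_at w b v) (S_at w b v)) \<le> (\<Sum>y\<in>?P. \<Sum>y'\<in>?P. k y y' ^ t)"
    proof (rule card_matched_le[OF _ _ _ F[OF P] P])
      fix y y'
      show "card {Z. (y, Z) \<in> S_at w b v \<and> (y', Z) \<in> S_at w b v} \<le> k y y' ^ t"
        by (rule order_trans[OF card_mono card_common_legs[of y w y' w]])
          (auto simp: S_at_def intro: finite_subset[of _ "legs w y"] simp: S_def)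
    qed auto
    also have "\<dots> = load w v" by (simp add: load_def)
    also have "\<dots> \<le> C8 * \<Delta> ^ (2 * t + 1)" using S_D(3)[OF y0(1)] y0(2) 1 by (simp add: branch_vert_def)
    finally show ?thesis .
  next
    case 2
    have P: "fst ` S_at w b v \<subseteq> {v}" using 2 by (force simp: S_at_def branch_vert_def)
    have "card (matched (S_at w b v) (S_at w b v)) \<le> (\<Sum>y\<in>{v}. \<Sum>y'\<in>{v}. \<Delta> ^ (2 * t))"
    proof (rule card_matched_le[OF _ _ _ F[OF P] P])
      fix y y'
      show "card {Z. (y, Z) \<in> S_at w b v \<and> (y', Z) \<in> S_at w b v} \<le> \<Delta> ^ (2 * t)"
        by (rule order_trans[OF card_mono card_funcset_nb2[of y]]) (auto simp: S_at_def dest: S_D(4) intro!: finite_PiE)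
    qed auto
    also have "\<dots> \<le> \<Delta> ^ (2 * t + 1)" using \<Delta>_mono[of "2 * t" "2 * t + 1"] by simp
    finally show ?thesis using C8le by linarith
  next
    case (3 j)
    let ?P = "nb v"
    have P: "fst ` S_at w b v \<subseteq> ?P"
    proof
      fix y assume "y \<in> fst ` S_at w b v"
      then obtain Z where Z: "(y, Z) \<in> S w" "mid y (Z j) = v" using 3 by (auto simp: S_at_def branch_vert_def)
      then have "Z j \<in> nb2 y" using S_D(4)[OF Z(1)] 3(2) by (auto simp: PiE_iff)
      then show "y \<in> nb v" using mid_adj[of "Z j" y] Z(2) sym by auto
    qed
    have "card (matched (S_at w b v) (S_at w b v)) \<le> (\<Sum>y\<in>?P. \<Sum>y'\<in>?P. \<Delta> * (\<Delta> ^ 2) ^ (t - 1))"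
    proof (rule card_matched_le[OF _ _ _ F[OF P] P])
      fix y y'
      have "card {Z. (y, Z) \<in> S_at w b v \<and> (y', Z) \<in> S_at w b v} \<le> card {Z \<in> {..<t} \<rightarrow>\<^sub>E nb2 y. Z j \<in> nb v}"
      proof (rule card_mono)
        show "finite {Z \<in> {..<t} \<rightarrow>\<^sub>E nb2 y. Z j \<in> nb v}"
          by (rule finite_subset[of _ "{..<t} \<rightarrow>\<^sub>E nb2 y"]) (auto intro!: finite_PiE)
        show "{Z. (y, Z) \<in> S_at w b v \<and> (y', Z) \<in> S_at w b v} \<subseteq> {Z \<in> {..<t} \<rightarrow>\<^sub>E nb2 y. Z j \<in> nb v}"
        proof
          fix Z assume "Z \<in> {Z. (y, Z) \<in> S_at w b v \<and> (y', Z) \<in> S_at w b v}"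
          then have Z: "(y, Z) \<in> S w" "mid y (Z j) = v" using 3 by (auto simp: S_at_def branch_vert_def)
          then have "Z j \<in> nb2 y" using S_D(4)[OF Z(1)] 3(2) by (auto simp: PiE_iff)
          then show "Z \<in> {Z \<in> {..<t} \<rightarrow>\<^sub>E nb2 y. Z j \<in> nb v}" using mid_adj[of "Z j" y] Z S_D(4)[OF Z(1)] by simp
        qed
      qed
      also have "\<dots> \<le> card (nb2 y \<inter> nb v) * card (nb2 y) ^ (card {..<t} - 1)"
        by (rule card_PiE_elem_le) (use 3 in auto)
      also have "\<dots> \<le> \<Delta> * (\<Delta> ^ 2) ^ (t - 1)"
        unfolding card_lessThan
        by (intro mult_le_mono power_mono card_nb2 order_trans[OF card_mono[of "nb v"] card_nb]) auto
      finally show "card {Z. (y, Z) \<in> S_at w b v \<and> (y', Z) \<in> S_at w b v} \<le> \<Delta> * (\<Delta> ^ 2) ^ (t - 1)" .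
    qed auto
    also have "\<dots> = card (nb v) * (card (nb v) * (\<Delta> * (\<Delta> ^ 2) ^ (t - 1)))" by simp
    also have "\<dots> \<le> \<Delta> * (\<Delta> * (\<Delta> * (\<Delta> ^ 2) ^ (t - 1)))" by (intro mult_le_mono card_nb order_refl)
    also have "\<dots> = \<Delta> ^ (2 * t + 1)"
    proof -
      have "Suc (Suc (Suc (2 * (t - 1)))) = 2 * t + 1" using t2 by simp
      then show ?thesis by (metis power_Suc power_mult)
    qed
    finally show ?thesis using C8le by linarith
  next
    case (4 j)
    let ?P = "nb2 w \<inter> nb2 v"
    have leg: "v \<in> nb2 y" if "(y, Z) \<in> S_at w b v" for y Z
    proof -
      have "(y, Z) \<in> S w" "Z j = v" using that 4 by (auto simp: S_at_def branch_vert_def)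
      then show ?thesis using S_D(4)[of y Z w] 4(2) by (auto simp: PiE_iff)
    qed
    have P: "fst ` S_at w b v \<subseteq> ?P" using leg nb2_sym S_D(1) S_at_subset by fastforce
    have "card (matched (S_at w b v) (S_at w b v)) \<le> (\<Sum>y\<in>?P. \<Sum>y'\<in>?P. k y y' ^ (t - 1))"
    proof (rule card_matched_le[OF _ _ _ F[OF P] P])
      fix y y'
      let ?X = "nb2 y \<inter> nb2 y'"
      have "card {Z. (y, Z) \<in> S_at w b v \<and> (y', Z) \<in> S_at w b v} \<le> card {Z \<in> {..<t} \<rightarrow>\<^sub>E ?X. Z j \<in> {v}}"
      proof (rule card_mono)
        show "finite {Z \<in> {..<t} \<rightarrow>\<^sub>E ?X. Z j \<in> {v}}"
          by (rule finite_subset[of _ "{..<t} \<rightarrow>\<^sub>E ?X"]) (auto intro!: finite_PiE)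
        show "{Z. (y, Z) \<in> S_at w b v \<and> (y', Z) \<in> S_at w b v} \<subseteq> {Z \<in> {..<t} \<rightarrow>\<^sub>E ?X. Z j \<in> {v}}"
        proof
          fix Z assume "Z \<in> {Z. (y, Z) \<in> S_at w b v \<and> (y', Z) \<in> S_at w b v}"
          then have Z: "(y, Z) \<in> S w" "(y', Z) \<in> S w" "Z j = v" using 4 by (auto simp: S_at_def branch_vert_def)
          from S_D(4)[OF Z(1)] S_D(4)[OF Z(2)] have "Z \<in> {..<t} \<rightarrow>\<^sub>E ?X" by (auto simp: PiE_iff)
          then show "Z \<in> {Z \<in> {..<t} \<rightarrow>\<^sub>E ?X. Z j \<in> {v}}" using Z by simp
        qed
      qed
      also have "\<dots> \<le> card (?X \<inter> {v}) * card ?X ^ (card {..<t} - 1)"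
        by (rule card_PiE_elem_le) (use 4 in auto)
      also have "\<dots> \<le> 1 * k y y' ^ (t - 1)"
      proof -
        have "card (?X \<inter> {v}) \<le> 1" using card_mono[of "{v}" "?X \<inter> {v}"] by simp
        then show ?thesis unfolding card_lessThan k_def by (rule mult_le_mono1)
      qed
      finally show "card {Z. (y, Z) \<in> S_at w b v \<and> (y', Z) \<in> S_at w b v} \<le> k y y' ^ (t - 1)" by simp
    qed auto
    also have "\<dots> = spread_via w v" by (simp add: spread_via_def)
    also have "\<dots> \<le> \<Delta> ^ (2 * t + 1)"
    proof -
      have "good_leg w y0 (Z0 j)" using S_D(5)[OF y0(1)] 4(2) by (simp add: nondegenerate_def)
      then have "v \<notin> popular w" using y0(2) 4(1) by (simp add: good_leg_def branch_vert_def)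
      moreover have "v \<in> V" using leg[of y0 Z0] y0 nb2_subset_V by (auto simp: S_at_def)
      ultimately show ?thesis by (simp add: popular_def)
    qed
    finally show ?thesis using C8le by linarith
  qed
qed

text \<open>Cauchy--Schwarz bound for the number of elements of \<open>\<Psi> w w'\<close> whose first branch passes through a
  prescribed vertex.\<close>

definition through_max :: nat where "through_max = nat \<lfloor>sqrt (real (C8 * \<Delta> ^ (2 * t + 1) * (C6 * D)))\<rfloor>"

lemma through_max_square: "through_max ^ 2 \<le> C8 * \<Delta> ^ (2 * t + 1) * (C6 * D)"
proof -
  let ?x = "real (C8 * \<Delta> ^ (2 * t + 1) * (C6 * D))"
  have "real through_max \<le> sqrt ?x" unfolding through_max_def by simp
  then have "real through_max ^ 2 \<le> sqrt ?x ^ 2" by (rule power_mono) simp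
  also have "\<dots> = ?x" by simp
  finally have "real (through_max ^ 2) \<le> ?x" by simp
  then show ?thesis by (simp only: of_nat_le_iff)
qed

lemma le_through_max: "x ^ 2 \<le> C8 * \<Delta> ^ (2 * t + 1) * (C6 * D) \<Longrightarrow> x \<le> through_max"
proof -
  assume "x ^ 2 \<le> C8 * \<Delta> ^ (2 * t + 1) * (C6 * D)"
  then have "real (x ^ 2) \<le> real (C8 * \<Delta> ^ (2 * t + 1) * (C6 * D))" by (simp only: of_nat_le_iff)
  then have "sqrt (real (x ^ 2)) \<le> sqrt (real (C8 * \<Delta> ^ (2 * t + 1) * (C6 * D)))" by (rule real_sqrt_le_mono)
  then have "real x \<le> sqrt (real (C8 * \<Delta> ^ (2 * t + 1) * (C6 * D)))" by simp
  then show ?thesis unfolding through_max_def by (simp add: le_nat_iff le_floor_iff)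
qed

lemma card_through:
  assumes w: "w' \<in> good" and b: "b \<in> branch_positions"
  shows "card {x \<in> \<Psi> w w'. branch_vert w (fst x) (fst (snd x)) b = v} \<le> through_max"
proof (rule le_through_max)
  have "{x \<in> \<Psi> w w'. branch_vert w (fst x) (fst (snd x)) b = v} = matched (S_at w b v) (S w')"
    by (auto simp: \<Psi>_def matched_def S_at_def)
  then have "card {x \<in> \<Psi> w w'. branch_vert w (fst x) (fst (snd x)) b = v} ^ 2 \<le> card (matched (S_at w b v) (S_at w b v)) * card (matched (S w') (S w'))"
    using matched_Cauchy_Schwarz[of "S_at w b v" "S w'"] by simp
  also have "\<dots> \<le> C8 * \<Delta> ^ (2 * t + 1) * (C6 * D)"
    using psi_self[OF w] by (intro mult_le_mono matched_S_at b) (simp add: psi_def \<Psi>_def)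
  finally show "card {x \<in> \<Psi> w w'. branch_vert w (fst x) (fst (snd x)) b = v} ^ 2 \<le> C8 * \<Delta> ^ (2 * t + 1) * (C6 * D)" .
qed

definition second_moment :: nat where "second_moment = (\<Sum>w\<in>good. \<Sum>w'\<in>good. psi w w' ^ r)"

text \<open>The saving in \<open>through_max\<close> against \<open>D\<close> is a factor of about $\Delta^{1/2}$ in each of $r - 1 \ge 6$ branches; it
  compensates for the first-moment bound \<open>sum_psi\<close>, which is too large by $\Delta^3$. This is where \<open>r \<ge> 7\<close> is used.\<close>

lemma through_bound:
  "A * (\<Sum>w\<in>good. \<Sum>w'\<in>good. through_max * psi w w' ^ (r - 1)) \<le> second_moment + A ^ (r - 1) * (C6 * C8) ^ r * (C6 * n * D ^ r)"
proof -
  have r': "r - 1 = Suc (r - 2)" "r = Suc (Suc (r - 2))" using r7 by auto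
  \<comment> \<open>One factor \<open>psi\<close> is set aside before splitting, so that the error
    term is linear in \<open>psi\<close> and \<open>sum_psi\<close> applies.\<close>
  have one: "A * (through_max * psi w w' ^ (r - 1)) \<le> psi w w' ^ r + (A ^ (r - 1) * through_max ^ (r - 1)) * psi w w'" for w w'
  proof -
    have "(A * (through_max * psi w w' ^ (r - 2))) * psi w w' \<le> (psi w w' ^ Suc (r - 2) + (A * through_max) ^ Suc (r - 2)) * psi w w'"
      by (intro mult_le_mono1 nat_split_power_le)
    moreover have "psi w w' ^ (r - 1) = psi w w' ^ (r - 2) * psi w w'" "psi w w' ^ r = psi w w' ^ Suc (r - 2) * psi w w'"
      using r' by (metis power_Suc2)+
    moreover have "(A * through_max) ^ Suc (r - 2) = A ^ (r - 1) * through_max ^ (r - 1)" by (simp only: r'(1) power_mult_distrib)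
    ultimately show ?thesis by (simp only: mult.assoc add_mult_distrib)
  qed
  have bD: "through_max \<le> C6 * C8 * D"
  proof (rule power2_le_imp_le)
    have "\<Delta> ^ (2 * t + 1) \<le> D" by (rule \<Delta>_mono) simp
    then have "C8 * \<Delta> ^ (2 * t + 1) * (C6 * D) \<le> C8 * D * (C6 * D)" by (intro mult_le_mono mult_le_mono2) auto
    also have "\<dots> = (C6 * C8) * D ^ 2" by (simp add: power2_eq_square)
    also have "\<dots> \<le> (C6 * C8) ^ 2 * D ^ 2"
    proof (rule mult_le_mono1)
      show "C6 * C8 \<le> (C6 * C8)\<^sup>2" by (simp add: power2_eq_square)
    qed
    finally show "through_max ^ 2 \<le> (C6 * C8 * D) ^ 2" using through_max_square by (simp add: power_mult_distrib)
  qed simp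
  \<comment> \<open>With six factors of \<open>through_max\<close> the exponents balance exactly: 3
    (4 t + 3) + 2 t + 5 = 7 (2 t + 2).\<close>
  have b6: "through_max ^ 6 * \<Delta> ^ (2 * t + 5) \<le> (C6 * C8) ^ 6 * D ^ 7"
  proof -
    have "(through_max ^ 2) ^ 3 \<le> (C8 * \<Delta> ^ (2 * t + 1) * (C6 * D)) ^ 3" by (rule power_mono[OF through_max_square]) simp
    also have "\<dots> = (C6 * C8) ^ 3 * (\<Delta> ^ (2 * t + 1) * D) ^ 3" by (simp add: power_mult_distrib algebra_simps)
    also have "\<dots> \<le> (C6 * C8) ^ 6 * (\<Delta> ^ (2 * t + 1) * D) ^ 3"
      using C6_ge_1 C8_ge_1 by (intro mult_le_mono1 power_increasing) auto
    finally have "through_max ^ 6 \<le> (C6 * C8) ^ 6 * (\<Delta> ^ (2 * t + 1) * D) ^ 3" by (simp add: power_mult[symmetric])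
    then have "through_max ^ 6 * \<Delta> ^ (2 * t + 5) \<le> (C6 * C8) ^ 6 * (\<Delta> ^ (2 * t + 1) * D) ^ 3 * \<Delta> ^ (2 * t + 5)" by (rule mult_le_mono1)
    also have "\<dots> = (C6 * C8) ^ 6 * D ^ 7"
    proof -
      have "(\<Delta> ^ (2 * t + 1) * D) ^ 3 * \<Delta> ^ (2 * t + 5) = \<Delta> ^ ((2 * t + 1 + (2 * t + 2)) * 3 + (2 * t + 5))"
        by (simp only: power_add power_mult power_mult_distrib)
      also have "(2 * t + 1 + (2 * t + 2)) * 3 + (2 * t + 5) = (2 * t + 2) * 7" by simp
      finally show ?thesis by (simp only: power_mult mult.assoc)
    qed
    finally show ?thesis .
  qed
  have br: "through_max ^ (r - 1) * \<Delta> ^ (2 * t + 5) \<le> (C6 * C8) ^ r * D ^ r"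
  proof -
    have e: "r - 1 = 6 + (r - 7)" "r = 7 + (r - 7)" using r7 by auto
    have "through_max ^ (r - 1) * \<Delta> ^ (2 * t + 5) = (through_max ^ 6 * \<Delta> ^ (2 * t + 5)) * through_max ^ (r - 7)"
      by (subst e(1)) (simp only: power_add mult_ac)
    also have "\<dots> \<le> ((C6 * C8) ^ 6 * D ^ 7) * (C6 * C8 * D) ^ (r - 7)"
      by (intro mult_le_mono b6 power_mono bD) simp
    also have "\<dots> = (C6 * C8) ^ (6 + (r - 7)) * D ^ (7 + (r - 7))"
      by (simp only: power_add power_mult_distrib mult_ac)
    also have "\<dots> \<le> (C6 * C8) ^ r * D ^ r"
    proof (rule mult_le_mono)
      show "(C6 * C8) ^ (6 + (r - 7)) \<le> (C6 * C8) ^ r" using C6_ge_1 C8_ge_1 r7 by (intro power_increasing) auto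
      show "D ^ (7 + (r - 7)) \<le> D ^ r" using e(2) by simp
    qed
    finally show ?thesis .
  qed
  have "A * (\<Sum>w\<in>good. \<Sum>w'\<in>good. through_max * psi w w' ^ (r - 1)) = (\<Sum>w\<in>good. \<Sum>w'\<in>good. A * (through_max * psi w w' ^ (r - 1)))"
    by (simp only: sum_distrib_left)
  also have "\<dots> \<le> (\<Sum>w\<in>good. \<Sum>w'\<in>good. psi w w' ^ r + (A ^ (r - 1) * through_max ^ (r - 1)) * psi w w')"
    by (intro sum_mono one)
  also have "\<dots> = second_moment + (A ^ (r - 1) * through_max ^ (r - 1)) * (\<Sum>w\<in>good. \<Sum>w'\<in>good. psi w w')"
    by (simp only: second_moment_def sum.distrib sum_distrib_left)
  also have "\<dots> \<le> second_moment + (A ^ (r - 1) * through_max ^ (r - 1)) * (C6 * n * \<Delta> ^ (2 * t + 5))"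
    by (intro add_left_mono mult_le_mono2 sum_psi)
  also have "\<dots> = second_moment + A ^ (r - 1) * (through_max ^ (r - 1) * \<Delta> ^ (2 * t + 5)) * (C6 * n)" by (simp only: mult_ac)
  also have "\<dots> \<le> second_moment + A ^ (r - 1) * ((C6 * C8) ^ r * D ^ r) * (C6 * n)"
    by (intro add_left_mono mult_le_mono1 mult_le_mono2 br)
  finally show ?thesis by (simp only: mult_ac)
qed

section \<open>Pairs of trees as r-tuples of branch pairs\<close>

definition leaf_families :: "(nat \<Rightarrow> nat \<Rightarrow> 'a) set" where "leaf_families = {..<r} \<rightarrow>\<^sub>E ({..<t} \<rightarrow>\<^sub>E V)"
definition trees :: "(nat \<Rightarrow> nat \<Rightarrow> 'a) \<Rightarrow> ('a \<times> (nat \<Rightarrow> 'a)) set" where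
  "trees Z = {(w, Y). w \<in> good \<and> Y \<in> {..<r} \<rightarrow>\<^sub>E good \<and> (\<forall>i<r. (Y i, Z i) \<in> S w)}"

lemma finite_leaf_families [simp]: "finite leaf_families" unfolding leaf_families_def using finV by (intro finite_PiE) auto
lemma finite_trees [simp]: "finite (trees Z)"
proof (rule finite_subset)
  show "trees Z \<subseteq> good \<times> ({..<r} \<rightarrow>\<^sub>E good)" by (auto simp: trees_def)
  show "finite (good \<times> ({..<r} \<rightarrow>\<^sub>E good))" by (intro finite_cartesian_product finite_PiE) auto
qed

text \<open>A pair of trees on the same leaves amounts to two roots and, for every i, a branch pair
  in \<open>\<Psi> w w'\<close>; the middle components return the leaves. \<open>\<rho>\<close>
  carries any side condition through this bijection.\<close>

lemma sum_pairs_trees: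
  "(\<Sum>Z\<in>leaf_families. card {(T, T') \<in> trees Z \<times> trees Z. \<rho> (fst T) (fst T') (\<lambda>i\<in>{..<r}. (snd T i, Z i, snd T' i))})
    = (\<Sum>w\<in>good. \<Sum>w'\<in>good. card {f \<in> {..<r} \<rightarrow>\<^sub>E \<Psi> w w'. \<rho> w w' f})"
proof -
  let ?F = "\<lambda>Z. {(T, T') \<in> trees Z \<times> trees Z. \<rho> (fst T) (fst T') (\<lambda>i\<in>{..<r}. (snd T i, Z i, snd T' i))}"
  let ?G = "\<lambda>p. {f \<in> {..<r} \<rightarrow>\<^sub>E \<Psi> (fst p) (snd p). \<rho> (fst p) (snd p) f}"
  let ?L = "Sigma leaf_families ?F"
  let ?R = "Sigma (good \<times> good) ?G"
  define h where "h = (\<lambda>(Z::nat \<Rightarrow> nat \<Rightarrow> 'a, T::'a \<times> (nat \<Rightarrow> 'a), T'::'a \<times> (nat \<Rightarrow> 'a)).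
    ((fst T, fst T'), \<lambda>i\<in>{..<r}. (snd T i, Z i, snd T' i)))"
  define g where "g = (\<lambda>(p::'a \<times> 'a, f::nat \<Rightarrow> 'a \<times> (nat \<Rightarrow> 'a) \<times> 'a).
    (\<lambda>i\<in>{..<r}. fst (snd (f i)), (fst p, \<lambda>i\<in>{..<r}. fst (f i)), (snd p, \<lambda>i\<in>{..<r}. snd (snd (f i)))))"
  have "bij_betw h ?L ?R"
  proof (rule bij_betw_byWitness[where f' = g])
    show "\<forall>x\<in>?L. g (h x) = x"
    proof
      fix x assume "x \<in> ?L"
      then obtain Z w Y w' Y' where x: "x = (Z, (w, Y), (w', Y'))" and Z: "Z \<in> leaf_families"
        and T: "(w, Y) \<in> trees Z" "(w', Y') \<in> trees Z" by auto
      have "restrict Z {..<r} = Z" using Z unfolding leaf_families_def by (rule PiE_restrict)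
      moreover have "restrict Y {..<r} = Y"
        using T(1) unfolding trees_def by (auto intro: PiE_restrict)
      moreover have "restrict Y' {..<r} = Y'"
        using T(2) unfolding trees_def by (auto intro: PiE_restrict)
      moreover have "g (h x) = (restrict Z {..<r}, (w, restrict Y {..<r}), (w', restrict Y' {..<r}))"
        unfolding x g_def h_def by (auto simp: restrict_def)
      ultimately show "g (h x) = x" by (simp add: x)
    qed
    show "\<forall>x\<in>?R. h (g x) = x"
    proof
      fix x assume "x \<in> ?R"
      then obtain w w' f where x: "x = ((w, w'), f)" and f: "f \<in> {..<r} \<rightarrow>\<^sub>E \<Psi> w w'" by auto
      have "h (g x) = ((w, w'), restrict f {..<r})"
        unfolding x g_def h_def by (auto simp: restrict_def)
      moreover have "restrict f {..<r} = f" using f by (rule PiE_restrict)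
      ultimately show "h (g x) = x" by (simp add: x)
    qed
    show "h ` ?L \<subseteq> ?R"
    proof
      fix x assume "x \<in> h ` ?L"
      then obtain Z w Y w' Y' where x: "x = h (Z, (w, Y), (w', Y'))"
        and T: "(w, Y) \<in> trees Z" "(w', Y') \<in> trees Z" and \<rho>: "\<rho> w w' (\<lambda>i\<in>{..<r}. (Y i, Z i, Y' i))" by auto
      have "(Y i, Z i, Y' i) \<in> \<Psi> w w'" if "i < r" for i
        using T that by (auto simp: trees_def \<Psi>_def matched_def)
      then have "(\<lambda>i\<in>{..<r}. (Y i, Z i, Y' i)) \<in> {..<r} \<rightarrow>\<^sub>E \<Psi> w w'" by auto
      then show "x \<in> ?R" using T \<rho> by (auto simp: x h_def trees_def)
    qed
    show "g ` ?R \<subseteq> ?L"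
    proof
      fix x assume "x \<in> g ` ?R"
      then obtain w w' f where x: "x = g ((w, w'), f)" and w: "w \<in> good" "w' \<in> good"
        and f: "f \<in> {..<r} \<rightarrow>\<^sub>E \<Psi> w w'" and \<rho>: "\<rho> w w' f" by auto
      define Z where "Z = (\<lambda>i\<in>{..<r}. fst (snd (f i)))"
      define Y where "Y = (\<lambda>i\<in>{..<r}. fst (f i))"
      define Y' where "Y' = (\<lambda>i\<in>{..<r}. snd (snd (f i)))"
      have fi: "(Y i, Z i) \<in> S w" "(Y' i, Z i) \<in> S w'" if "i < r" for i
      proof -
        have "f i \<in> \<Psi> w w'" using f that by auto
        then show "(Y i, Z i) \<in> S w" "(Y' i, Z i) \<in> S w'"
          using that by (auto simp: \<Psi>_def matched_def Y_def Z_def Y'_def)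
      qed
      have "Z \<in> leaf_families"
        unfolding leaf_families_def
      proof (rule PiE_I)
        fix i assume "i \<in> {..<r}"
        then have "Z i \<in> {..<t} \<rightarrow>\<^sub>E nb2 (Y i)" using fi(1)[of i] S_D(4) by auto
        then show "Z i \<in> {..<t} \<rightarrow>\<^sub>E V" using nb2_subset_V[of "Y i"] by (auto simp: PiE_iff)
      qed (simp add: Z_def)
      moreover have "(w, Y) \<in> trees Z"
        unfolding trees_def using w fi(1) S_D(2)[OF fi(1)] by (auto simp: Y_def)
      moreover have "(w', Y') \<in> trees Z"
        unfolding trees_def using w fi(2) S_D(2)[OF fi(2)] by (auto simp: Y'_def)
      moreover have "(\<lambda>i\<in>{..<r}. (Y i, Z i, Y' i)) = f"
      proof -
        have "(\<lambda>i\<in>{..<r}. (Y i, Z i, Y' i)) = restrict f {..<r}" by (auto simp: Y_def Z_def Y'_def restrict_def)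
        also have "\<dots> = f" using f by (rule PiE_restrict)
        finally show ?thesis .
      qed
      moreover have "x = (Z, (w, Y), (w', Y'))" by (simp add: x g_def Z_def Y_def Y'_def)
      ultimately show "x \<in> ?L" using \<rho> by simp
    qed
  qed
  then have "card ?L = card ?R" by (rule bij_betw_same_card)
  moreover have "card ?L = (\<Sum>Z\<in>leaf_families. card (?F Z))"
  proof (rule card_SigmaI)
    show "\<forall>Z\<in>leaf_families. finite (?F Z)"
      by (intro ballI, rule finite_subset[of _ "trees _ \<times> trees _"]) auto
  qed simp
  moreover have "card ?R = (\<Sum>p\<in>good \<times> good. card (?G p))"
  proof (rule card_SigmaI)
    show "\<forall>p\<in>good \<times> good. finite (?G p)"
    proof
      fix p
      have "finite ({..<r} \<rightarrow>\<^sub>E \<Psi> (fst p) (snd p))" by (intro finite_PiE) auto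
      then show "finite (?G p)" by simp
    qed
  qed simp
  moreover have "(\<Sum>p\<in>good \<times> good. card (?G p)) = (\<Sum>w\<in>good. \<Sum>w'\<in>good. card {f \<in> {..<r} \<rightarrow>\<^sub>E \<Psi> w w'. \<rho> w w' f})"
    by (simp add: sum.cartesian_product case_prod_beta)
  ultimately show ?thesis by simp
qed

lemma sum_card_trees_square: "(\<Sum>Z\<in>leaf_families. card (trees Z) ^ 2) = second_moment"
proof -
  have "(\<Sum>Z\<in>leaf_families. card (trees Z) ^ 2) = (\<Sum>Z\<in>leaf_families. card {(T, T') \<in> trees Z \<times> trees Z. True})"
    by (simp add: card_cartesian_product power2_eq_square)
  also have "\<dots> = (\<Sum>w\<in>good. \<Sum>w'\<in>good. card {f \<in> {..<r} \<rightarrow>\<^sub>E \<Psi> w w'. True})"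
    by (rule sum_pairs_trees[where \<rho> = "\<lambda>_ _ _. True"])
  also have "\<dots> = second_moment" by (simp add: second_moment_def psi_def card_funcsetE)
  finally show ?thesis .
qed

lemma sum_pairs_coord_le:
  assumes i: "i < r"
  shows "(\<Sum>Z\<in>leaf_families. card {(T, T') \<in> trees Z \<times> trees Z. P (fst T) (fst T') (snd T i, Z i, snd T' i)})
    \<le> (\<Sum>w\<in>good. \<Sum>w'\<in>good. card {x \<in> \<Psi> w w'. P w w' x} * psi w w' ^ (r - 1))"
proof -
  have "(\<Sum>Z\<in>leaf_families. card {(T, T') \<in> trees Z \<times> trees Z. P (fst T) (fst T') (snd T i, Z i, snd T' i)})
    = (\<Sum>Z\<in>leaf_families. card {(T, T') \<in> trees Z \<times> trees Z. (\<lambda>w w' f. P w w' (f i)) (fst T) (fst T') (\<lambda>i\<in>{..<r}. (snd T i, Z i, snd T' i))})"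
    using i by simp
  also have "\<dots> = (\<Sum>w\<in>good. \<Sum>w'\<in>good. card {f \<in> {..<r} \<rightarrow>\<^sub>E \<Psi> w w'. P w w' (f i)})"
    by (rule sum_pairs_trees)
  also have "\<dots> \<le> (\<Sum>w\<in>good. \<Sum>w'\<in>good. card {x \<in> \<Psi> w w'. P w w' x} * psi w w' ^ (r - 1))"
  proof (intro sum_mono)
    fix w w'
    have "card {f \<in> {..<r} \<rightarrow>\<^sub>E \<Psi> w w'. f i \<in> {x. P w w' x}} \<le> card (\<Psi> w w' \<inter> {x. P w w' x}) * card (\<Psi> w w') ^ (card {..<r} - 1)"
      by (rule card_PiE_elem_le) (use i in auto)
    then show "card {f \<in> {..<r} \<rightarrow>\<^sub>E \<Psi> w w'. P w w' (f i)} \<le> card {x \<in> \<Psi> w w'. P w w' x} * psi w w' ^ (r - 1)"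
      by (simp add: psi_def Int_def)
  qed
  finally show ?thesis .
qed

lemma sum_pairs_two_coords_le:
  assumes ik: "i < r" "j < r" "i \<noteq> j"
    and c: "\<And>w w' x. w \<in> good \<Longrightarrow> w' \<in> good \<Longrightarrow> x \<in> \<Psi> w w' \<Longrightarrow> card {x' \<in> \<Psi> w w'. P w x x'} \<le> c"
  shows "(\<Sum>Z\<in>leaf_families. card {(T, T') \<in> trees Z \<times> trees Z. P (fst T) (snd T i, Z i, snd T' i) (snd T j, Z j, snd T' j)})
    \<le> (\<Sum>w\<in>good. \<Sum>w'\<in>good. c * psi w w' ^ (r - 1))"
proof -
  have "(\<Sum>Z\<in>leaf_families. card {(T, T') \<in> trees Z \<times> trees Z. P (fst T) (snd T i, Z i, snd T' i) (snd T j, Z j, snd T' j)})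
    = (\<Sum>Z\<in>leaf_families. card {(T, T') \<in> trees Z \<times> trees Z. (\<lambda>w w' f. P w (f i) (f j)) (fst T) (fst T') (\<lambda>i\<in>{..<r}. (snd T i, Z i, snd T' i))})"
    using ik by simp
  also have "\<dots> = (\<Sum>w\<in>good. \<Sum>w'\<in>good. card {f \<in> {..<r} \<rightarrow>\<^sub>E \<Psi> w w'. P w (f i) (f j)})"
    by (rule sum_pairs_trees)
  also have "\<dots> \<le> (\<Sum>w\<in>good. \<Sum>w'\<in>good. c * psi w w' ^ (r - 1))"
  proof (intro sum_mono)
    fix w w' assume w: "w \<in> good" "w' \<in> good"
    have "card {f \<in> {..<r} \<rightarrow>\<^sub>E \<Psi> w w'. P w (f i) (f j)} \<le> c * card (\<Psi> w w') ^ (card {..<r} - 1)"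
      by (rule card_PiE_rel_le) (use ik c[OF w] in auto)
    then show "card {f \<in> {..<r} \<rightarrow>\<^sub>E \<Psi> w w'. P w (f i) (f j)} \<le> c * psi w w' ^ (r - 1)" by (simp add: psi_def)
  qed
  finally show ?thesis .
qed

text \<open>The exponent beyond t + 1 is paid for with k <= \<Delta>^2.\<close>

lemma sum_k_r:
  assumes "y \<in> good"
  shows "(\<Sum>w\<in>V. k y w ^ r) \<le> C6 * \<Delta> ^ (2 * r)"
proof -
  have e: "(t + 1) + (r - (t + 1)) = r" using rt by simp
  have "(\<Sum>w\<in>V. k y w ^ r) = (\<Sum>w\<in>V. k y w ^ (r - (t + 1)) * k y w ^ (t + 1))"
    by (rule sum.cong[OF refl]) (metis e power_add mult.commute)
  also have "\<dots> \<le> (\<Sum>w\<in>V. (\<Delta> ^ 2) ^ (r - (t + 1)) * k y w ^ (t + 1))"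
    by (intro sum_mono mult_le_mono1 power_mono k_le) simp
  also have "\<dots> = (\<Delta> ^ 2) ^ (r - (t + 1)) * (\<Sum>w\<in>V. k y w ^ (t + 1))" by (simp only: sum_distrib_left)
  also have "\<dots> \<le> (\<Delta> ^ 2) ^ (r - (t + 1)) * (C6 * (\<Delta> ^ 2) ^ (t + 1))"
    using good_sum_k[OF assms] by (intro mult_le_mono2) (simp only: D_eq)
  also have "\<dots> = C6 * (\<Delta> ^ 2) ^ ((t + 1) + (r - (t + 1)))" by (simp only: power_add mult_ac)
  also have "\<dots> = C6 * \<Delta> ^ (2 * r)" by (simp only: e power_mult)
  finally show ?thesis .
qed

section \<open>Clashes: trees with the same leaves that share an inner vertex\<close>

lemma r_split: "psi w w' ^ Suc (r - 1) = psi w w' ^ r" "x ^ Suc (r - 1) = x ^ r" for x :: nat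
  using r1 by simp_all

lemma psi_bound: "w \<in> good \<Longrightarrow> w' \<in> good \<Longrightarrow> card {x \<in> \<Psi> w w'. P x} \<le> psi w w'"
  unfolding psi_def by (intro card_mono) auto

text \<open>Equal roots: \<open>psi_self\<close> bounds every term, so no second moment term
  appears.\<close>

lemma clash_W:
  "A * (\<Sum>Z\<in>leaf_families. card {(T, T') \<in> trees Z \<times> trees Z. fst T = fst T'}) \<le> A * C6 ^ r * (n * D ^ r)"
proof -
  have "(\<Sum>Z\<in>leaf_families. card {(T, T') \<in> trees Z \<times> trees Z. fst T = fst T'})
      = (\<Sum>w\<in>good. \<Sum>w'\<in>good. card {f \<in> {..<r} \<rightarrow>\<^sub>E \<Psi> w w'. w = w'})"
    by (rule sum_pairs_trees[where \<rho> = "\<lambda>w w' _. w = w'"])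
  also have "\<dots> = (\<Sum>w\<in>good. \<Sum>w'\<in>good. if w' = w then psi w w ^ r else 0)"
    by (intro sum.cong refl) (auto simp: psi_def card_funcsetE)
  also have "\<dots> = (\<Sum>w\<in>good. psi w w ^ r)" by simp
  also have "\<dots> \<le> (\<Sum>w\<in>good. (C6 * D) ^ r)" by (intro sum_mono power_mono psi_self) auto
  also have "\<dots> = card good * (C6 * D) ^ r" by simp
  also have "\<dots> \<le> n * (C6 * D) ^ r" using good_subset_V finV by (intro mult_le_mono1 card_mono) auto
  finally have "A * (\<Sum>Z\<in>leaf_families. card {(T, T') \<in> trees Z \<times> trees Z. fst T = fst T'}) \<le> A * (n * (C6 * D) ^ r)"
    by (rule mult_le_mono2)
  then show ?thesis by (simp add: power_mult_distrib algebra_simps)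
qed

lemma sum_good_le: "(\<Sum>w\<in>good. c) \<le> n * (c::nat)"
  using good_subset_V finV by (simp add: card_mono)

text \<open>Equal vertices u: distinct light roots with a common neighbour form an
  \<open>nb2\<close> pair, so w' has at most \<Delta>^2 choices, and O(\<Delta>^(2 t + 1)) branch
  pairs share their u. The saving \<Delta>^r pays for \<Delta>^2.\<close>

lemma clash_U:
  assumes i: "i < r"
  shows "A * (\<Sum>Z\<in>leaf_families. card {(T, T') \<in> trees Z \<times> trees Z. mid (fst T) (snd T i) = mid (fst T') (snd T' i) \<and> lite (fst T) (fst T')})
    \<le> second_moment + (A * C6 ^ r + (A * hsz * C8) ^ r) * (n * D ^ r)"
proof -
  let ?P = "\<lambda>w w' (y, Z::nat \<Rightarrow> 'a, y'). mid w y = mid w' y' \<and> lite w w'"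
  let ?c = "\<lambda>w w'. card {x \<in> \<Psi> w w'. ?P w w' x}"
  let ?b = "A * (hsz * (C8 * \<Delta> ^ (2 * t + 1)))"
  have pt: "A * (?c w w' * psi w w' ^ (r - 1)) \<le> psi w w' ^ r + (if w' = w then A * (C6 * D) ^ r else 0) + (if w' \<in> nb2 w then ?b ^ r else 0)"
    if w: "w \<in> good" "w' \<in> good" for w w'
  proof (cases "w' = w")
    case True
    have "?c w w' * psi w w' ^ (r - 1) \<le> psi w w' * psi w w' ^ (r - 1)" by (intro mult_le_mono1 psi_bound w)
    also have "\<dots> = psi w w' ^ r" using r_split by (simp only: power_Suc[symmetric])
    also have "\<dots> \<le> (C6 * D) ^ r" unfolding True by (intro power_mono psi_self w) simp
    finally have "A * (?c w w' * psi w w' ^ (r - 1)) \<le> A * (C6 * D) ^ r" by (rule mult_le_mono2)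
    moreover have "(if w' = w then A * (C6 * D) ^ r else 0) = A * (C6 * D) ^ r" using True by (rule if_P)
    ultimately show ?thesis by linarith
  next
    case False
    show ?thesis
    proof (cases "w' \<in> nb2 w")
      case True
      let ?U = "nb w \<inter> nb w'"
      have "{x \<in> \<Psi> w w'. ?P w w' x} \<subseteq> (\<Union>u\<in>?U. matched (S_at w BU u) (S_at w' BU u))"
      proof
        fix x assume "x \<in> {x \<in> \<Psi> w w'. ?P w w' x}"
        then have x0: "x \<in> \<Psi> w w'" "?P w w' x" by blast+
        obtain y Z y' where x1: "x = (y, Z, y')" by (cases x)
        have x: "x = (y, Z, y')" "(y, Z) \<in> S w" "(y', Z) \<in> S w'" "mid w y = mid w' y'"
          using x0 unfolding x1 by (simp_all add: \<Psi>_def matched_def)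
        have "mid w y \<in> ?U" using mid_adj[OF S_D(1)[OF x(2)]] mid_adj[OF S_D(1)[OF x(3)]] x(4) by simp
        moreover have "x \<in> matched (S_at w BU (mid w y)) (S_at w' BU (mid w y))" using x by (simp add: matched_def S_at_def branch_vert_def)
        ultimately show "x \<in> (\<Union>u\<in>?U. matched (S_at w BU u) (S_at w' BU u))" by blast
      qed
      then have "?c w w' \<le> card (\<Union>u\<in>?U. matched (S_at w BU u) (S_at w' BU u))" by (intro card_mono finite_UN_I) auto
      also have "\<dots> \<le> hsz * (C8 * \<Delta> ^ (2 * t + 1))"
      proof (rule card_UN_bound)
        show "card ?U \<le> hsz" using True by (intro not_heavy) (auto simp: nb2_def)
        fix u
        have "BU \<in> branch_positions" by (simp add: branch_positions_def)
        then have "card (matched (S_at w BU u) (S_at w' BU u)) ^ 2 \<le> (C8 * \<Delta> ^ (2 * t + 1)) ^ 2"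
          unfolding power2_eq_square[of "C8 * \<Delta> ^ (2 * t + 1)"]
          by (intro order_trans[OF matched_Cauchy_Schwarz] mult_le_mono matched_S_at) auto
        then show "card (matched (S_at w BU u) (S_at w' BU u)) \<le> C8 * \<Delta> ^ (2 * t + 1)" by (rule power2_le_imp_le) simp
      qed simp
      finally have "A * ?c w w' \<le> ?b" by (rule mult_le_mono2)
      then have "(A * ?c w w') ^ r \<le> ?b ^ r" by (rule power_mono) simp
      moreover have "A * (?c w w' * psi w w' ^ (r - 1)) \<le> psi w w' ^ r + (A * ?c w w') ^ r"
        using nat_split_power_le[of A "?c w w'" "psi w w'" "r - 1"] by (simp only: r_split)
      moreover have "(if w' \<in> nb2 w then ?b ^ r else 0) = ?b ^ r" using True by (rule if_P)
      ultimately show ?thesis by linarith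
    next
      case n2: False
      have "{x \<in> \<Psi> w w'. ?P w w' x} = {}"
      proof (rule equals0I)
        fix x assume "x \<in> {x \<in> \<Psi> w w'. ?P w w' x}"
        then have x0: "x \<in> \<Psi> w w'" "?P w w' x" by blast+
        obtain y Z y' where x1: "x = (y, Z, y')" by (cases x)
        have x: "(y, Z) \<in> S w" "(y', Z) \<in> S w'" "mid w y = mid w' y'" "lite w w'"
          using x0 unfolding x1 by (simp_all add: \<Psi>_def matched_def)
        have "mid w y \<in> nb w \<inter> nb w'" using mid_adj[OF S_D(1)[OF x(1)]] mid_adj[OF S_D(1)[OF x(2)]] x(3) by simp
        moreover have "\<not> heavy w w'" using x(4) False by (simp add: lite_def)
        ultimately show False using n2 False by (auto simp: nb2_def)
      qed
      then have c0: "?c w w' = 0" by (simp only: card.empty)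
      have "A * (?c w w' * psi w w' ^ (r - 1)) = 0" unfolding c0 by simp
      then show ?thesis by linarith
    qed
  qed
  have i2: "(\<Sum>w'\<in>good. if w' \<in> nb2 w then c else 0) \<le> \<Delta> ^ 2 * c" for w and c :: nat
  proof -
    have "(\<Sum>w'\<in>good. if w' \<in> nb2 w then c else 0) = card {w' \<in> good. w' \<in> nb2 w} * c" by (simp add: sum.inter_filter[symmetric])
    also have "card {w' \<in> good. w' \<in> nb2 w} \<le> card (nb2 w)" by (intro card_mono) auto
    also have "\<dots> \<le> \<Delta> ^ 2" by (rule card_nb2)
    finally show ?thesis by simp
  qed
  have pw: "\<Delta> ^ 2 * ?b ^ r \<le> (A * hsz * C8) ^ r * D ^ r"
  proof -
    have "\<Delta> ^ 2 * ?b ^ r = (A * hsz * C8) ^ r * (\<Delta> ^ 2 * (\<Delta> ^ (2 * t + 1)) ^ r)"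
      by (simp only: power_mult_distrib mult_ac)
    also have "\<Delta> ^ 2 * (\<Delta> ^ (2 * t + 1)) ^ r \<le> \<Delta> ^ r * (\<Delta> ^ (2 * t + 1)) ^ r"
      using \<Delta>_mono[of 2 r] r7 by simp
    also have "\<dots> = D ^ r"
    proof -
      have "\<Delta> * \<Delta> ^ (2 * t + 1) = D" by simp
      then show ?thesis by (simp only: power_mult_distrib[symmetric])
    qed
    finally show ?thesis by simp
  qed
  have "A * (\<Sum>Z\<in>leaf_families. card {(T, T') \<in> trees Z \<times> trees Z. mid (fst T) (snd T i) = mid (fst T') (snd T' i) \<and> lite (fst T) (fst T')})
    \<le> A * (\<Sum>w\<in>good. \<Sum>w'\<in>good. ?c w w' * psi w w' ^ (r - 1))"
    using sum_pairs_coord_le[OF i, of ?P] by (intro mult_le_mono2) simp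
  also have "\<dots> = (\<Sum>w\<in>good. \<Sum>w'\<in>good. A * (?c w w' * psi w w' ^ (r - 1)))" by (simp only: sum_distrib_left)
  also have "\<dots> \<le> (\<Sum>w\<in>good. \<Sum>w'\<in>good. psi w w' ^ r + (if w' = w then A * (C6 * D) ^ r else 0) + (if w' \<in> nb2 w then ?b ^ r else 0))"
    by (intro sum_mono pt)
  also have "\<dots> = second_moment + (\<Sum>w\<in>good. \<Sum>w'\<in>good. if w' = w then A * (C6 * D) ^ r else 0) + (\<Sum>w\<in>good. \<Sum>w'\<in>good. if w' \<in> nb2 w then ?b ^ r else 0)"
    by (simp only: sum.distrib second_moment_def)
  also have "\<dots> \<le> second_moment + n * (A * (C6 * D) ^ r) + n * ((A * hsz * C8) ^ r * D ^ r)"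
  proof (intro add_mono order_refl)
    show "(\<Sum>w\<in>good. \<Sum>w'\<in>good. if w' = w then A * (C6 * D) ^ r else 0) \<le> n * (A * (C6 * D) ^ r)"
      using sum_good_le[of "A * (C6 * D) ^ r"] by simp
    show "(\<Sum>w\<in>good. \<Sum>w'\<in>good. if w' \<in> nb2 w then ?b ^ r else 0) \<le> n * ((A * hsz * C8) ^ r * D ^ r)"
      by (rule order_trans[OF _ sum_good_le]) (intro sum_mono order_trans[OF i2 pw])
  qed
  also have "\<dots> = second_moment + (A * C6 ^ r + (A * hsz * C8) ^ r) * (n * D ^ r)"
    by (simp add: power_mult_distrib algebra_simps)
  finally show ?thesis .
qed

text \<open>The common centre is one of k w w' vertices, and its legs are counted trivially.\<close>

lemma card_same_center: "card {x \<in> \<Psi> w w'. fst x = snd (snd x)} \<le> k w w' * \<Delta> ^ (2 * t)"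
proof -
  have "{x \<in> \<Psi> w w'. fst x = snd (snd x)} \<subseteq> (\<Union>y\<in>nb2 w \<inter> nb2 w'. (\<lambda>Z. (y, Z, y)) ` ({..<t} \<rightarrow>\<^sub>E nb2 y))"
  proof
    fix x assume "x \<in> {x \<in> \<Psi> w w'. fst x = snd (snd x)}"
    then obtain y Z where x: "x = (y, Z, y)" "(y, Z) \<in> S w" "(y, Z) \<in> S w'" by (auto simp: \<Psi>_def matched_def)
    then have "y \<in> nb2 w \<inter> nb2 w'" "Z \<in> {..<t} \<rightarrow>\<^sub>E nb2 y" using S_D(1,4) by blast+
    then show "x \<in> (\<Union>y\<in>nb2 w \<inter> nb2 w'. (\<lambda>Z. (y, Z, y)) ` ({..<t} \<rightarrow>\<^sub>E nb2 y))" using x(1) by blast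
  qed
  then have "card {x \<in> \<Psi> w w'. fst x = snd (snd x)} \<le> card (\<Union>y\<in>nb2 w \<inter> nb2 w'. (\<lambda>Z. (y, Z, y)) ` ({..<t} \<rightarrow>\<^sub>E nb2 y))"
    by (intro card_mono finite_UN_I finite_imageI finite_PiE) auto
  also have "\<dots> \<le> k w w' * \<Delta> ^ (2 * t)"
  proof (rule card_UN_bound)
    fix y
    have "card ((\<lambda>Z. (y, Z, y)) ` ({..<t} \<rightarrow>\<^sub>E nb2 y)) \<le> card ({..<t} \<rightarrow>\<^sub>E nb2 y)"
      by (intro card_image_le finite_PiE) auto
    then show "card ((\<lambda>Z. (y, Z, y)) ` ({..<t} \<rightarrow>\<^sub>E nb2 y)) \<le> \<Delta> ^ (2 * t)" using card_funcset_nb2[of y] by linarith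
  qed (auto simp: k_def)
  finally show ?thesis .
qed

text \<open>The error terms k^r are summed with \<open>sum_k_r\<close>; 2 t r + 2 r is exactly the
  exponent of \<Delta> in D^r.\<close>

lemma center_sum:
  "(\<Sum>w\<in>good. \<Sum>w'\<in>good. A * (card {x \<in> \<Psi> w w'. fst x = snd (snd x)} * psi w w' ^ (r - 1)))
    \<le> second_moment + A ^ r * C6 * (n * D ^ r)"
proof -
  let ?c = "\<lambda>w w'. card {x \<in> \<Psi> w w'. fst x = snd (snd x)}"
  have "A * (?c w w' * psi w w' ^ (r - 1)) \<le> psi w w' ^ r + (A * (\<Delta> ^ (2 * t))) ^ r * k w w' ^ r" for w w'
  proof -
    have "A * (?c w w' * psi w w' ^ (r - 1)) \<le> psi w w' ^ r + (A * ?c w w') ^ r"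
      using nat_split_power_le[of A "?c w w'" "psi w w'" "r - 1"] by (simp only: r_split)
    also have "(A * ?c w w') ^ r \<le> (A * (k w w' * \<Delta> ^ (2 * t))) ^ r"
      by (intro power_mono mult_le_mono2 card_same_center) simp
    also have "\<dots> = (A * (\<Delta> ^ (2 * t))) ^ r * k w w' ^ r" by (simp only: power_mult_distrib mult_ac)
    finally show ?thesis by simp
  qed
  then have "(\<Sum>w\<in>good. \<Sum>w'\<in>good. A * (?c w w' * psi w w' ^ (r - 1)))
      \<le> (\<Sum>w\<in>good. \<Sum>w'\<in>good. psi w w' ^ r + (A * (\<Delta> ^ (2 * t))) ^ r * k w w' ^ r)" by (intro sum_mono)
  also have "\<dots> = second_moment + (A * (\<Delta> ^ (2 * t))) ^ r * (\<Sum>w\<in>good. \<Sum>w'\<in>good. k w w' ^ r)"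
    by (simp only: second_moment_def sum.distrib sum_distrib_left)
  also have "(\<Sum>w\<in>good. \<Sum>w'\<in>good. k w w' ^ r) \<le> (\<Sum>w\<in>good. \<Sum>w'\<in>V. k w w' ^ r)"
    using good_subset_V finV by (intro sum_mono sum_mono2) auto
  also have "\<dots> \<le> (\<Sum>w\<in>good. C6 * \<Delta> ^ (2 * r))" by (intro sum_mono sum_k_r)
  also have "\<dots> \<le> n * (C6 * \<Delta> ^ (2 * r))" by (rule sum_good_le)
  finally have "(\<Sum>w\<in>good. \<Sum>w'\<in>good. A * (?c w w' * psi w w' ^ (r - 1)))
      \<le> second_moment + (A * (\<Delta> ^ (2 * t))) ^ r * (n * (C6 * \<Delta> ^ (2 * r)))" by simp
  also have "(A * (\<Delta> ^ (2 * t))) ^ r * (n * (C6 * \<Delta> ^ (2 * r))) = A ^ r * C6 * (n * D ^ r)"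
  proof -
    have "(\<Delta> ^ (2 * t)) ^ r * \<Delta> ^ (2 * r) = D ^ r"
      by (simp only: power_mult[of \<Delta> 2 r] power_mult_distrib[symmetric] power_add)
    then show ?thesis by (simp add: power_mult_distrib algebra_simps)
  qed
  finally show ?thesis .
qed

lemma clash_Y:
  assumes i: "i < r"
  shows "A * (\<Sum>Z\<in>leaf_families. card {(T, T') \<in> trees Z \<times> trees Z. snd T i = snd T' i}) \<le> second_moment + A ^ r * C6 * (n * D ^ r)"
proof -
  have "A * (\<Sum>Z\<in>leaf_families. card {(T, T') \<in> trees Z \<times> trees Z. snd T i = snd T' i})
    \<le> A * (\<Sum>w\<in>good. \<Sum>w'\<in>good. card {x \<in> \<Psi> w w'. fst x = snd (snd x)} * psi w w' ^ (r - 1))"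
    using sum_pairs_coord_le[OF i, of "\<lambda>_ _ x. fst x = snd (snd x)"] by (intro mult_le_mono2) simp
  also have "\<dots> = (\<Sum>w\<in>good. \<Sum>w'\<in>good. A * (card {x \<in> \<Psi> w w'. fst x = snd (snd x)} * psi w w' ^ (r - 1)))"
    by (simp only: sum_distrib_left)
  also note center_sum
  finally show ?thesis .
qed

lemma card_\<Psi>_pred:
  "card {x \<in> \<Psi> w w'. R x} = (\<Sum>y\<in>centers w. \<Sum>y'\<in>centers w'. card {Z \<in> legs w y \<inter> legs w' y'. R (y, Z, y')})"
proof -
  let ?G = "\<lambda>p. {Z \<in> legs w (fst p) \<inter> legs w' (snd p). R (fst p, Z, snd p)}"
  let ?h = "\<lambda>(p, Z). (fst p, Z, snd p)"
  have "{x \<in> \<Psi> w w'. R x} = ?h ` Sigma (centers w \<times> centers w') ?G"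
  proof
    show "{x \<in> \<Psi> w w'. R x} \<subseteq> ?h ` Sigma (centers w \<times> centers w') ?G"
    proof
      fix x assume "x \<in> {x \<in> \<Psi> w w'. R x}"
      then obtain y Z y' where x: "x = (y, Z, y')" "(y, Z) \<in> S w" "(y', Z) \<in> S w'" "R (y, Z, y')" by (auto simp: \<Psi>_def matched_def)
      then have "((y, y'), Z) \<in> Sigma (centers w \<times> centers w') ?G" by (auto simp: S_def)
      moreover have "x = ?h ((y, y'), Z)" using x by simp
      ultimately show "x \<in> ?h ` Sigma (centers w \<times> centers w') ?G" by (rule rev_image_eqI)
    qed
  qed (auto simp: \<Psi>_def matched_def S_def)
  moreover have "inj_on ?h (Sigma (centers w \<times> centers w') ?G)" by (auto simp: inj_on_def)
  ultimately have "card {x \<in> \<Psi> w w'. R x} = card (Sigma (centers w \<times> centers w') ?G)" by (simp only: card_image)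
  also have "\<dots> = (\<Sum>p\<in>centers w \<times> centers w'. card (?G p))" by (rule card_SigmaI) auto
  also have "\<dots> = (\<Sum>y\<in>centers w. \<Sum>y'\<in>centers w'. card {Z \<in> legs w y \<inter> legs w' y'. R (y, Z, y')})"
    by (simp add: sum.cartesian_product case_prod_beta)
  finally show ?thesis .
qed

text \<open>Above this size the tuples degenerate for w, y and those degenerate for w', y' are at
  most a quarter of all tuples each.\<close>

lemma most_legs_nondegenerate:
  assumes w: "w \<in> good" "w' \<in> good" and big: "4 * C9 * \<Delta> \<le> k y y'"
  shows "k y y' ^ t \<le> 2 * card (legs w y \<inter> legs w' y')"
proof -
  let ?X = "nb2 y \<inter> nb2 y'"
  let ?F = "{..<t} \<rightarrow>\<^sub>E ?X"
  have fin: "finite ?F" by (intro finite_PiE) auto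
  have "?F \<subseteq> (legs w y \<inter> legs w' y') \<union> ({Z \<in> ?F. \<not> nondegenerate w y Z} \<union> {Z \<in> ?F. \<not> nondegenerate w' y' Z})"
  proof
    fix Z assume Z: "Z \<in> ?F"
    then have "Z \<in> {..<t} \<rightarrow>\<^sub>E nb2 y" "Z \<in> {..<t} \<rightarrow>\<^sub>E nb2 y'" by (auto simp: PiE_iff)
    then show "Z \<in> (legs w y \<inter> legs w' y') \<union> ({Z \<in> ?F. \<not> nondegenerate w y Z} \<union> {Z \<in> ?F. \<not> nondegenerate w' y' Z})"
      using Z by (simp add: legs_def)
  qed
  then have "card ?F \<le> card ((legs w y \<inter> legs w' y') \<union> ({Z \<in> ?F. \<not> nondegenerate w y Z} \<union> {Z \<in> ?F. \<not> nondegenerate w' y' Z}))"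
    using fin by (intro card_mono) auto
  also have "\<dots> \<le> card (legs w y \<inter> legs w' y') + (card {Z \<in> ?F. \<not> nondegenerate w y Z} + card {Z \<in> ?F. \<not> nondegenerate w' y' Z})"
    by (intro order_trans[OF card_Un_le] add_mono order_refl card_Un_le)
  also have "\<dots> \<le> card (legs w y \<inter> legs w' y') + (C9 * \<Delta> * card ?X ^ (t - 1) + C9 * \<Delta> * card ?X ^ (t - 1))"
    by (intro add_mono order_refl card_bad_legs w) auto
  finally have "k y y' ^ t \<le> card (legs w y \<inter> legs w' y') + 2 * (C9 * \<Delta> * k y y' ^ (t - 1))"
    by (simp add: card_funcsetE k_def)
  moreover have "4 * (C9 * \<Delta> * k y y' ^ (t - 1)) \<le> k y y' ^ t"
  proof -
    have "Suc (t - 1) = t" using t2 by simp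
    then have "k y y' ^ t = k y y' * k y y' ^ (t - 1)" by (metis power_Suc)
    then show ?thesis using mult_le_mono1[OF big, of "k y y' ^ (t - 1)"] by (simp add: mult.assoc)
  qed
  ultimately show ?thesis by linarith
qed

text \<open>Leaf j is adjacent to a common neighbour of the light pair y, y', hence has O(\<Delta>)
  choices.\<close>

lemma card_same_mid:
  assumes y: "y' \<in> nb2 y" and j: "j < t"
  shows "card {Z \<in> legs w y \<inter> legs w' y'. mid y (Z j) = mid y' (Z j)} \<le> hsz * \<Delta> * k y y' ^ (t - 1)"
proof -
  let ?X = "nb2 y \<inter> nb2 y'"
  let ?B = "\<Union>m\<in>nb y \<inter> nb y'. nb m"
  have "card {Z \<in> legs w y \<inter> legs w' y'. mid y (Z j) = mid y' (Z j)} \<le> card {Z \<in> {..<t} \<rightarrow>\<^sub>E ?X. Z j \<in> ?B}"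
  proof (rule card_mono)
    have "finite ({..<t} \<rightarrow>\<^sub>E ?X)" by (intro finite_PiE) auto
    then show "finite {Z \<in> {..<t} \<rightarrow>\<^sub>E ?X. Z j \<in> ?B}" by simp
    show "{Z \<in> legs w y \<inter> legs w' y'. mid y (Z j) = mid y' (Z j)} \<subseteq> {Z \<in> {..<t} \<rightarrow>\<^sub>E ?X. Z j \<in> ?B}"
    proof
      fix Z assume Z: "Z \<in> {Z \<in> legs w y \<inter> legs w' y'. mid y (Z j) = mid y' (Z j)}"
      then have zx: "Z \<in> {..<t} \<rightarrow>\<^sub>E ?X" by (auto simp: legs_def PiE_iff)
      then have "Z j \<in> nb2 y" "Z j \<in> nb2 y'" using j by (auto simp: PiE_iff)
      from mid_adj[OF this(1)] mid_adj[OF this(2)] have "Z j \<in> ?B" using Z by auto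
      then show "Z \<in> {Z \<in> {..<t} \<rightarrow>\<^sub>E ?X. Z j \<in> ?B}" using zx by simp
    qed
  qed
  also have "\<dots> \<le> card (?X \<inter> ?B) * card ?X ^ (card {..<t} - 1)"
    by (rule card_PiE_elem_le) (use j in auto)
  also have "\<dots> \<le> (hsz * \<Delta>) * k y y' ^ (t - 1)"
  proof -
    have "card (?X \<inter> ?B) \<le> card ?B" by (intro card_mono) auto
    also have "\<dots> \<le> hsz * \<Delta>"
    proof (rule card_UN_bound)
      show "card (nb y \<inter> nb y') \<le> hsz" using y by (intro not_heavy) (auto simp: nb2_def)
    qed (use card_nb in auto)
    finally show ?thesis unfolding card_lessThan k_def by (rule mult_le_mono1)
  qed
  finally show ?thesis .
qed

text \<open>A threshold for k in units of \<Delta>: 4 \<open>C9\<close> serves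
  \<open>most_legs_nondegenerate\<close>, and 4 \<open>hsz\<close> A + 1 lets the \<open>psi\<close>
  terms in \<open>clash_M\<close> be absorbed.\<close>

definition mid_weight :: "nat \<Rightarrow> nat" where "mid_weight A = 4 * C9 + 4 * hsz * A + 1"
text \<open>Walks w - y - y' - w' of length three along \<open>nb2\<close>, with y a centre.\<close>

definition walks :: "'a \<Rightarrow> 'a \<Rightarrow> nat" where "walks w w' = (\<Sum>y\<in>centers w. k y w')"

text \<open>Where k y y' is at least \<open>mid_weight A * \<Delta>\<close>, shared midpoints are a
  small fraction of all common legs, which \<open>psi\<close> counts. Elsewhere the number of legs
  is bounded outright and the pairs y, y' are counted by \<open>walks\<close>.\<close>

lemma card_same_mid_total:
  assumes w: "w \<in> good" "w' \<in> good" and j: "j < t"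
  shows "mid_weight A * card {x \<in> \<Psi> w w'. mid (fst x) (fst (snd x) j) = mid (snd (snd x)) (fst (snd x) j) \<and> snd (snd x) \<in> nb2 (fst x)}
    \<le> 2 * hsz * psi w w' + hsz * mid_weight A ^ t * \<Delta> ^ t * walks w w'"
proof -
  let ?a = "mid_weight A"
  let ?R = "\<lambda>x. mid (fst x) (fst (snd x) j) = mid (snd (snd x)) (fst (snd x) j) \<and> snd (snd x) \<in> nb2 (fst x)"
  have pt: "?a * card {Z \<in> legs w y \<inter> legs w' y'. ?R (y, Z, y')}
      \<le> 2 * hsz * card (legs w y \<inter> legs w' y') + (if y' \<in> nb2 y then hsz * ?a ^ t * \<Delta> ^ t else 0)" for y y'
  proof (cases "y' \<in> nb2 y")
    case True
    have tt: "Suc (t - 1) = t" using t2 by simp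
    have c: "card {Z \<in> legs w y \<inter> legs w' y'. ?R (y, Z, y')} \<le> hsz * \<Delta> * k y y' ^ (t - 1)"
      using card_same_mid[OF True j, of w w'] True by simp
    show ?thesis
    proof (cases "?a * \<Delta> \<le> k y y'")
      case big: True
      have "4 * C9 * \<Delta> \<le> ?a * \<Delta>" by (intro mult_le_mono1) (simp add: mid_weight_def)
      then have k: "k y y' ^ t \<le> 2 * card (legs w y \<inter> legs w' y')" using big by (intro most_legs_nondegenerate w) linarith
      have "?a * card {Z \<in> legs w y \<inter> legs w' y'. ?R (y, Z, y')} \<le> ?a * (hsz * \<Delta> * k y y' ^ (t - 1))" by (rule mult_le_mono2[OF c])
      also have "\<dots> = hsz * ((?a * \<Delta>) * k y y' ^ (t - 1))" by (simp only: mult_ac)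
      also have "\<dots> \<le> hsz * (k y y' * k y y' ^ (t - 1))" by (intro mult_le_mono2 mult_le_mono1 big)
      also have "\<dots> = hsz * k y y' ^ t" by (simp only: power_Suc[symmetric] tt)
      also have "\<dots> \<le> hsz * (2 * card (legs w y \<inter> legs w' y'))" by (rule mult_le_mono2[OF k])
      finally show ?thesis by simp
    next
      case small: False
      have "?a * card {Z \<in> legs w y \<inter> legs w' y'. ?R (y, Z, y')} \<le> ?a * (hsz * \<Delta> * k y y' ^ (t - 1))" by (rule mult_le_mono2[OF c])
      also have "\<dots> \<le> ?a * (hsz * \<Delta> * (?a * \<Delta>) ^ (t - 1))" using small by (intro mult_le_mono2 power_mono) auto
      also have "\<dots> = hsz * (?a * \<Delta>) ^ Suc (t - 1)" by (simp only: power_Suc mult_ac)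
      also have "\<dots> = hsz * ?a ^ t * \<Delta> ^ t" by (simp only: tt power_mult_distrib mult.assoc)
      finally show ?thesis using True by simp
    qed
  qed simp
  have "?a * card {x \<in> \<Psi> w w'. ?R x} = (\<Sum>y\<in>centers w. \<Sum>y'\<in>centers w'. ?a * card {Z \<in> legs w y \<inter> legs w' y'. ?R (y, Z, y')})"
    by (simp only: card_\<Psi>_pred sum_distrib_left)
  also have "\<dots> \<le> (\<Sum>y\<in>centers w. \<Sum>y'\<in>centers w'. 2 * hsz * card (legs w y \<inter> legs w' y') + (if y' \<in> nb2 y then hsz * ?a ^ t * \<Delta> ^ t else 0))"
    by (intro sum_mono pt)
  also have "\<dots> = 2 * hsz * (\<Sum>y\<in>centers w. \<Sum>y'\<in>centers w'. card (legs w y \<inter> legs w' y')) + (\<Sum>y\<in>centers w. \<Sum>y'\<in>centers w'. if y' \<in> nb2 y then hsz * ?a ^ t * \<Delta> ^ t else 0)"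
    by (simp only: sum.distrib sum_distrib_left)
  also have "(\<Sum>y\<in>centers w. \<Sum>y'\<in>centers w'. card (legs w y \<inter> legs w' y')) = psi w w'"
    using card_\<Psi>_pred[of w w' "\<lambda>_. True"] by (simp add: psi_def Int_def)
  also have "(\<Sum>y\<in>centers w. \<Sum>y'\<in>centers w'. if y' \<in> nb2 y then hsz * ?a ^ t * \<Delta> ^ t else 0) \<le> (\<Sum>y\<in>centers w. k y w' * (hsz * ?a ^ t * \<Delta> ^ t))"
  proof (rule sum_mono)
    fix y
    have "(\<Sum>y'\<in>centers w'. if y' \<in> nb2 y then hsz * ?a ^ t * \<Delta> ^ t else 0) = card {y' \<in> centers w'. y' \<in> nb2 y} * (hsz * ?a ^ t * \<Delta> ^ t)"
      by (simp add: sum.inter_filter[symmetric])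
    also have "card {y' \<in> centers w'. y' \<in> nb2 y} \<le> k y w'"
      unfolding k_def using centers_subset_nb2 by (intro card_mono) auto
    finally show "(\<Sum>y'\<in>centers w'. if y' \<in> nb2 y then hsz * ?a ^ t * \<Delta> ^ t else 0) \<le> k y w' * (hsz * ?a ^ t * \<Delta> ^ t)" by simp
  qed
  also have "\<dots> = hsz * ?a ^ t * \<Delta> ^ t * walks w w'" unfolding walks_def by (simp only: sum_distrib_left mult_ac)
  finally show ?thesis by simp
qed

text \<open>Power mean over at most \<Delta>^2 centres y, then \<open>sum_k_r\<close> for each
  y.\<close>

lemma sum_walks: "(\<Sum>w\<in>good. \<Sum>w'\<in>good. walks w w' ^ r) \<le> C6 * n * \<Delta> ^ (4 * r)"
proof -
  have "(\<Sum>w\<in>good. \<Sum>w'\<in>good. walks w w' ^ r) \<le> (\<Sum>w\<in>good. \<Sum>w'\<in>good. (\<Delta> ^ 2) ^ (r - 1) * (\<Sum>y\<in>centers w. k y w' ^ r))"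
    unfolding walks_def by (intro sum_mono nat_power_sum_le card_centers) (use r1 in auto)
  also have "\<dots> = (\<Delta> ^ 2) ^ (r - 1) * (\<Sum>w\<in>good. \<Sum>y\<in>centers w. \<Sum>w'\<in>good. k y w' ^ r)"
  proof -
    have "(\<Sum>w'\<in>good. \<Sum>y\<in>centers w. k y w' ^ r) = (\<Sum>y\<in>centers w. \<Sum>w'\<in>good. k y w' ^ r)" for w by (rule sum.swap)
    then show ?thesis by (simp only: sum_distrib_left[symmetric])
  qed
  also have "\<dots> \<le> (\<Delta> ^ 2) ^ (r - 1) * (\<Sum>w\<in>good. \<Sum>y\<in>centers w. C6 * \<Delta> ^ (2 * r))"
  proof (intro mult_le_mono2 sum_mono)
    fix w y assume "y \<in> centers w"
    have "(\<Sum>w'\<in>good. k y w' ^ r) \<le> (\<Sum>w'\<in>V. k y w' ^ r)" using good_subset_V finV by (intro sum_mono2) auto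
    also have "\<dots> \<le> C6 * \<Delta> ^ (2 * r)" using \<open>y \<in> centers w\<close> centers_subset_good by (intro sum_k_r) auto
    finally show "(\<Sum>w'\<in>good. k y w' ^ r) \<le> C6 * \<Delta> ^ (2 * r)" .
  qed
  also have "\<dots> \<le> (\<Delta> ^ 2) ^ (r - 1) * (\<Sum>w\<in>good. \<Delta> ^ 2 * (C6 * \<Delta> ^ (2 * r)))"
  proof (intro mult_le_mono2 sum_mono)
    fix w
    have "(\<Sum>y\<in>centers w. C6 * \<Delta> ^ (2 * r)) = card (centers w) * (C6 * \<Delta> ^ (2 * r))" by simp
    also have "\<dots> \<le> \<Delta> ^ 2 * (C6 * \<Delta> ^ (2 * r))" by (intro mult_le_mono1 card_centers)
    finally show "(\<Sum>y\<in>centers w. C6 * \<Delta> ^ (2 * r)) \<le> \<Delta> ^ 2 * (C6 * \<Delta> ^ (2 * r))" .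
  qed
  also have "\<dots> \<le> (\<Delta> ^ 2) ^ (r - 1) * (n * (\<Delta> ^ 2 * (C6 * \<Delta> ^ (2 * r))))" by (intro mult_le_mono2 sum_good_le)
  also have "\<dots> = C6 * n * ((\<Delta> ^ 2) ^ Suc (r - 1) * \<Delta> ^ (2 * r))" by (simp only: power_Suc mult_ac)
  also have "(\<Delta> ^ 2) ^ Suc (r - 1) * \<Delta> ^ (2 * r) = \<Delta> ^ (4 * r)"
  proof -
    have "(\<Delta> ^ 2) ^ Suc (r - 1) * \<Delta> ^ (2 * r) = \<Delta> ^ (2 * r + 2 * r)" by (simp only: r_split power_mult[symmetric] power_add)
    also have "2 * r + 2 * r = 4 * r" by simp
    finally show ?thesis .
  qed
  finally show ?thesis .
qed

text \<open>Equal vertices m: either the centres agree, which is \<open>center_sum\<close>, or,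
  being light with a common neighbour, they form an \<open>nb2\<close> pair, which is
  \<open>card_same_mid_total\<close>. The walk term closes by t + 4 <= 2 t + 2.\<close>

lemma clash_M:
  assumes i: "i < r" and j: "j < t"
  shows "A * (\<Sum>Z\<in>leaf_families. card {(T, T') \<in> trees Z \<times> trees Z. mid (snd T i) (Z i j) = mid (snd T' i) (Z i j) \<and> lite (snd T i) (snd T' i)})
    \<le> 2 * second_moment + (A ^ r * C6 + (2 * A * hsz * mid_weight A ^ t) ^ r * C6) * (n * D ^ r)"
proof -
  let ?P = "\<lambda>x. mid (fst x) (fst (snd x) j) = mid (snd (snd x)) (fst (snd x) j) \<and> lite (fst x) (snd (snd x))"
  let ?R = "\<lambda>x. mid (fst x) (fst (snd x) j) = mid (snd (snd x)) (fst (snd x) j) \<and> snd (snd x) \<in> nb2 (fst x)"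
  let ?c = "\<lambda>w w'. card {x \<in> \<Psi> w w'. ?P x}"
  let ?cY = "\<lambda>w w'. card {x \<in> \<Psi> w w'. fst x = snd (snd x)}"
  let ?cm = "\<lambda>w w'. card {x \<in> \<Psi> w w'. ?R x}"
  let ?a = "mid_weight A"
  let ?x = "2 * A * hsz * ?a ^ t * \<Delta> ^ t"
  have c: "?c w w' \<le> ?cY w w' + ?cm w w'" for w w'
  proof -
    have "{x \<in> \<Psi> w w'. ?P x} \<subseteq> {x \<in> \<Psi> w w'. fst x = snd (snd x)} \<union> {x \<in> \<Psi> w w'. ?R x}"
    proof
      fix x assume "x \<in> {x \<in> \<Psi> w w'. ?P x}"
      then have x: "x \<in> \<Psi> w w'" "?P x" by simp_all
      show "x \<in> {x \<in> \<Psi> w w'. fst x = snd (snd x)} \<union> {x \<in> \<Psi> w w'. ?R x}"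
      proof (cases "fst x = snd (snd x)")
        case False
        obtain y Z y' where xe: "x = (y, Z, y')" "(y, Z) \<in> S w" "(y', Z) \<in> S w'" using x(1) by (auto simp: \<Psi>_def matched_def)
        have "Z j \<in> nb2 y" "Z j \<in> nb2 y'" using S_D(4)[OF xe(2)] S_D(4)[OF xe(3)] j by (auto simp: PiE_iff)
        from mid_adj[OF this(1)] mid_adj[OF this(2)] have "mid y (Z j) \<in> nb y \<inter> nb y'" using x(2) xe(1) by simp
        then have "y' \<in> nb2 y" using x(2) xe(1) False by (auto simp: nb2_def lite_def)
        then show ?thesis using x xe(1) by simp
      qed (use x in simp)
    qed
    then have "?c w w' \<le> card ({x \<in> \<Psi> w w'. fst x = snd (snd x)} \<union> {x \<in> \<Psi> w w'. ?R x})" by (intro card_mono) auto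
    also have "\<dots> \<le> ?cY w w' + ?cm w w'" by (rule card_Un_le)
    finally show ?thesis .
  qed
  have m: "A * (?cm w w' * psi w w' ^ (r - 1)) \<le> psi w w' ^ r + (?x * walks w w') ^ r"
    if w: "w \<in> good" "w' \<in> good" for w w'
  proof -
    let ?p = "psi w w' ^ (r - 1)"
    have pr: "psi w w' * ?p = psi w w' ^ r" by (simp only: power_Suc[symmetric] r_split)
    have h: "?x * (walks w w' * ?p) \<le> psi w w' ^ r + (?x * walks w w') ^ r"
      using nat_split_power_le[of ?x "walks w w'" "psi w w'" "r - 1"] unfolding r_split .
    \<comment> \<open>Multiplying by 2 A psi^(r-1) produces psi^r with coefficient 4
      \<open>hsz\<close> A and a walk term that is split again by \<open>h\<close>; the factor 2
      \<open>mid_weight A\<close> cancels at the end.\<close>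
    have "2 * A * ?p * (?a * ?cm w w') \<le> 2 * A * ?p * (2 * hsz * psi w w' + hsz * ?a ^ t * \<Delta> ^ t * walks w w')"
      by (intro mult_le_mono2 card_same_mid_total w j)
    also have "\<dots> = 4 * hsz * A * (psi w w' * ?p) + ?x * (walks w w' * ?p)" by (simp only: distrib_left mult_ac)
    also have "\<dots> \<le> 4 * hsz * A * psi w w' ^ r + (psi w w' ^ r + (?x * walks w w') ^ r)"
      unfolding pr by (rule add_left_mono[OF h])
    also have "\<dots> = (4 * hsz * A + 1) * psi w w' ^ r + (?x * walks w w') ^ r" by (simp only: add_mult_distrib mult_1 add.assoc)
    also have "\<dots> \<le> (2 * ?a) * psi w w' ^ r + (2 * ?a) * (?x * walks w w') ^ r"
    proof (rule add_mono)
      show "(4 * hsz * A + 1) * psi w w' ^ r \<le> (2 * ?a) * psi w w' ^ r" by (intro mult_le_mono1) (simp add: mid_weight_def)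
      have "1 * (?x * walks w w') ^ r \<le> (2 * ?a) * (?x * walks w w') ^ r" by (intro mult_le_mono1) (simp add: mid_weight_def)
      then show "(?x * walks w w') ^ r \<le> (2 * ?a) * (?x * walks w w') ^ r" by simp
    qed
    finally have "(2 * ?a) * (A * (?cm w w' * ?p)) \<le> (2 * ?a) * (psi w w' ^ r + (?x * walks w w') ^ r)"
      by (simp only: distrib_left mult_ac)
    moreover have "2 * ?a > 0" by (simp add: mid_weight_def)
    ultimately show ?thesis by (meson mult_le_cancel1)
  qed
  have "A * (\<Sum>Z\<in>leaf_families. card {(T, T') \<in> trees Z \<times> trees Z. mid (snd T i) (Z i j) = mid (snd T' i) (Z i j) \<and> lite (snd T i) (snd T' i)})
    \<le> A * (\<Sum>w\<in>good. \<Sum>w'\<in>good. ?c w w' * psi w w' ^ (r - 1))"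
    using sum_pairs_coord_le[OF i, of "\<lambda>_ _. ?P"] by (intro mult_le_mono2) simp
  also have "\<dots> = (\<Sum>w\<in>good. \<Sum>w'\<in>good. A * (?c w w' * psi w w' ^ (r - 1)))" by (simp only: sum_distrib_left)
  also have "\<dots> \<le> (\<Sum>w\<in>good. \<Sum>w'\<in>good. A * (?cY w w' * psi w w' ^ (r - 1)) + (psi w w' ^ r + (?x * walks w w') ^ r))"
  proof (intro sum_mono)
    fix w w' assume w: "w \<in> good" "w' \<in> good"
    have "A * (?c w w' * psi w w' ^ (r - 1)) \<le> A * ((?cY w w' + ?cm w w') * psi w w' ^ (r - 1))"
      by (intro mult_le_mono2 mult_le_mono1 c)
    also have "\<dots> = A * (?cY w w' * psi w w' ^ (r - 1)) + A * (?cm w w' * psi w w' ^ (r - 1))"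
      by (simp only: distrib_left distrib_right)
    finally show "A * (?c w w' * psi w w' ^ (r - 1)) \<le> A * (?cY w w' * psi w w' ^ (r - 1)) + (psi w w' ^ r + (?x * walks w w') ^ r)"
      using m[OF w] by linarith
  qed
  also have "\<dots> = (\<Sum>w\<in>good. \<Sum>w'\<in>good. A * (?cY w w' * psi w w' ^ (r - 1))) + (second_moment + ?x ^ r * (\<Sum>w\<in>good. \<Sum>w'\<in>good. walks w w' ^ r))"
    by (simp only: sum.distrib second_moment_def sum_distrib_left power_mult_distrib)
  also have "\<dots> \<le> (second_moment + A ^ r * C6 * (n * D ^ r)) + (second_moment + ?x ^ r * (C6 * n * \<Delta> ^ (4 * r)))"
    by (intro add_mono center_sum mult_le_mono2 sum_walks order_refl)
  also have "?x ^ r * (C6 * n * \<Delta> ^ (4 * r)) = (2 * A * hsz * ?a ^ t) ^ r * C6 * (n * ((\<Delta> ^ t) ^ r * \<Delta> ^ (4 * r)))"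
    by (simp only: power_mult_distrib mult_ac)
  also have "(\<Delta> ^ t) ^ r * \<Delta> ^ (4 * r) \<le> D ^ r"
  proof -
    have "(\<Delta> ^ t) ^ r * \<Delta> ^ (4 * r) = (\<Delta> ^ (t + 4)) ^ r"
      by (simp only: power_mult[of \<Delta> 4 r] power_mult_distrib[symmetric] power_add)
    also have "\<dots> \<le> D ^ r" using t2 by (intro power_mono \<Delta>_mono) auto
    finally show ?thesis .
  qed
  finally show ?thesis by (simp add: algebra_simps)
qed

section \<open>From trees with common leaves to a copy of H\<close>

lemma S_inj:
  assumes S: "(y, Z) \<in> S w"
  shows "inj_on (branch_vert w y Z) branch_positions" and "w \<notin> branch_vert w y Z ` branch_positions"
proof -
  have y: "E w (mid w y)" "E (mid w y) y" "w \<noteq> y" using mid_adj[OF S_D(1)[OF S]] S_D(1)[OF S] by (auto simp: nb2_def)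
  have z: "E y (mid y (Z j))" "E (mid y (Z j)) (Z j)" "y \<noteq> Z j" if "j < t" for j
  proof -
    have "Z j \<in> nb2 y" using S_D(4)[OF S] that by (auto simp: PiE_iff)
    then show "E y (mid y (Z j))" "E (mid y (Z j)) (Z j)" "y \<noteq> Z j" using mid_adj[of "Z j" y] by (auto simp: nb2_def)
  qed
  have ad: "a \<noteq> b" if "E a b" for a b using that irrefl by blast
  have leg: "Z j \<noteq> w" "Z j \<noteq> mid w y" "mid y (Z j) \<noteq> w" "mid y (Z j) \<noteq> mid w y" if "j < t" for j
    using S_D(5)[OF S] that by (auto simp: nondegenerate_def good_leg_def)
  have pair: "mid y (Z i) \<noteq> mid y (Z j)" "mid y (Z i) \<noteq> Z j" if "i < t" "j < t" "i \<noteq> j" for i j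
    using S_D(5)[OF S] that by (auto simp: nondegenerate_def good_leg_pair_def)
  have pz: "Z i \<noteq> Z j" if "i < t" "j < t" "i \<noteq> j" for i j using pair(1)[OF that] by metis
  show "w \<notin> branch_vert w y Z ` branch_positions"
  proof
    assume "w \<in> branch_vert w y Z ` branch_positions"
    then obtain b where b: "b \<in> branch_positions" "w = branch_vert w y Z b" by blast
    have "b = BU \<or> b = BY \<or> (\<exists>j<t. b = BM j) \<or> (\<exists>j<t. b = BZ j)" using b(1) by (auto simp: branch_positions_def)
    then show False
      using b(2) y(3) ad[OF y(1)] leg(1,3) by (elim disjE exE conjE) (simp_all add: branch_vert_def, metis+)
  qed
  have mz: "mid y (Z i) \<noteq> Z j" if "i < t" "j < t" for i j
    using pair(2)[OF that] ad[OF z(2)[OF that(1)]] by (cases "i = j") auto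
  show "inj_on (branch_vert w y Z) branch_positions"
  proof (rule inj_onI)
    fix b b' assume b: "b \<in> branch_positions" "b' \<in> branch_positions" "branch_vert w y Z b = branch_vert w y Z b'"
    have b1: "b = BU \<or> b = BY \<or> (\<exists>j<t. b = BM j) \<or> (\<exists>j<t. b = BZ j)"
      and b2: "b' = BU \<or> b' = BY \<or> (\<exists>j<t. b' = BM j) \<or> (\<exists>j<t. b' = BZ j)" using b by (auto simp: branch_positions_def)
    show "b = b'"
      using b1 b2 b(3) ad[OF y(2)] ad[OF z(1)] z(3) leg(2,4) pair(1) pz mz
      by (elim disjE exE conjE) (simp_all add: branch_vert_def, metis+)
  qed
qed

text \<open>\<open>None\<close> stands for the root \<open>w\<close>, and \<open>Some (i, b)\<close> for position \<open>b\<close> in branch \<open>i\<close>.\<close>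

definition vert :: "(nat \<Rightarrow> nat \<Rightarrow> 'a) \<Rightarrow> 'a \<times> (nat \<Rightarrow> 'a) \<Rightarrow> (nat \<times> branch_pos) option \<Rightarrow> 'a" where
  "vert Z T p = (case p of None \<Rightarrow> fst T | Some (i, b) \<Rightarrow> branch_vert (fst T) (snd T i) (Z i) b)"
text \<open>Leaves are left out because all trees on Z share them.\<close>

definition inner_positions :: "(nat \<times> branch_pos) option set" where
  "inner_positions = insert None (Some ` ({..<r} \<times> ({BU, BY} \<union> BM ` {..<t})))"
text \<open>Coincidences inside one branch or with the root are excluded by \<open>S_inj\<close>, so
  only different branches are compared.\<close>

definition degen :: "(nat \<Rightarrow> nat \<Rightarrow> 'a) \<Rightarrow> 'a \<times> (nat \<Rightarrow> 'a) \<Rightarrow> bool" where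
  "degen Z T \<longleftrightarrow> (\<exists>i<r. \<exists>k<r. i \<noteq> k \<and> (\<exists>b\<in>branch_positions. \<exists>b'\<in>branch_positions. vert Z T (Some (k, b')) = vert Z T (Some (i, b))))"
definition clash :: "(nat \<Rightarrow> nat \<Rightarrow> 'a) \<Rightarrow> 'a \<times> (nat \<Rightarrow> 'a) \<Rightarrow> 'a \<times> (nat \<Rightarrow> 'a) \<Rightarrow> bool" where
  "clash Z T T' \<longleftrightarrow> (\<exists>p\<in>inner_positions. \<exists>p'\<in>inner_positions. vert Z T p = vert Z T' p')"

lemma finite_inner_positions [simp]: "finite inner_positions" by (simp add: inner_positions_def)
lemma finite_branch_positions [simp]: "finite branch_positions" by (simp add: branch_positions_def)

lemma vert_inj:
  assumes T: "T \<in> trees Z" and nd: "\<not> degen Z T"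
  shows "inj_on (vert Z T) (insert None (Some ` ({..<r} \<times> branch_positions)))"
proof -
  obtain w Y where Te: "T = (w, Y)" by (cases T)
  have S: "(Y i, Z i) \<in> S w" if "i < r" for i using T that by (auto simp: Te trees_def)
  have w: "vert Z T None \<noteq> vert Z T (Some (i, b))" if "i < r" "b \<in> branch_positions" for i b
    using S_inj(2)[OF S[OF that(1)]] that(2) by (auto simp: vert_def Te)
  have b: "(i, b) = (k, b')"
    if "i < r" "b \<in> branch_positions" "k < r" "b' \<in> branch_positions" "vert Z T (Some (i, b)) = vert Z T (Some (k, b'))" for i k b b'
  proof (cases "i = k")
    case True
    then show ?thesis using that S_inj(1)[OF S[OF that(1)]] by (auto simp: vert_def Te inj_on_def)
  next
    case False
    then have "degen Z T" unfolding degen_def using that by metis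
    with nd show ?thesis by contradiction
  qed
  show ?thesis
  proof (rule inj_onI)
    fix p q assume pq: "p \<in> insert None (Some ` ({..<r} \<times> branch_positions))" "q \<in> insert None (Some ` ({..<r} \<times> branch_positions))"
      "vert Z T p = vert Z T q"
    show "p = q"
    proof (cases p)
      case None
      then show ?thesis using pq w by (cases q) force+
    next
      case p: (Some a)
      show ?thesis
      proof (cases q)
        case None
        then show ?thesis using pq w p by (metis (no_types, lifting) imageE insertE lessThan_iff mem_Sigma_iff option.distinct(1) surj_pair)
      next
        case q: (Some c)
        have "a \<in> {..<r} \<times> branch_positions" "c \<in> {..<r} \<times> branch_positions" using pq p q by auto
        then show ?thesis using b[of "fst a" "snd a" "fst c" "snd c"] pq(3) p q by auto
      qed
    qed
  qed
qed

text \<open>Nondegenerate trees with the same leaves and without clashes are the copies of $T'$ in \<open>H\<close>.\<close>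

lemma no_family:
  assumes T: "\<And>c. c < l \<Longrightarrow> T c \<in> trees Z" and nd: "\<And>c. c < l \<Longrightarrow> \<not> degen Z (T c)"
    and nc: "\<And>c c'. c < l \<Longrightarrow> c' < l \<Longrightarrow> c \<noteq> c' \<Longrightarrow> \<not> clash Z (T c) (T c')"
  shows False
proof -
  define cp where "cp x = (case x of HW c \<Rightarrow> c | HU c i \<Rightarrow> c | HY c i \<Rightarrow> c | HM c i j \<Rightarrow> c | HZ i j \<Rightarrow> 0)" for x
  define loc where "loc x = (case x of HW c \<Rightarrow> None | HU c i \<Rightarrow> Some (i, BU) | HY c i \<Rightarrow> Some (i, BY)
    | HM c i j \<Rightarrow> Some (i, BM j) | HZ i j \<Rightarrow> Some (i, BZ j))" for x
  define \<phi> where "\<phi> x = vert Z (T (cp x)) (loc x)" for x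
  let ?L = "insert None (Some ` ({..<r} \<times> branch_positions))"
  have l0: "0 < l" using l1 by simp
  have cp: "cp x < l" and loc: "loc x \<in> ?L" and pos: "loc x \<in> inner_positions \<or> (\<exists>i j. x = HZ i j)" if "x \<in> hverts l r t" for x
    using that l0 by (cases x; auto simp: cp_def loc_def hverts_def inner_positions_def branch_positions_def)+
  have root: "\<phi> (HZ i j) = vert Z (T c) (loc (HZ i j))" for i j c by (simp add: \<phi>_def vert_def loc_def branch_vert_def)
  have rootl: "x = HZ i j" if "loc x = loc (HZ i j)" for x i j using that by (cases x) (auto simp: loc_def)
  have inj: "p = q" if "c < l" "p \<in> ?L" "q \<in> ?L" "vert Z (T c) p = vert Z (T c) q" for c p q
    using inj_onD[OF vert_inj[OF T nd, OF that(1,1)] that(4,2,3)] .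
  \<comment> \<open>A leaf can be read in any copy, so a coincidence with a leaf takes place inside
    a single tree.\<close>
  have wlog: "x = HZ i j" if "x \<in> hverts l r t" "HZ i j \<in> hverts l r t" "\<phi> x = \<phi> (HZ i j)" for x i j
  proof (rule rootl, rule inj[OF cp[OF that(1)] loc[OF that(1)] loc[OF that(2)]])
    show "vert Z (T (cp x)) (loc x) = vert Z (T (cp x)) (loc (HZ i j))"
      using that(3) unfolding root[of i j "cp x"] by (simp only: \<phi>_def)
  qed
  have "inj_on \<phi> (hverts l r t)"
  proof (rule inj_onI)
    fix x y assume xy: "x \<in> hverts l r t" "y \<in> hverts l r t" "\<phi> x = \<phi> y"
    show "x = y"
    proof (cases "(\<exists>i j. x = HZ i j) \<or> (\<exists>i j. y = HZ i j)")
      case True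
      then show ?thesis using wlog xy by metis
    next
      case False
      then have p: "loc x \<in> inner_positions" "loc y \<in> inner_positions" using pos xy by blast+
      have e: "vert Z (T (cp x)) (loc x) = vert Z (T (cp y)) (loc y)" using xy(3) by (simp only: \<phi>_def)
      have "cp x = cp y"
      proof (rule ccontr)
        assume "cp x \<noteq> cp y"
        from nc[OF cp[OF xy(1)] cp[OF xy(2)] this] show False unfolding clash_def using p e by blast
      qed
      moreover from this have "loc x = loc y"
        using inj[OF cp[OF xy(1)] loc[OF xy(1)] loc[OF xy(2)]] e by simp
      ultimately show ?thesis using False by (cases x; cases y; simp add: cp_def loc_def)
    qed
  qed
  moreover have "E (\<phi> (HW c)) (\<phi> (HU c i)) \<and> E (\<phi> (HU c i)) (\<phi> (HY c i)) \<and>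
     (\<forall>j<t. E (\<phi> (HY c i)) (\<phi> (HM c i j)) \<and> E (\<phi> (HM c i j)) (\<phi> (HZ i j)))" if c: "c < l" "i < r" for c i
  proof -
    obtain w Y where Te: "T c = (w, Y)" by (cases "T c")
    have S: "(Y i, Z i) \<in> S w" using T[OF c(1)] c(2) by (auto simp: Te trees_def)
    have v: "\<phi> (HW c) = w" "\<phi> (HU c i) = mid w (Y i)" "\<phi> (HY c i) = Y i" "\<phi> (HM c i j) = mid (Y i) (Z i j)" "\<phi> (HZ i j) = Z i j" for j
      by (simp_all add: \<phi>_def vert_def loc_def cp_def branch_vert_def Te)
    have "E (Y i) (mid (Y i) (Z i j)) \<and> E (mid (Y i) (Z i j)) (Z i j)" if "j < t" for j
      by (rule mid_adj) (use S_D(4)[OF S] that in \<open>auto simp: PiE_iff\<close>)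
    then show ?thesis using mid_adj[OF S_D(1)[OF S]] by (simp add: v)
  qed
  ultimately have "embeds l r t E" unfolding embeds_def by blast
  with free show False by contradiction
qed

text \<open>Otherwise \<open>no_family\<close> applies to l of the l + 1 sampled trees. The extra
  tree gives every c < l a partner, so that degeneracy of one tree becomes a condition on a pair,
  also when l = 1.\<close>

lemma pairs_meet:
  "card (trees Z) ^ 2 \<le> (l + 1) ^ 2 * card {(T, T') \<in> trees Z \<times> trees Z. degen Z T \<or> degen Z T' \<or> clash Z T T'}"
proof (rule pair_sampling[where P = "\<lambda>T T'. degen Z T \<or> degen Z T' \<or> clash Z T T'"])
  fix f assume f: "f \<in> {..<l + 1} \<rightarrow>\<^sub>E trees Z"
  show "\<exists>i<l + 1. \<exists>j<l + 1. i \<noteq> j \<and> (degen Z (f i) \<or> degen Z (f j) \<or> clash Z (f i) (f j))"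
  proof (rule ccontr)
    assume "\<not> ?thesis"
    then have n: "\<not> degen Z (f i) \<and> \<not> clash Z (f i) (f j)" if "i < l + 1" "j < l + 1" "i \<noteq> j" for i j using that by blast
    show False
    proof (rule no_family[of f Z])
      fix c assume c: "c < l"
      show "f c \<in> trees Z" using PiE_mem[OF f] c by simp
      show "\<not> degen Z (f c)" using n[of c l] c by simp
      fix c' assume "c' < l" "c \<noteq> c'"
      then show "\<not> clash Z (f c) (f c')" using n[of c c'] c by simp
    qed
  qed
qed simp

section \<open>Absorbing the pairs that meet\<close>

definition degen_count :: "(nat \<Rightarrow> nat \<Rightarrow> 'a) \<Rightarrow> nat" where
  "degen_count Z = card {(T, T') \<in> trees Z \<times> trees Z. degen Z T}"
definition clash_count :: "(nat \<Rightarrow> nat \<Rightarrow> 'a) \<Rightarrow> (nat \<times> branch_pos) option \<Rightarrow> nat" where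
  "clash_count Z p = card {(T, T') \<in> trees Z \<times> trees Z. vert Z T p = vert Z T' p}"

lemma finite_pairs [simp]: "finite {(T, T') \<in> trees Z \<times> trees Z. P T T'}"
  by (rule finite_subset[OF _ finite_cartesian_product[OF finite_trees finite_trees]]) blast

text \<open>\<open>card_collision_le\<close> replaces a clash at positions p and p' by clashes at
  equal positions.\<close>

lemma card_trees_square_le: "card (trees Z) ^ 2 \<le> (l + 1) ^ 2 * (2 * degen_count Z + 2 * card inner_positions * (\<Sum>p\<in>inner_positions. clash_count Z p))"
proof -
  let ?X = "\<lambda>P. {(T, T') \<in> trees Z \<times> trees Z. P T T'}"
  have sw: "card (?X (\<lambda>T T'. degen Z T')) = degen_count Z"
    unfolding degen_count_def by (rule bij_betw_same_card[of prod.swap]) (auto simp: bij_betw_def inj_on_def image_def)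
  have "?X (\<lambda>T T'. degen Z T \<or> degen Z T' \<or> clash Z T T')
    = (?X (\<lambda>T T'. degen Z T) \<union> ?X (\<lambda>T T'. degen Z T')) \<union> (\<Union>p\<in>inner_positions. \<Union>p'\<in>inner_positions. ?X (\<lambda>T T'. vert Z T p = vert Z T' p'))"
    by (auto simp: clash_def)
  then have "card (?X (\<lambda>T T'. degen Z T \<or> degen Z T' \<or> clash Z T T'))
    \<le> card (?X (\<lambda>T T'. degen Z T) \<union> ?X (\<lambda>T T'. degen Z T')) + card (\<Union>p\<in>inner_positions. \<Union>p'\<in>inner_positions. ?X (\<lambda>T T'. vert Z T p = vert Z T' p'))"
    by (simp only: card_Un_le)
  also have "card (?X (\<lambda>T T'. degen Z T) \<union> ?X (\<lambda>T T'. degen Z T')) \<le> degen_count Z + degen_count Z"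
    using card_Un_le[of "?X (\<lambda>T T'. degen Z T)" "?X (\<lambda>T T'. degen Z T')"] sw by (simp add: degen_count_def)
  also have "card (\<Union>p\<in>inner_positions. \<Union>p'\<in>inner_positions. ?X (\<lambda>T T'. vert Z T p = vert Z T' p')) \<le> (\<Sum>p\<in>inner_positions. \<Sum>p'\<in>inner_positions. card (?X (\<lambda>T T'. vert Z T p = vert Z T' p')))"
    by (rule order_trans[OF card_UN_le[OF finite_inner_positions] sum_mono[OF card_UN_le[OF finite_inner_positions]]])
  also have "\<dots> \<le> (\<Sum>p\<in>inner_positions. \<Sum>p'\<in>inner_positions. clash_count Z p + clash_count Z p')"
    unfolding clash_count_def by (intro sum_mono card_collision_le finite_trees)
  also have "\<dots> = 2 * card inner_positions * (\<Sum>p\<in>inner_positions. clash_count Z p)"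
    by (simp add: sum.distrib sum_distrib_left[symmetric])
  finally have "card (?X (\<lambda>T T'. degen Z T \<or> degen Z T' \<or> clash Z T T')) \<le> 2 * degen_count Z + 2 * card inner_positions * (\<Sum>p\<in>inner_positions. clash_count Z p)"
    by (simp add: algebra_simps)
  then show ?thesis using pairs_meet[of Z] by (meson mult_le_mono2 order_trans)
qed

text \<open>For two branches i, j and two positions: once branch pair i is fixed, branch pair j
  passes through the prescribed vertex in at most \<open>through_max\<close> ways, by
  \<open>card_through\<close>.\<close>

lemma sum_degen_count: "(\<Sum>Z\<in>leaf_families. degen_count Z) \<le> (r * card branch_positions) ^ 2 * (\<Sum>w\<in>good. \<Sum>w'\<in>good. through_max * psi w w' ^ (r - 1))"
proof -
  let ?S = "\<Sum>w\<in>good. \<Sum>w'\<in>good. through_max * psi w w' ^ (r - 1)"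
  let ?I = "({..<r} \<times> branch_positions) \<times> ({..<r} \<times> branch_positions)"
  let ?X = "\<lambda>Z q. {(T, T') \<in> trees Z \<times> trees Z. fst (fst q) \<noteq> fst (snd q) \<and> vert Z T (Some (snd q)) = vert Z T (Some (fst q))}"
  have "(\<Sum>Z\<in>leaf_families. degen_count Z) \<le> (\<Sum>Z\<in>leaf_families. \<Sum>q\<in>?I. card (?X Z q))"
  proof (rule sum_mono)
    fix Z
    have "{(T, T') \<in> trees Z \<times> trees Z. degen Z T} \<subseteq> (\<Union>q\<in>?I. ?X Z q)" by (force simp: degen_def)
    then have "degen_count Z \<le> card (\<Union>q\<in>?I. ?X Z q)" unfolding degen_count_def by (intro card_mono finite_UN_I finite_pairs) auto
    also have "\<dots> \<le> (\<Sum>q\<in>?I. card (?X Z q))" by (rule card_UN_le) simp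
    finally show "degen_count Z \<le> (\<Sum>q\<in>?I. card (?X Z q))" .
  qed
  also have "\<dots> = (\<Sum>q\<in>?I. \<Sum>Z\<in>leaf_families. card (?X Z q))" by (rule sum.swap)
  also have "\<dots> \<le> (\<Sum>q\<in>?I. ?S)"
  proof (rule sum_mono)
    fix q assume q: "q \<in> ?I"
    obtain i b j b' where qe: "q = ((i, b), (j, b'))" by (metis surj_pair)
    have ij: "i < r" "j < r" "b \<in> branch_positions" "b' \<in> branch_positions" using q qe by auto
    show "(\<Sum>Z\<in>leaf_families. card (?X Z q)) \<le> ?S"
    proof (cases "i = j")
      case True
      then have z: "?X Z q = {}" for Z by (auto simp: qe)
      show ?thesis unfolding z by simp
    next
      case False
      let ?P = "\<lambda>w x x'. branch_vert w (fst x') (fst (snd x')) b' = branch_vert w (fst x) (fst (snd x)) b"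
      have "(\<Sum>Z\<in>leaf_families. card {(T, T') \<in> trees Z \<times> trees Z. ?P (fst T) (snd T i, Z i, snd T' i) (snd T j, Z j, snd T' j)}) \<le> ?S"
        by (rule sum_pairs_two_coords_le[where P = ?P, OF ij(1,2) False card_through]) (use ij in auto)
      moreover have "?X Z q = {(T, T') \<in> trees Z \<times> trees Z. ?P (fst T) (snd T i, Z i, snd T' i) (snd T j, Z j, snd T' j)}" for Z
        using False by (simp add: qe vert_def)
      ultimately show ?thesis by simp
    qed
  qed
  also have "\<dots> = (r * card branch_positions) ^ 2 * ?S" by (simp add: card_cartesian_product power2_eq_square)
  finally show ?thesis .
qed

definition C_degen :: "nat \<Rightarrow> nat" where
  "C_degen A = (A * (r * card branch_positions) ^ 2) ^ (r - 1) * (C6 * C8) ^ r * C6"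
definition C_clash :: "nat \<Rightarrow> nat" where
  "C_clash A = A * C6 ^ r + (A * hsz * C8) ^ r + (A ^ r * C6 + (2 * A * hsz * mid_weight A ^ t) ^ r * C6)"

lemma sum_degen_count_le: "A * (\<Sum>Z\<in>leaf_families. degen_count Z) \<le> second_moment + C_degen A * (n * D ^ r)"
proof -
  have "A * (\<Sum>Z\<in>leaf_families. degen_count Z) \<le> (A * (r * card branch_positions) ^ 2) * (\<Sum>w\<in>good. \<Sum>w'\<in>good. through_max * psi w w' ^ (r - 1))"
    using mult_le_mono2[OF sum_degen_count, of A] by (simp only: mult.assoc)
  also note through_bound
  finally show ?thesis by (simp only: C_degen_def mult_ac)
qed

lemma lite_exists: "\<exists>i<pair_ramsey. \<exists>j<pair_ramsey. i \<noteq> j \<and> lite (g (f i)) (g (f j))"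
proof -
  obtain i j where "i < pair_ramsey" "j < pair_ramsey" "i \<noteq> j" "nice (g (f i)) (g (f j)) undefined"
    using nice_exists[of "\<lambda>i. g (f i)" undefined] by blast
  then show ?thesis unfolding nice_def by blast
qed

text \<open>For the positions u and m, \<open>fiber_pair_sampling\<close> first makes the roots or
  centres light, at the cost of \<open>pair_ramsey ^ 2\<close>; then the clash bound for the type of
  position applies.\<close>

lemma sum_clash_count_le:
  assumes p: "p \<in> inner_positions"
  shows "A * (\<Sum>Z\<in>leaf_families. clash_count Z p) \<le> 2 * second_moment + C_clash (pair_ramsey ^ 2 * A) * (n * D ^ r)"
proof -
  let ?A = "pair_ramsey ^ 2 * A"
  let ?N = "n * D ^ r"
  have A: "A * x \<le> ?A * x" for x using pair_ramsey_ge_2 by simp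
  have lt: "A * (\<Sum>Z\<in>leaf_families. card {(T, T') \<in> trees Z \<times> trees Z. h Z T = h Z T'})
      \<le> ?A * (\<Sum>Z\<in>leaf_families. card {(T, T') \<in> trees Z \<times> trees Z. h Z T = h Z T' \<and> lite (g T) (g T')})" for h g
  proof -
    have "(\<Sum>Z\<in>leaf_families. card {(T, T') \<in> trees Z \<times> trees Z. h Z T = h Z T'})
      \<le> (\<Sum>Z\<in>leaf_families. pair_ramsey ^ 2 * card {(T, T') \<in> trees Z \<times> trees Z. h Z T = h Z T' \<and> lite (g T) (g T')})"
      by (intro sum_mono fiber_pair_sampling[where P = "\<lambda>T T'. lite (g T) (g T')"] finite_trees lite_exists)
    then have "A * (\<Sum>Z\<in>leaf_families. card {(T, T') \<in> trees Z \<times> trees Z. h Z T = h Z T'})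
      \<le> A * (pair_ramsey ^ 2 * (\<Sum>Z\<in>leaf_families. card {(T, T') \<in> trees Z \<times> trees Z. h Z T = h Z T' \<and> lite (g T) (g T')}))"
      unfolding sum_distrib_left[symmetric] by (rule mult_le_mono2)
    then show ?thesis by (simp only: mult_ac)
  qed
  have up: "x \<le> 2 * second_moment + C_clash ?A * ?N" if "x \<le> m * second_moment + c * ?N" "m \<le> 2" "c \<le> C_clash ?A" for x m c
    using that(1) mult_le_mono1[OF that(2), of second_moment] mult_le_mono1[OF that(3), of ?N] by linarith
  consider "p = None" | i where "p = Some (i, BU)" "i < r" | i where "p = Some (i, BY)" "i < r"
    | i j where "p = Some (i, BM j)" "i < r" "j < t" using p by (auto simp: inner_positions_def)
  then show ?thesis
  proof cases
    case 1
    have "A * (\<Sum>Z\<in>leaf_families. clash_count Z p) \<le> 0 * second_moment + ?A * C6 ^ r * ?N"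
      using order_trans[OF A clash_W[of ?A]] by (simp add: clash_count_def vert_def 1)
    then show ?thesis by (rule up) (simp_all add: C_clash_def)
  next
    case (2 i)
    have "A * (\<Sum>Z\<in>leaf_families. clash_count Z p) \<le> 1 * second_moment + (?A * C6 ^ r + (?A * hsz * C8) ^ r) * ?N"
      using order_trans[OF lt[of "\<lambda>Z T. mid (fst T) (snd T i)" fst] clash_U[OF 2(2), of ?A]]
      by (simp add: clash_count_def vert_def branch_vert_def 2)
    then show ?thesis by (rule up) (simp_all add: C_clash_def)
  next
    case (3 i)
    have "A * (\<Sum>Z\<in>leaf_families. clash_count Z p) \<le> 1 * second_moment + ?A ^ r * C6 * ?N"
      using order_trans[OF A clash_Y[OF 3(2), of ?A]] by (simp add: clash_count_def vert_def branch_vert_def 3)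
    then show ?thesis by (rule up) (simp_all add: C_clash_def)
  next
    case (4 i j)
    have "A * (\<Sum>Z\<in>leaf_families. clash_count Z p) \<le> 2 * second_moment + (?A ^ r * C6 + (2 * ?A * hsz * mid_weight ?A ^ t) ^ r * C6) * ?N"
      using order_trans[OF lt[of "\<lambda>Z T. mid (snd T i) (Z i j)" "\<lambda>T. snd T i"] clash_M[OF 4(2,3), of ?A]]
      by (simp add: clash_count_def vert_def branch_vert_def 4)
    then show ?thesis by (rule up) (simp_all add: C_clash_def)
  qed
qed

definition C_moment :: nat where
  "C_moment = C_degen ((2 * card inner_positions + 2) * (l + 1) ^ 2 * 2) + card inner_positions * C_clash (pair_ramsey ^ 2 * ((2 * card inner_positions + 2) * (l + 1) ^ 2 * (2 * card inner_positions)))"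

text \<open>After multiplication by 2 q + 2, with q inner positions, the right side contains the
  second moment 2 q + 1 times: once from degenerate trees and twice for each position. One copy is
  left over on the left side.\<close>

lemma second_moment_le: "second_moment \<le> C_moment * (n * D ^ r)"
proof -
  let ?q = "card inner_positions"
  let ?N = "2 * ?q + 2"
  let ?A = "?N * (l + 1) ^ 2 * 2"
  let ?B = "?N * (l + 1) ^ 2 * (2 * ?q)"
  let ?n = "n * D ^ r"
  have "?N * second_moment \<le> ?N * (\<Sum>Z\<in>leaf_families. (l + 1) ^ 2 * (2 * degen_count Z + 2 * ?q * (\<Sum>p\<in>inner_positions. clash_count Z p)))"
    unfolding sum_card_trees_square[symmetric] by (intro mult_le_mono2 sum_mono card_trees_square_le)
  also have "\<dots> = ?A * (\<Sum>Z\<in>leaf_families. degen_count Z) + ?B * (\<Sum>Z\<in>leaf_families. \<Sum>p\<in>inner_positions. clash_count Z p)"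
    by (simp only: sum.distrib sum_distrib_left[symmetric] distrib_left mult.assoc)
  also have "(\<Sum>Z\<in>leaf_families. \<Sum>p\<in>inner_positions. clash_count Z p) = (\<Sum>p\<in>inner_positions. \<Sum>Z\<in>leaf_families. clash_count Z p)" by (rule sum.swap)
  also have "?B * \<dots> = (\<Sum>p\<in>inner_positions. ?B * (\<Sum>Z\<in>leaf_families. clash_count Z p))" by (rule sum_distrib_left)
  also have "\<dots> \<le> (\<Sum>p\<in>inner_positions. 2 * second_moment + C_clash (pair_ramsey ^ 2 * ?B) * ?n)" by (intro sum_mono sum_clash_count_le)
  also have "\<dots> = ?q * (2 * second_moment + C_clash (pair_ramsey ^ 2 * ?B) * ?n)" by simp
  finally have "?N * second_moment \<le> (second_moment + C_degen ?A * ?n) + ?q * (2 * second_moment + C_clash (pair_ramsey ^ 2 * ?B) * ?n)"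
    using sum_degen_count_le[of ?A] by linarith
  then have "(2 * ?q + 1) * second_moment + second_moment \<le> (2 * ?q + 1) * second_moment + C_moment * ?n"
    unfolding C_moment_def by (simp add: algebra_simps)
  then show ?thesis by linarith
qed

text \<open>Any r branches at one root, repetitions included, form an element of
  \<open>trees\<close>; degeneracy is dealt with only in the second moment.\<close>

lemma sum_S_power_le: "(\<Sum>w\<in>good. card (S w) ^ r) \<le> (\<Sum>Z\<in>leaf_families. card (trees Z))"
proof -
  let ?L = "Sigma good (\<lambda>w. {..<r} \<rightarrow>\<^sub>E S w)"
  define g where "g = (\<lambda>(w::'a, f::nat \<Rightarrow> 'a \<times> (nat \<Rightarrow> 'a)). (\<lambda>i\<in>{..<r}. snd (f i), (w, \<lambda>i\<in>{..<r}. fst (f i))))"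
  have "card ?L \<le> card (Sigma leaf_families trees)"
  proof (rule card_inj_on_le[where f = g])
    show "inj_on g ?L"
    proof (rule inj_onI)
      fix x x' assume x: "x \<in> ?L" "x' \<in> ?L" "g x = g x'"
      obtain w f w' f' where xe: "x = (w, f)" "x' = (w', f')" by (metis surj_pair)
      have f: "f \<in> {..<r} \<rightarrow>\<^sub>E S w" "f' \<in> {..<r} \<rightarrow>\<^sub>E S w'" using x xe by auto
      have e: "w = w'" "(\<lambda>i\<in>{..<r}. snd (f i)) = (\<lambda>i\<in>{..<r}. snd (f' i))" "(\<lambda>i\<in>{..<r}. fst (f i)) = (\<lambda>i\<in>{..<r}. fst (f' i))"
        using x(3) xe by (auto simp: g_def)
      have "f i = f' i" if "i \<in> {..<r}" for i
        using fun_cong[OF e(2), of i] fun_cong[OF e(3), of i] that by (simp add: prod_eq_iff)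
      then have "f = f'" using f e(1) by (intro PiE_ext[of f "{..<r}" "\<lambda>_. S w"]) auto
      then show "x = x'" using e xe by simp
    qed
    show "g ` ?L \<subseteq> Sigma leaf_families trees"
    proof
      fix x assume "x \<in> g ` ?L"
      then obtain w f where w: "w \<in> good" and f: "f \<in> {..<r} \<rightarrow>\<^sub>E S w" and x: "x = g (w, f)" by auto
      define Z where "Z = (\<lambda>i\<in>{..<r}. snd (f i))"
      define Y where "Y = (\<lambda>i\<in>{..<r}. fst (f i))"
      have S: "(Y i, Z i) \<in> S w" if "i < r" for i using f that by (auto simp: Z_def Y_def)
      have "Z \<in> leaf_families"
        unfolding leaf_families_def
      proof (rule PiE_I)
        fix i assume "i \<in> {..<r}"
        then have "Z i \<in> {..<t} \<rightarrow>\<^sub>E nb2 (Y i)" using S[of i] S_D(4) by auto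
        then show "Z i \<in> {..<t} \<rightarrow>\<^sub>E V" using nb2_subset_V[of "Y i"] by (auto simp: PiE_iff)
      qed (simp add: Z_def)
      moreover have "(w, Y) \<in> trees Z" unfolding trees_def using w S S_D(2)[OF S] by (auto simp: Y_def)
      ultimately show "x \<in> Sigma leaf_families trees" by (simp add: x g_def Z_def Y_def)
    qed
    show "finite (Sigma leaf_families trees)" by (intro finite_SigmaI) auto
  qed
  moreover have "card ?L = (\<Sum>w\<in>good. card ({..<r} \<rightarrow>\<^sub>E S w))"
    by (rule card_SigmaI) (auto intro!: finite_PiE)
  moreover have "card (Sigma leaf_families trees) = (\<Sum>Z\<in>leaf_families. card (trees Z))" by (rule card_SigmaI) auto
  ultimately show ?thesis by (simp add: card_funcsetE)
qed

lemma card_leaf_families: "card leaf_families = n ^ (r * t)"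
proof -
  have "card leaf_families = card ({..<t} \<rightarrow>\<^sub>E V) ^ card {..<r}" unfolding leaf_families_def by (rule card_funcsetE) simp
  also have "card ({..<t} \<rightarrow>\<^sub>E V) = n ^ card {..<t}" by (rule card_funcsetE) simp
  finally show ?thesis by (simp only: card_lessThan power_mult[symmetric] mult.commute)
qed

definition C_large :: nat where "C_large = (2 * \<kappa>1) ^ (2 * r) * C_moment"

text \<open>The number of trees is at least of order n D^r. Its square is at most n^(r t) times the
  second moment, and one factor n D^r cancels.\<close>

lemma degree_bound_large:
  assumes "deg_min \<le> \<Delta>" "M * C9 \<le> \<Delta>"
  shows "n * D ^ r \<le> C_large * n ^ (r * t)"
proof -
  let ?P = "\<Sum>Z\<in>leaf_families. card (trees Z)"
  let ?X = "\<Sum>w\<in>good. card (S w) ^ r"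
  let ?c = "(2 * \<kappa>1) ^ r"
  have np: "0 < n" using n1 by simp
  have "(n * D) ^ r \<le> (2 * \<kappa>1 * (\<Sum>w\<in>good. card (S w))) ^ r" by (rule power_mono[OF many_S[OF assms]]) simp
  also have "\<dots> = ?c * (\<Sum>w\<in>good. card (S w)) ^ r" by (rule power_mult_distrib)
  also have "(\<Sum>w\<in>good. card (S w)) ^ r \<le> card good ^ (r - 1) * ?X" using r1 by (intro nat_power_sum_le) auto
  also have "\<dots> \<le> n ^ (r - 1) * ?P"
    using good_subset_V finV by (intro mult_le_mono power_mono card_mono sum_S_power_le) auto
  finally have a: "(n * D) ^ r \<le> ?c * (n ^ (r - 1) * ?P)" by simp
  have "n ^ (r - 1) * (n * D ^ r) = (n * D) ^ r" 
  proof -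
    have "n ^ (r - 1) * n = n ^ r" using r1 by (simp only: power_Suc2[symmetric]) simp
    then show ?thesis by (simp only: power_mult_distrib mult.assoc[symmetric])
  qed
  with a have "n ^ (r - 1) * (n * D ^ r) \<le> n ^ (r - 1) * (?c * ?P)" by (simp only: mult_ac)
  then have "n * D ^ r \<le> ?c * ?P" using np by simp
  then have "(n * D ^ r) ^ 2 \<le> (?c * ?P) ^ 2" by (rule power_mono) simp
  also have "\<dots> = ?c ^ 2 * ?P ^ 2" by (rule power_mult_distrib)
  also have "?P ^ 2 \<le> card leaf_families ^ (2 - 1) * (\<Sum>Z\<in>leaf_families. card (trees Z) ^ 2)" by (intro nat_power_sum_le) auto
  also have "\<dots> = n ^ (r * t) * second_moment" by (simp add: card_leaf_families sum_card_trees_square)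
  also have "\<dots> \<le> n ^ (r * t) * (C_moment * (n * D ^ r))" by (intro mult_le_mono2 second_moment_le)
  finally have "(n * D ^ r) * (n * D ^ r) \<le> ?c ^ 2 * (n ^ (r * t) * (C_moment * (n * D ^ r)))" by (simp add: power2_eq_square)
  also have "?c ^ 2 = (2 * \<kappa>1) ^ (2 * r)" by (simp only: power_mult[symmetric] mult.commute)
  finally have "(n * D ^ r) * (n * D ^ r) \<le> (C_large * n ^ (r * t)) * (n * D ^ r)" unfolding C_large_def by (simp only: mult_ac)
  moreover have "0 < n * D ^ r" using np \<Delta>1 by simp
  ultimately show ?thesis by (metis mult_le_cancel2)
qed

text \<open>The second summand covers degrees too small for \<open>degree_bound_large\<close>, where
  n <= n^(r t) suffices.\<close>

definition C_degree :: nat where "C_degree = C_large + (deg_min + M * C9) ^ ((2 * t + 2) * r)"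

lemma degree_bound: "n * \<Delta> ^ ((2 * t + 2) * r) \<le> C_degree * n ^ (r * t)"
proof (cases "deg_min \<le> \<Delta> \<and> M * C9 \<le> \<Delta>")
  case True
  then have "n * D ^ r \<le> C_large * n ^ (r * t)" by (intro degree_bound_large) auto
  also have "\<dots> \<le> C_degree * n ^ (r * t)" by (intro mult_le_mono1) (simp add: C_degree_def)
  finally show ?thesis by (simp only: power_mult)
next
  case False
  then have "\<Delta> \<le> deg_min + M * C9" by linarith
  then have "\<Delta> ^ ((2 * t + 2) * r) \<le> (deg_min + M * C9) ^ ((2 * t + 2) * r)" by (rule power_mono) simp
  also have "\<dots> \<le> C_degree" by (simp add: C_degree_def)
  finally have "n * \<Delta> ^ ((2 * t + 2) * r) \<le> n * C_degree" by (rule mult_le_mono2)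
  also have "n \<le> n ^ (r * t)"
  proof -
    have "1 \<le> r * t" using r1 t2 by (simp add: Suc_le_eq)
    then show ?thesis using power_increasing[of 1 "r * t" n] n1 by simp
  qed
  finally show ?thesis by (simp add: mult.commute)
qed

end

section \<open>Passing to an almost regular subgraph\<close>

text \<open>Ordered pairs: twice the number of edges when the relation is symmetric and
  irreflexive.\<close>

definition pairs :: "('a \<Rightarrow> 'a \<Rightarrow> bool) \<Rightarrow> 'a set \<Rightarrow> nat" where
  "pairs E U = card {(a, b) \<in> U \<times> U. E a b}"

lemma pairs_eq_sum: "finite U \<Longrightarrow> pairs E U = (\<Sum>a\<in>U. card {b \<in> U. E a b})"
proof -
  assume U: "finite U"
  have "{(a, b) \<in> U \<times> U. E a b} = Sigma U (\<lambda>a. {b \<in> U. E a b})" by auto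
  then show ?thesis using U by (simp add: pairs_def)
qed

lemma dense_subset:
  assumes V: "finite V" "V \<noteq> {}"
  shows "\<exists>U\<subseteq>V. U \<noteq> {} \<and> (\<forall>U'\<subseteq>V. U' \<noteq> {} \<longrightarrow>
    real (pairs E U') / real (card U') powr \<beta> \<le> real (pairs E U) / real (card U) powr \<beta>)"
proof -
  let ?S = "{U. U \<subseteq> V \<and> U \<noteq> {}}"
  let ?f = "\<lambda>U. real (pairs E U) / real (card U) powr \<beta>"
  have S: "finite ?S" "?S \<noteq> {}" using V by auto
  obtain U where U: "U \<in> ?S" "Max (?f ` ?S) = ?f U" by (rule obtains_MAX[OF S, of ?f]) (rule that, simp_all)
  then have "?f U' \<le> ?f U" if "U' \<in> ?S" for U' using Max_ge[of "?f ` ?S" "?f U'"] S(1) that by simp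
  then show ?thesis using U(1) by blast
qed

text \<open>Cut \<open>U\<close> into blocks \<open>B\<close> of size \<open>b\<close> and apply the density bound to each \<open>A \<union> B\<close>.\<close>

lemma sum_blocks_le:
  assumes U: "finite U" "A \<subseteq> U" "A \<noteq> {}"
    and b: "card A \<le> b" "1 \<le> b" and \<beta>: "\<beta> > 0"
    and max: "\<And>U'. U' \<subseteq> U \<Longrightarrow> U' \<noteq> {} \<Longrightarrow> real (pairs E U') \<le> c * real (card U') powr \<beta>" and c: "c \<ge> 0"
  shows "real (card {(a, x) \<in> A \<times> U. E a x}) \<le> (real (card U) / real b + 1) * (c * (2 * real b) powr \<beta>)"
proof -
  let ?m = "card U"
  let ?s = "?m div b + 1"
  obtain \<sigma> where \<sigma>: "bij_betw \<sigma> U {..<?m}" using ex_bij_betw_finite_nat[OF U(1)] by (metis atLeast0LessThan)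
  define B where "B j = {x \<in> U. \<sigma> x div b = j}" for j
  have cB: "card (B j) \<le> b" for j
  proof -
    have "\<sigma> ` B j \<subseteq> {j * b..<j * b + b}"
    proof
      fix z assume "z \<in> \<sigma> ` B j"
      then have "z div b = j" by (auto simp: B_def)
      moreover have "z = z div b * b + z mod b" "z mod b < b" using b(2) by simp_all
      ultimately show "z \<in> {j * b..<j * b + b}" by auto
    qed
    then have "card (\<sigma> ` B j) \<le> b" using card_mono[of "{j * b..<j * b + b}"] by simp
    moreover have "inj_on \<sigma> (B j)" using \<sigma> by (auto simp: bij_betw_def B_def inj_on_def)
    ultimately show ?thesis by (simp add: card_image)
  qed
  have fB: "finite (B j)" "B j \<subseteq> U" for j using U(1) by (auto simp: B_def)
  have fA: "finite A" using U by (metis finite_subset)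
  have cov: "{(a, x) \<in> A \<times> U. E a x} \<subseteq> (\<Union>j<?s. {(a, x) \<in> A \<times> B j. E a x})"
  proof
    fix p assume "p \<in> {(a, x) \<in> A \<times> U. E a x}"
    then obtain a x where p: "p = (a, x)" "a \<in> A" "x \<in> U" "E a x" by auto
    have "\<sigma> x < ?m" using \<sigma> p(3) by (auto simp: bij_betw_def)
    then have "\<sigma> x div b < ?s" by (simp add: div_le_mono le_imp_less_Suc)
    then show "p \<in> (\<Union>j<?s. {(a, x) \<in> A \<times> B j. E a x})" using p by (auto simp: B_def)
  qed
  have one: "real (card {(a, x) \<in> A \<times> B j. E a x}) \<le> c * (2 * real b) powr \<beta>" for j
  proof -
    have "card {(a, x) \<in> A \<times> B j. E a x} \<le> pairs E (A \<union> B j)"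
      unfolding pairs_def
      by (rule card_mono) (use fA fB in \<open>auto intro: finite_subset[of _ "(A \<union> B j) \<times> (A \<union> B j)"]\<close>)
    then have "real (card {(a, x) \<in> A \<times> B j. E a x}) \<le> real (pairs E (A \<union> B j))" by simp
    also have "\<dots> \<le> c * real (card (A \<union> B j)) powr \<beta>" using U fB by (intro max) auto
    also have "\<dots> \<le> c * (2 * real b) powr \<beta>"
    proof (intro mult_left_mono powr_mono2 c)
      have "card (A \<union> B j) \<le> card A + card (B j)" by (rule card_Un_le)
      then show "real (card (A \<union> B j)) \<le> 2 * real b" using b(1) cB[of j] by linarith
    qed (use \<beta> in auto)
    finally show ?thesis .
  qed
  have "card {(a, x) \<in> A \<times> U. E a x} \<le> card (\<Union>j<?s. {(a, x) \<in> A \<times> B j. E a x})"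
  proof (rule card_mono[OF _ cov])
    have "finite {(a, x) \<in> A \<times> B j. E a x}" for j
      by (rule finite_subset[of _ "A \<times> B j"]) (use fA fB in auto)
    then show "finite (\<Union>j<?s. {(a, x) \<in> A \<times> B j. E a x})" by blast
  qed
  also have "\<dots> \<le> (\<Sum>j<?s. card {(a, x) \<in> A \<times> B j. E a x})" by (rule card_UN_le) simp
  finally have "real (card {(a, x) \<in> A \<times> U. E a x}) \<le> real (\<Sum>j<?s. card {(a, x) \<in> A \<times> B j. E a x})"
    by (simp only: of_nat_le_iff)
  also have "\<dots> = (\<Sum>j<?s. real (card {(a, x) \<in> A \<times> B j. E a x}))" by (rule of_nat_sum)
  also have "\<dots> \<le> (\<Sum>j<?s. c * (2 * real b) powr \<beta>)" by (intro sum_mono one)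
  also have "\<dots> = real ?s * (c * (2 * real b) powr \<beta>)" by simp
  also have "\<dots> \<le> (real ?m / real b + 1) * (c * (2 * real b) powr \<beta>)"
  proof (intro mult_right_mono)
    have "real (?m div b) \<le> real ?m / real b" by (rule of_nat_div_le_of_nat)
    then show "real ?s \<le> real ?m / real b + 1" by simp
  qed (use c in auto)
  finally show ?thesis .
qed

text \<open>Let \<open>U\<close> maximise the number of edges divided by $|U|^{1+\alpha}$. If the few vertices of degree larger
  than $K$ times the average met a quarter of all edges, then adding one of the blocks above to them
  would give a denser set. So they can be deleted.\<close>

lemma almost_regular_subgraph:
  assumes V: "finite V" "V \<noteq> {}" and sE: "symp E" and E0: "pairs E V > 0"
    and \<alpha>: "\<alpha> > 0" and K: "real K \<ge> 4 * 16 powr (1 / \<alpha>)"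
  shows "\<exists>U A. U \<subseteq> V \<and> A \<subseteq> U \<and> U \<noteq> {} \<and>
    real (pairs E V) / real (card V) powr (1 + \<alpha>) \<le> real (pairs E U) / real (card U) powr (1 + \<alpha>) \<and>
    (\<forall>a\<in>A. real (card {b \<in> U. E a b}) \<le> real K * real (pairs E U) / real (card U)) \<and>
    pairs E U \<le> 2 * pairs E A"
proof -
  let ?\<beta> = "1 + \<alpha>"
  note sym = sympD[OF sE]
  obtain U where U: "U \<subseteq> V" "U \<noteq> {}" and max: "\<And>U'. U' \<subseteq> V \<Longrightarrow> U' \<noteq> {} \<Longrightarrow>
    real (pairs E U') / real (card U') powr ?\<beta> \<le> real (pairs E U) / real (card U) powr ?\<beta>"
    using dense_subset[OF V, of E ?\<beta>] by blast
  have fU: "finite U" using U(1) V(1) by (rule finite_subset)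
  define m where "m = card U"
  define P where "P = pairs E U"
  have m0: "m > 0" using fU U by (simp add: m_def card_gt_0_iff)
  have cV: "card V > 0" using V by (simp add: card_gt_0_iff)
  have P0: "P > 0"
  proof (rule ccontr)
    assume "\<not> P > 0"
    then have "real (pairs E V) / real (card V) powr ?\<beta> \<le> 0" using max[OF order_refl V(2)] by (simp add: P_def)
    moreover have "real (pairs E V) / real (card V) powr ?\<beta> > 0" using E0 cV by simp
    ultimately show False by linarith
  qed
  define c where "c = real P / real m powr ?\<beta>"
  have c0: "c \<ge> 0" by (simp add: c_def)
  have maxc: "real (pairs E U') \<le> c * real (card U') powr ?\<beta>" if "U' \<subseteq> U" "U' \<noteq> {}" for U'
  proof -
    have "card U' > 0" using that fU by (metis card_gt_0_iff finite_subset)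
    then have "real (card U') powr ?\<beta> > 0" by simp
    moreover have "real (pairs E U') / real (card U') powr ?\<beta> \<le> c"
      using max[of U'] that U by (simp add: c_def P_def m_def)
    ultimately show ?thesis by (simp add: pos_divide_le_eq)
  qed
  have K1: "real K \<ge> 4"
  proof -
    have "(16::real) powr 0 \<le> 16 powr (1 / \<alpha>)" using \<alpha> by (intro powr_mono) auto
    then show ?thesis using K by simp
  qed
  let ?d = "\<lambda>a. card {b \<in> U. E a b}"
  define H where "H = {a \<in> U. real (?d a) > real K * real P / real m}"
  have HU: "H \<subseteq> U" by (auto simp: H_def)
  have fH: "finite H" using HU fU by (rule finite_subset)
  have cH: "real (card H) * real K \<le> real m"
  proof -
    have "real (card H) * (real K * real P / real m) = (\<Sum>a\<in>H. real K * real P / real m)" by simp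
    also have "\<dots> \<le> (\<Sum>a\<in>H. real (?d a))" by (intro sum_mono) (simp add: H_def)
    also have "\<dots> \<le> (\<Sum>a\<in>U. real (?d a))" by (rule sum_mono2[OF fU HU]) simp
    also have "\<dots> = real P" by (simp add: P_def pairs_eq_sum[OF fU])
    finally have "(real (card H) * real K) * real P \<le> real m * real P" using m0 by (simp add: field_simps)
    then show ?thesis using P0 by simp
  qed
  let ?T = "card {(a, x) \<in> H \<times> U. E a x}"
  have T: "real ?T \<le> real P / 4"
  proof (cases "H = {}")
    case False
    \<comment> \<open>At most m / K vertices have high degree; \<open>b\<close> exceeds their number
      and is at most 2 m / K.\<close>
    define b where "b = m div K + 1"
    have h1: "card H \<ge> 1" using False fH by (simp add: card_gt_0_iff Suc_le_eq)
    have "card H * K \<le> m" using cH by (metis of_nat_le_iff of_nat_mult)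
    then have hb: "card H \<le> m div K" using K1 by (simp add: less_eq_div_iff_mult_less_eq)
    have mK: "real K \<le> real m" 
    proof -
      have "1 * real K \<le> real (card H) * real K" by (intro mult_right_mono) (use h1 in auto)
      then show ?thesis using cH by linarith
    qed
    have b1: "real b \<le> 2 * (real m / real K)"
    proof -
      have "real (m div K) \<le> real m / real K" by (rule of_nat_div_le_of_nat)
      moreover have "1 \<le> real m / real K" using mK K1 by simp
      ultimately show ?thesis by (simp add: b_def)
    qed
    have bm: "real b \<le> real m"
    proof -
      have "real m / real K \<le> real m / 2" using K1 by (intro divide_left_mono) auto
      then have "2 * (real m / real K) \<le> real m" by linarith
      with b1 show ?thesis by (rule order_trans)
    qed
    have bp: "real b \<ge> 1" by (simp add: b_def)
    have "real ?T \<le> (real (card U) / real b + 1) * (c * (2 * real b) powr ?\<beta>)"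
      by (rule sum_blocks_le[OF fU HU False _ _ _ maxc c0]) (use hb \<alpha> in \<open>auto simp: b_def\<close>)
    also have "\<dots> \<le> (2 * (real m / real b)) * (c * (2 * real b) powr ?\<beta>)"
    proof (intro mult_right_mono)
      have "1 \<le> real m / real b" using bm bp by simp
      then show "real (card U) / real b + 1 \<le> 2 * (real m / real b)" by (simp add: m_def)
    qed (use c0 in simp)
    also have "\<dots> = 4 * real P * (2 * real b / real m) powr \<alpha>"
      using m0 bp by (simp add: c_def powr_add powr_divide)
    \<comment> \<open>Since 2 b / m <= 4 / K <= 16^(-1/\<alpha>), the power is at most 1 / 16; this
      is the origin of the lower bound on \<open>K\<close>.\<close>
    also have "\<dots> \<le> 4 * real P * (1 / 16)"
    proof (intro mult_left_mono)
      have "2 * real b / real m \<le> 4 / real K"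
      proof -
        have "2 * real b / real m \<le> 2 * (2 * (real m / real K)) / real m"
          by (intro divide_right_mono mult_left_mono b1) auto
        then show ?thesis using m0 by simp
      qed
      also have "\<dots> \<le> 4 / (4 * 16 powr (1 / \<alpha>))" using K K1 by (intro divide_left_mono) auto
      also have "\<dots> = 1 / 16 powr (1 / \<alpha>)" by simp
      finally have "(2 * real b / real m) powr \<alpha> \<le> (1 / 16 powr (1 / \<alpha>)) powr \<alpha>"
        using \<alpha> by (intro powr_mono2) auto
      also have "\<dots> = 1 / 16" using \<alpha> by (simp add: powr_divide powr_powr)
      finally show "(2 * real b / real m) powr \<alpha> \<le> 1 / 16" .
    qed simp
    finally show ?thesis by simp
  qed simp
  \<comment> \<open>A lost pair has its first or its second entry in \<open>H\<close>, so at most 2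
    T <= P / 2 pairs are lost.\<close>
  have "{(a, b) \<in> U \<times> U. E a b} \<subseteq> {(a, b) \<in> (U - H) \<times> (U - H). E a b} \<union> ({(a, x) \<in> H \<times> U. E a x} \<union> prod.swap ` {(a, x) \<in> H \<times> U. E a x})"
    using sym by (auto simp: image_iff)
  moreover have f1: "finite {(a, b) \<in> (U - H) \<times> (U - H). E a b}"
    by (rule finite_subset[of _ "U \<times> U"]) (use fU in auto)
  moreover have f2: "finite {(a, x) \<in> H \<times> U. E a x}"
    by (rule finite_subset[of _ "U \<times> U"]) (use fU HU in auto)
  ultimately have "P \<le> card ({(a, b) \<in> (U - H) \<times> (U - H). E a b} \<union> ({(a, x) \<in> H \<times> U. E a x} \<union> prod.swap ` {(a, x) \<in> H \<times> U. E a x}))"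
    unfolding P_def pairs_def by (intro card_mono finite_UnI finite_imageI)
  also have "\<dots> \<le> pairs E (U - H) + (?T + card (prod.swap ` {(a, x) \<in> H \<times> U. E a x}))"
    unfolding pairs_def by (intro order_trans[OF card_Un_le] add_left_mono card_Un_le)
  also have "\<dots> \<le> pairs E (U - H) + (?T + ?T)" by (intro add_left_mono card_image_le f2)
  finally have "real P \<le> real (pairs E (U - H)) + 2 * real ?T" by (simp flip: of_nat_add of_nat_mult)
  then have "real P \<le> 2 * real (pairs E (U - H))" using T by linarith
  then have half: "pairs E U \<le> 2 * pairs E (U - H)" unfolding P_def by linarith
  show ?thesis
  proof (rule exI[of _ U], rule exI[of _ "U - H"], intro conjI)
    show "real (pairs E V) / real (card V) powr ?\<beta> \<le> real (pairs E U) / real (card U) powr ?\<beta>"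
      by (rule max[OF order_refl V(2)])
    show "\<forall>a\<in>U - H. real (card {b \<in> U. E a b}) \<le> real K * real (pairs E U) / real (card U)"
      by (auto simp: H_def P_def m_def not_less)
  qed (use U half in auto)
qed

text \<open>With N = (2 t + 2) r the degree bound becomes \<Delta>^N <= F m^(r t - 1), and (r t - 1)
  / N is \<alpha>. The constant is fixed before V and E.\<close>

lemma pairs_bound:
  fixes l r t :: nat
  assumes lrt: "l \<ge> 1" "t \<ge> 2" "r \<ge> 7" "r \<ge> t + 1"
  defines "\<alpha> \<equiv> (real r * real t - 1) / (2 * real r * real t + 2 * real r)"
  obtains C where "C \<ge> 0" and "\<And>V (E :: 'a \<Rightarrow> 'a \<Rightarrow> bool). finite V \<Longrightarrow> (\<And>a b. E a b \<Longrightarrow> E b a) \<Longrightarrow> (\<And>a. \<not> E a a) \<Longrightarrow>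
    \<not> embeds l r t E \<Longrightarrow> real (pairs E V) \<le> C * real (card V) powr (1 + \<alpha>)"
proof -
  define N where "N = (2 * t + 2) * r"
  have rt1: "r * t \<ge> 2" using lrt mult_le_mono[of 1 r 2 t] by simp
  have N0: "N > 0" using lrt by (simp add: N_def)
  have \<alpha>: "\<alpha> = real (r * t - 1) / real N"
  proof -
    have "real (r * t - 1) = real r * real t - 1" using rt1 lrt by (subst of_nat_diff) (auto simp: Suc_le_eq)
    then show ?thesis by (simp add: \<alpha>_def N_def algebra_simps)
  qed
  have \<alpha>0: "\<alpha> > 0" using rt1 N0 by (simp add: \<alpha>)
  define K where "K = nat \<lceil>4 * 16 powr (1 / \<alpha>)\<rceil>"
  have K: "real K \<ge> 4 * 16 powr (1 / \<alpha>)" unfolding K_def by linarith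
  \<comment> \<open>Outside the locale the constant visibly depends only on l, r, t and the
    regularity factor, which is 2 K because at least half of the pairs survive.\<close>
  define F where "F = dense_host.C_degree l r t (2 * K)"
  define C where "C = 2 * real F powr (1 / real N)"
  have "real (pairs E V) \<le> C * real (card V) powr (1 + \<alpha>)"
    if V: "finite V" and sym: "\<And>a b. E a b \<Longrightarrow> E b a" and irr: "\<And>a. \<not> E a a" and free: "\<not> embeds l r t E"
    for V and E :: "'a \<Rightarrow> 'a \<Rightarrow> bool"
  proof (cases "pairs E V > 0")
    case True
    then have Vne: "V \<noteq> {}" by (auto simp: pairs_def)
    have sE: "symp E" by (rule sympI) (rule sym)
    obtain U A where U: "U \<subseteq> V" "A \<subseteq> U" "U \<noteq> {}"
      and dens: "real (pairs E V) / real (card V) powr (1 + \<alpha>) \<le> real (pairs E U) / real (card U) powr (1 + \<alpha>)"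
      and dA: "\<forall>a\<in>A. real (card {b \<in> U. E a b}) \<le> real K * real (pairs E U) / real (card U)"
      and half: "pairs E U \<le> 2 * pairs E A"
      using almost_regular_subgraph[OF V Vne sE True \<alpha>0 K] by (elim exE conjE)
    define m where "m = card U"
    define P where "P = pairs E U"
    have fU: "finite U" using U(1) V by (rule finite_subset)
    have m0: "m > 0" using fU U by (simp add: m_def card_gt_0_iff)
    have cV: "card V > 0" using V Vne by (simp add: card_gt_0_iff)
    have P0: "P > 0"
    proof (rule ccontr)
      assume "\<not> P > 0"
      then have "real (pairs E V) / real (card V) powr (1 + \<alpha>) \<le> 0" using dens by (simp add: P_def)
      moreover have "real (pairs E V) / real (card V) powr (1 + \<alpha>) > 0" using True cV by simp
      ultimately show False by linarith
    qed
    \<comment> \<open>Vertices outside \<open>A\<close> stay in the host as isolated vertices, so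
      its order remains m and the density of \<open>U\<close> can be used.\<close>
    define E' where "E' a b \<longleftrightarrow> E a b \<and> a \<in> A \<and> b \<in> A" for a b
    \<comment> \<open>The real degree bound. Rounding it down to \<open>\<Delta>\<close> loses at
      most a factor 2 since \<Delta> >= 1, whence the 2 in \<open>C\<close>.\<close>
    define x where "x = real K * real P / real m"
    define \<Delta> where "\<Delta> = nat \<lfloor>x\<rfloor>"
    have deg: "card {u. E' v u} \<le> \<Delta>" for v
    proof (cases "v \<in> A")
      case v: True
      have "card {u. E' v u} \<le> card {b \<in> U. E v b}" using U fU by (intro card_mono) (auto simp: E'_def)
      then have "real (card {u. E' v u}) \<le> x" using bspec[OF dA v] by (simp add: x_def P_def m_def)
      then show ?thesis unfolding \<Delta>_def by (simp add: le_nat_iff le_floor_iff)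
    next
      case False
      then show ?thesis by (simp add: E'_def)
    qed
    have sumE': "(\<Sum>v\<in>U. card {u. E' v u}) = pairs E A"
    proof -
      have "(\<Sum>v\<in>U. card {u. E' v u}) = (\<Sum>v\<in>A. card {u. E' v u})"
        by (rule sum.mono_neutral_right[OF fU U(2)]) (simp add: E'_def)
      also have "\<dots> = (\<Sum>v\<in>A. card {b \<in> A. E v b})"
        by (rule sum.cong[OF refl]) (auto simp: E'_def intro!: arg_cong[where f = card])
      also have "\<dots> = pairs E A" using U fU by (subst pairs_eq_sum) (auto intro: finite_subset)
      finally show ?thesis .
    qed
    have \<Delta>1: "\<Delta> \<ge> 1"
    proof (rule ccontr)
      assume "\<not> \<Delta> \<ge> 1"
      then have "card {u. E' v u} = 0" for v using deg[of v] by linarith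
      then have "pairs E A = 0" using sumE' by simp
      then show False using half P0 by (simp add: P_def)
    qed
    have x\<Delta>: "real \<Delta> \<le> x" "x \<le> 2 * real \<Delta>"
      using \<Delta>1 unfolding \<Delta>_def by linarith+
    interpret host U E' l r t \<Delta>
    proof
      show "\<not> embeds l r t E'" using free unfolding embeds_def E'_def by blast
    qed (use fU sym irr U deg \<Delta>1 lrt in \<open>auto simp: E'_def\<close>)
    interpret dense_host U E' l r t \<Delta> "2 * K"
    proof
      have "real m * real \<Delta> \<le> real m * x" by (intro mult_left_mono x\<Delta>) simp
      also have "\<dots> = real K * real P" using m0 by (simp add: x_def)
      finally have "m * \<Delta> \<le> K * P" by (metis of_nat_le_iff of_nat_mult)
      also have "\<dots> \<le> K * (2 * pairs E A)" using half unfolding P_def by (rule mult_le_mono2)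
      finally show "card U * \<Delta> \<le> 2 * K * (\<Sum>v\<in>U. card (nb v))"
        by (simp add: nb_def sumE' m_def)
    qed (use U lrt in auto)
    have "m * \<Delta> ^ N \<le> F * m ^ (r * t)" using degree_bound by (simp add: m_def N_def F_def)
    also have "m ^ (r * t) = m * m ^ (r * t - 1)" 
    proof -
      have "Suc (r * t - 1) = r * t" using rt1 by linarith
      then show ?thesis by (simp only: power_Suc[symmetric])
    qed
    finally have "m * \<Delta> ^ N \<le> m * (F * m ^ (r * t - 1))" by (simp only: mult_ac)
    then have d: "\<Delta> ^ N \<le> F * m ^ (r * t - 1)" using m0 by simp
    have "real \<Delta> = (real \<Delta> powr real N) powr (1 / real N)" using N0 by (simp add: powr_powr)
    also have "real \<Delta> powr real N = real (\<Delta> ^ N)" using \<Delta>1 by (simp add: powr_realpow)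
    also have "\<dots> powr (1 / real N) \<le> real (F * m ^ (r * t - 1)) powr (1 / real N)"
      using d by (intro powr_mono2) (simp_all only: of_nat_le_iff of_nat_0_le_iff, simp_all)
    also have "\<dots> = real F powr (1 / real N) * (real m powr real (r * t - 1)) powr (1 / real N)"
      using m0 by (simp add: powr_mult powr_realpow)
    also have "(real m powr real (r * t - 1)) powr (1 / real N) = real m powr \<alpha>" by (simp add: powr_powr \<alpha>)
    finally have d2: "real \<Delta> \<le> real F powr (1 / real N) * real m powr \<alpha>" .
    have K1: "real K \<ge> 1"
    proof -
      have "(16::real) powr 0 \<le> 16 powr (1 / \<alpha>)" using \<alpha>0 by (intro powr_mono) auto
      then show ?thesis using K by simp
    qed
    have "real P / real m \<le> x" using K1 mult_right_mono[OF K1, of "real P / real m"] by (simp add: x_def)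
    also have "\<dots> \<le> C * real m powr \<alpha>" using x\<Delta>(2) d2 by (simp add: C_def)
    finally have "real P \<le> C * (real m powr \<alpha> * real m)" using m0 by (simp add: pos_divide_le_eq)
    then have "real P \<le> C * real m powr (1 + \<alpha>)" using m0 by (simp add: powr_add mult.commute)
    then have "real P / real m powr (1 + \<alpha>) \<le> C" using m0 by (simp add: pos_divide_le_eq)
    then have "real (pairs E V) / real (card V) powr (1 + \<alpha>) \<le> C" using dens by (simp add: P_def m_def)
    then show ?thesis using cV by (simp add: pos_divide_le_eq)
  qed (simp add: C_def)
  then show thesis by (intro that[of C]) (simp_all add: C_def)
qed

section \<open>The graph \<open>H\<close>\<close>

text \<open>Translates the names used in the proof into vertices of \<open>H_graph\<close>: a
  subdivision vertex is the tree edge it lies on, and leaves carry no copy number.\<close>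

fun hvert_copy :: "hvert \<Rightarrow> (tree_vertex + tree_vertex set) + (tree_vertex + tree_vertex set) \<times> nat" where
  "hvert_copy (HW c) = Inr (Inl VW, c)"
| "hvert_copy (HU c i) = Inr (Inr {VW, VY i}, c)"
| "hvert_copy (HY c i) = Inr (Inl (VY i), c)"
| "hvert_copy (HM c i j) = Inr (Inr {VY i, VZ i j}, c)"
| "hvert_copy (HZ i j) = Inl (Inl (VZ i j))"

lemma inj_hvert_copy: "inj hvert_copy"
proof (rule injI)
  fix x y assume "hvert_copy x = hvert_copy y"
  then show "x = y" by (cases x; cases y) (auto simp: doubleton_eq_iff)
qed

lemma copy_map_leaves [simp]:
  "copy_map (sub_tree_leaves r t) c (Inl VW) = Inr (Inl VW, c)"
  "copy_map (sub_tree_leaves r t) c (Inl (VY i)) = Inr (Inl (VY i), c)"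
  "copy_map (sub_tree_leaves r t) c (Inr e) = Inr (Inr e, c)"
  "i < r \<Longrightarrow> j < t \<Longrightarrow> copy_map (sub_tree_leaves r t) c (Inl (VZ i j)) = Inl (Inl (VZ i j))"
  by (auto simp: copy_map_def sub_tree_leaves_def)

lemma verts_H_graph: "verts (H_graph l r t) \<subseteq> hvert_copy ` hverts l r t"
proof
  fix x assume "x \<in> verts (H_graph l r t)"
  then obtain c v where c: "c < l" "v \<in> verts (sub_tree r t)" "x = copy_map (sub_tree_leaves r t) c v"
    by (auto simp: H_graph_def rooted_power_def)
  have "v = Inl VW \<or> (\<exists>i<r. v = Inl (VY i)) \<or> (\<exists>i<r. \<exists>j<t. v = Inl (VZ i j)) \<or>
     (\<exists>i<r. v = Inr {VW, VY i}) \<or> (\<exists>i<r. \<exists>j<t. v = Inr {VY i, VZ i j})"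
    using c(2) by (auto simp: sub_tree_def subdivision_def tree_def)
  then have "\<exists>h\<in>hverts l r t. x = hvert_copy h"
  proof (elim disjE exE conjE)
    assume "v = Inl VW"
    then show ?thesis using c by (intro bexI[of _ "HW c"]) (auto simp: hverts_def)
  next
    fix i assume "i < r" "v = Inl (VY i)"
    then show ?thesis using c by (intro bexI[of _ "HY c i"]) (auto simp: hverts_def)
  next
    fix i j assume "i < r" "j < t" "v = Inl (VZ i j)"
    then show ?thesis using c by (intro bexI[of _ "HZ i j"]) (auto simp: hverts_def)
  next
    fix i assume "i < r" "v = Inr {VW, VY i}"
    then show ?thesis using c by (intro bexI[of _ "HU c i"]) (auto simp: hverts_def)
  next
    fix i j assume "i < r" "j < t" "v = Inr {VY i, VZ i j}"
    then show ?thesis using c by (intro bexI[of _ "HM c i j"]) (auto simp: hverts_def)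
  qed
  then show "x \<in> hvert_copy ` hverts l r t" by blast
qed

lemma edges_H_graph_cases:
  assumes "e \<in> edges (H_graph l r t)"
  obtains c i where "c < l" "i < r" "e = hvert_copy ` {HW c, HU c i} \<or> e = hvert_copy ` {HU c i, HY c i}"
  | c i j where "c < l" "i < r" "j < t" "e = hvert_copy ` {HY c i, HM c i j} \<or> e = hvert_copy ` {HM c i j, HZ i j}"
proof -
  obtain c v d where c: "c < l" and d: "d \<in> edges (tree r t)" "v \<in> d"
    and e: "e = copy_map (sub_tree_leaves r t) c ` {Inl v, Inr d}"
    using assms by (auto simp: H_graph_def rooted_power_def sub_tree_def subdivision_def)
  consider i where "i < r" "d = {VW, VY i}" | i j where "i < r" "j < t" "d = {VY i, VZ i j}"
    using d(1) by (auto simp: tree_def)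
  then show thesis
  proof cases
    case 1
    then have "e = hvert_copy ` {HW c, HU c i} \<or> e = hvert_copy ` {HU c i, HY c i}"
      using d(2) unfolding e by auto
    then show thesis using that(1)[OF c 1(1)] by blast
  next
    case 2
    then have "e = hvert_copy ` {HY c i, HM c i j} \<or> e = hvert_copy ` {HM c i j, HZ i j}"
      using d(2) unfolding e by auto
    then show thesis using that(2)[OF c 2(1,2)] by blast
  qed
qed

lemma contains_H_graph:
  assumes lr: "l \<ge> 1" "r \<ge> 1" and G: "simple_graph G" and emb: "embeds l r t (\<lambda>a b. {a, b} \<in> edges G)"
  shows "contains_subgraph G (H_graph l r t)"
proof -
  obtain \<phi> where inj: "inj_on \<phi> (hverts l r t)" and
    E: "\<And>c i. c < l \<Longrightarrow> i < r \<Longrightarrow> {\<phi> (HW c), \<phi> (HU c i)} \<in> edges G"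
      "\<And>c i. c < l \<Longrightarrow> i < r \<Longrightarrow> {\<phi> (HU c i), \<phi> (HY c i)} \<in> edges G"
      "\<And>c i j. c < l \<Longrightarrow> i < r \<Longrightarrow> j < t \<Longrightarrow> {\<phi> (HY c i), \<phi> (HM c i j)} \<in> edges G"
      "\<And>c i j. c < l \<Longrightarrow> i < r \<Longrightarrow> j < t \<Longrightarrow> {\<phi> (HM c i j), \<phi> (HZ i j)} \<in> edges G"
    using emb unfolding embeds_def by blast
  have edge_verts: "a \<in> verts G" "b \<in> verts G" if "{a, b} \<in> edges G" for a b
    using G that by (auto simp: simple_graph_def)
  define f where "f x = \<phi> (inv hvert_copy x)" for x
  have f: "f (hvert_copy h) = \<phi> h" for h by (simp add: f_def inv_f_f[OF inj_hvert_copy])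
  \<comment> \<open>Every vertex of H lies on an edge; for the roots this uses branch 0, for the
    leaves copy 0.\<close>
  have \<phi>V: "\<phi> h \<in> verts G" if "h \<in> hverts l r t" for h
  proof (cases h)
    case (HW c)
    then show ?thesis using that lr edge_verts[OF E(1)[of c 0]] by (auto simp: hverts_def)
  next
    case (HU c i)
    then show ?thesis using that edge_verts[OF E(1)[of c i]] by (auto simp: hverts_def)
  next
    case (HY c i)
    then show ?thesis using that edge_verts[OF E(2)[of c i]] by (auto simp: hverts_def)
  next
    case (HM c i j)
    then show ?thesis using that edge_verts[OF E(3)[of c i j]] by (auto simp: hverts_def)
  next
    case (HZ i j)
    then show ?thesis using that lr edge_verts[OF E(4)[of 0 i j]] by (auto simp: hverts_def)
  qed
  show ?thesis
    unfolding contains_subgraph_def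
  proof (intro exI[of _ f] conjI ballI)
    have "inj_on f (hvert_copy ` hverts l r t)"
      using inj by (auto simp: inj_on_def f)
    then show "inj_on f (verts (H_graph l r t))" by (rule inj_on_subset[OF _ verts_H_graph])
    show "f ` verts (H_graph l r t) \<subseteq> verts G" using verts_H_graph[of l r t] \<phi>V f by force
    fix e assume "e \<in> edges (H_graph l r t)"
    then show "f ` e \<in> edges G"
      by (rule edges_H_graph_cases) (auto simp: f E simp del: hvert_copy.simps)
  qed
qed

theorem theorem1p7:
  fixes l r t :: nat
  assumes "l \<ge> 1" and "r \<ge> 1" and "t \<ge> 2" and "r \<ge> 2 * t + 3"
  shows "(\<lambda>n. real (ex n (H_graph l r t))) \<in>
           O(\<lambda>n. real n powr (1 + (real r * real t - 1) / (2 * real r * real t + 2 * real r)))"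
proof -
  let ?\<alpha> = "(real r * real t - 1) / (2 * real r * real t + 2 * real r)"
  \<comment> \<open>r >= 7 is for \<open>through_bound\<close>, r >= t + 1 for
    \<open>sum_k_r\<close>.\<close>
  have "t \<ge> 2" "r \<ge> 7" "r \<ge> t + 1" using assms by auto
  then obtain C where C: "\<And>V (E :: nat \<Rightarrow> nat \<Rightarrow> bool). finite V \<Longrightarrow> (\<And>a b. E a b \<Longrightarrow> E b a) \<Longrightarrow> (\<And>a. \<not> E a a) \<Longrightarrow>
    \<not> embeds l r t E \<Longrightarrow> real (pairs E V) \<le> C * real (card V) powr (1 + ?\<alpha>)"
    using pairs_bound[of l t r] assms(1) by blast
  have "real (ex n (H_graph l r t)) \<le> C * real n powr (1 + ?\<alpha>)" for n
  proof -
    obtain G :: "nat graph" where G: "simple_graph G" "card (verts G) = n"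
      "\<not> contains_subgraph G (H_graph l r t)" "card (edges G) = ex n (H_graph l r t)"
      using ex_attained[OF edges_H_graph[OF assms(1,2)]] by blast
    let ?E = "\<lambda>a b. {a, b} \<in> edges G"
    have fin: "finite (verts G)" using G(1) by (simp add: simple_graph_def)
    have "edges G \<subseteq> (\<lambda>(a, b). {a, b}) ` {(a, b) \<in> verts G \<times> verts G. ?E a b}"
    proof
      fix e assume e: "e \<in> edges G"
      then have "card e = 2" "e \<subseteq> verts G" using G(1) by (auto simp: simple_graph_def)
      then obtain a b where "e = {a, b}" by (auto simp: card_2_iff)
      then show "e \<in> (\<lambda>(a, b). {a, b}) ` {(a, b) \<in> verts G \<times> verts G. ?E a b}"
        using e \<open>e \<subseteq> verts G\<close> by (intro image_eqI[of _ _ "(a, b)"]) auto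
    qed
    then have "card (edges G) \<le> pairs ?E (verts G)"
      unfolding pairs_def by (rule surj_card_le[rotated]) (rule finite_subset[of _ "verts G \<times> verts G"], use fin in auto)
    moreover have "real (pairs ?E (verts G)) \<le> C * real (card (verts G)) powr (1 + ?\<alpha>)"
    proof (rule C[OF fin])
      show "\<not> embeds l r t ?E" using contains_H_graph[OF assms(1,2) G(1)] G(3) by blast
      show "\<not> ?E a a" for a using G(1) by (auto simp: simple_graph_def)
    qed (simp add: insert_commute)
    ultimately show ?thesis using G(2,4) by simp
  qed
  then show ?thesis by (intro bigoI[of _ C] always_eventually allI) simp
qed

end
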